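(* For any operadic category $\mathbb{O}$, the pre-simplicial symmetric strict monoidal groupoid $\mathrm{N}_{\mathrm{opd}}(\mathbb{O})$ (the operadic nerve, with face operators $d_i$, degeneracy operators $s_i$ and invertible monoidal $2$-cells $\beta_r$ as defined in the context) is a coherent pseudo-simplicial symmetric strict monoidal groupoid whose only nontrivial $2$-cells are the $\beta_r$. That is: all simplicial identities except those equating $d_{r+1}d_{r+1}$ with $d_{r+1}d_{r+2}$ as functors from degree $r+2$ to degree $r$ (two consecutive top face operators) hold strictly, and the $\beta_r: d_{r+1}d_{r+1}\Rightarrow d_{r+1}d_{r+2}$ ($r\ge 0$) satisfy all the coherence equations of a pseudo-simplicial object.
   Context: FINITE ORDINALS. $\mathbb{F}$ is the category with objects $\underline n=\{1<\dots<n\}$ ($n\ge 0$) and all set maps as morphisms. For $g:\underline n\to\underline k$ and $i\in\underline k$, $g^{-1}(i)$ denotes the object of $\mathbb{F}$ with the cardinality of $\{j\in\underline n: g(j)=i\}$, and $\epsilon_{g,i}:g^{-1}(i)\to\underline n$ the unique order-preserving injection with image $\{j: g(j)=i\}$. For $f:\underline m\to\underline n$, $f^g_i:(gf)^{-1}(i)\to g^{-1}(i)$ is the unique map with $\epsilon_{g,i}f^g_i=f\epsilon_{gf,i}$. $\pi_g:\underline n\to\sum_{i=1}^k g^{-1}(i)$ (ordinal sum) is the bijection whose inverse restricts to $\epsilon_{g,i}$ on the $i$-th summand. OPERADIC CATEGORY. An operadic category is a small category $\mathbb{O}$ with: (D1) a chosen terminal object in each connected component (chosen local terminals); $\tau_R:R\to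 U_R$ denotes the unique map to the chosen terminal of the component of $R$; (D2) a cardinality functor $|\cdot|:\mathbb{O}\to\mathbb{F}$; (D3) for each object $R$ and $i\in|R|$ a fibre functor $\varphi_{R,i}:\mathbb{O}/R\to\mathbb{O}$, written $(g:S\to R)\mapsto g^{-1}(i)$ on objects and $(f:gf\to g)\mapsto (f^g_i:(gf)^{-1}(i)\to g^{-1}(i))$ on morphisms. Axioms: (A1) if $R$ is a local terminal then $|R|=\underline 1$; (A2) $(\mathrm{id}_R)^{-1}(i)$ is a chosen local terminal for all $R$, $i\in|R|$; (A3) $|g^{-1}(i)|=|g|^{-1}(i)$ and $|f^g_i|=|f|^{|g|}_i$; (A4) $\tau_R^{-1}(1)=R$, and for $g:S\to R$ the fibre map of $g$ with respect to $\tau_R$ at $1$ is $g$; (A5) for $T\xrightarrow{f}S\xrightarrow{g}R$, $i\in|R|$, $j\in|g|^{-1}(i)$ and $\epsilon j:=\epsilon_{|g|,i}(j)$, one has $(f^g_i)^{-1}(j)=f^{-1}(\epsilon j)$, and for any further $h:Q\to T$, $(h^{gf}_i)^{f^g_i}_j=h^f_{\epsilon j}$. SYMMETRIC MONOIDAL GROUPOID MONAD. For a groupoid (or set) $A$, $\mathsf{S}A$ is the free symmetric strict monoidal groupoid on $A$: objects are finite lists in $A$; a morphism $(x_i)_{i\in\underline n}\to(y_i)_{i\in\underline n}$ is a permutation $\rho$ of $\underline n$ with arrows $x_i\to y_{\rho i}$ in $A$ (so for a set $A$: a permutation with $x_i=y_{\rho i}$). The monoidal product is concatenation; elements of $A$,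 as one-element lists, are the monoidal generators. A symmetric strict monoidal functor out of $\mathsf{S}A$, and a monoidal natural transformation between two such, are determined by their values on generators. OPERADIC NERVE. $\pi_0(\mathbb{O})$ is the set of connected components and, for $m\ge0$, $\mathbb{O}_m$ the set of chains of $m$ composable morphisms. Put $\mathrm{N}_{\mathrm{opd}}(\mathbb{O})_0=\mathsf{S}\pi_0(\mathbb{O})$ and $\mathrm{N}_{\mathrm{opd}}(\mathbb{O})_r=\mathsf{S}\mathbb{O}_{r-1}$ for $r\ge1$; a generator in degree $r\ge 1$ is written $p=(T_r\xrightarrow{f_{r-1}}T_{r-1}\to\cdots\xrightarrow{f_1}T_1)$. All operators are symmetric strict monoidal functors, defined on generators: for $0\le i\le r-1$, $d_i$ omits $T_{r-i}$ (composing if necessary), except that for $r=1$, $d_0(T)$ is the component of $T$; for $0\le i\le r-1$, $s_i$ repeats $T_{r-i}$ by inserting an identity; $s_r$ appends $\tau_{T_1}:T_1\to U_{T_1}$; in degree $0$, $s_0$ sends a component to its chosen local terminal. The top face operator $d_r$ is: for $r=1$, $d_1(T)$ is the list over $i\in|T|$ of the components of $(\mathrm{id}_T)^{-1}(i)$; for $r\ge2$, $d_r(p)=(p_1,\dots,p_k)$, $k=|T_1|$, where $p_i=(h_{r-1}^{-1}(i)\to\cdots\to h_1^{-1}(i))$ is the chain of fibre maps over $i$, with $h_j:T_{j+1}\to T_1$ the composite map. The $2$-cell $\beta_r:d_{r+1}d_{r+1}\Rightarrow d_{r+1}d_{r+2}$ ($r\ge0$, from degree $r+2$ to degree $r$)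 has, at a generator $p=(T_{r+2}\to\cdots\to T_2\xrightarrow{f_1}T_1)$, underlying bijection $\pi_{|f_1|}:|T_2|\to\sum_{i\in|T_1|}|f_1|^{-1}(i)$; the corresponding list entries in source and target are equal by the axioms. PSEUDO-SIMPLICIAL COHERENCE. A symmetric strict monoidal groupoid-valued pre-simplicial object of this kind consists of groupoids, symmetric strict monoidal operators $d_i,s_i$ and invertible monoidal transformations $\beta_r$, with no equations on $\beta$ imposed. It is a coherent pseudo-simplicial object with $\beta_r$ as only nontrivial $2$-cells when all other simplicial identities hold strictly and, for all $r\ge0$: (a) $(d_{r+1}\beta_{r+1})\circ(\beta_r d_{r+2})=(\beta_r d_{r+3})\circ(\beta_r d_{r+1})$ as $2$-cells from $d_{r+1}d_{r+1}d_{r+1}$ to $d_{r+1}d_{r+2}d_{r+3}$ (from degree $r+3$ to degree $r$, using the strict identities to match composites); (b) $d_i\beta_{r+1}=\beta_r d_i$ for $0\le i\le r$; (c) $\beta_r s_{r+1}=\mathrm{id}$; (d) $\beta_{r+1}s_i=s_i\beta_r$ for $0\le i\le r$. (These are the nontrivial instances of Jardine's supercoherence equations.) *)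

theory Defs
  imports "HOL-Library.FuncSet" "HOL-Combinatorics.Permutations"
begin

section \<open>Categories, functors and natural transformations\<close>

record ('o, 'a) cat =
  Ob :: "'o set"
  Ar :: "'a set"
  Dom :: "'a \<Rightarrow> 'o"
  Cod :: "'a \<Rightarrow> 'o"
  Idn :: "'o \<Rightarrow> 'a"
  Cmp :: "'a \<Rightarrow> 'a \<Rightarrow> 'a"  \<comment> \<open>\<open>Cmp C g f\<close> is \<open>g\<close> after \<open>f\<close>\<close>

definition hom :: "('o, 'a, 'z) cat_scheme \<Rightarrow> 'o \<Rightarrow> 'o \<Rightarrow> 'a set" where
  "hom C x y = {f \<in> Ar C. Dom C f = x \<and> Cod C f = y}"

locale category =
  fixes C :: "('o, 'a, 'z) cat_scheme"
  assumes dom_in: "f \<in> Ar C \<Longrightarrow> Dom C f \<in> Ob C"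
    and cod_in: "f \<in> Ar C \<Longrightarrow> Cod C f \<in> Ob C"
    and idn_hom: "x \<in> Ob C \<Longrightarrow> Idn C x \<in> hom C x x"
    and cmp_hom: "\<lbrakk>f \<in> hom C x y; g \<in> hom C y z\<rbrakk> \<Longrightarrow> Cmp C g f \<in> hom C x z"
    and cmp_idn: "f \<in> hom C x y \<Longrightarrow> Cmp C f (Idn C x) = f"
    and idn_cmp: "f \<in> hom C x y \<Longrightarrow> Cmp C (Idn C y) f = f"
    and cmp_assoc: "\<lbrakk>f \<in> hom C x y; g \<in> hom C y z; h \<in> hom C z w\<rbrakk> \<Longrightarrow>
      Cmp C h (Cmp C g f) = Cmp C (Cmp C h g) f"

definition isomorphism :: "('o, 'a, 'z) cat_scheme \<Rightarrow> 'a \<Rightarrow> bool" where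
  "isomorphism C f \<longleftrightarrow> f \<in> Ar C \<and>
    (\<exists>g \<in> hom C (Cod C f) (Dom C f).
      Cmp C g f = Idn C (Dom C f) \<and> Cmp C f g = Idn C (Cod C f))"

record ('o, 'a, 'p, 'b) func =
  FO :: "'o \<Rightarrow> 'p"
  FA :: "'a \<Rightarrow> 'b"

locale cat_functor =
  fixes C :: "('o, 'a, 'z) cat_scheme"
    and D :: "('p, 'b, 'y) cat_scheme"
    and F :: "('o, 'a, 'p, 'b) func"
  assumes ob_map: "x \<in> Ob C \<Longrightarrow> FO F x \<in> Ob D"
    and ar_map: "f \<in> hom C x y \<Longrightarrow> FA F f \<in> hom D (FO F x) (FO F y)"
    and map_idn: "x \<in> Ob C \<Longrightarrow> FA F (Idn C x) = Idn D (FO F x)"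
    and map_cmp: "\<lbrakk>f \<in> hom C x y; g \<in> hom C y z\<rbrakk> \<Longrightarrow>
      FA F (Cmp C g f) = Cmp D (FA F g) (FA F f)"

definition idf :: "('o, 'a, 'o, 'a) func" where
  "idf = \<lparr>FO = (\<lambda>x. x), FA = (\<lambda>f. f)\<rparr>"

definition fcomp :: "('p, 'b, 'q, 'c) func \<Rightarrow> ('o, 'a, 'p, 'b) func \<Rightarrow> ('o, 'a, 'q, 'c) func"
    (infixl "\<odot>" 70) where
  "G \<odot> F = \<lparr>FO = (\<lambda>x. FO G (FO F x)), FA = (\<lambda>f. FA G (FA F f))\<rparr>"

text \<open>Functors and transformations are total HOL functions, so they are compared only on the
  objects and arrows of their source category.\<close>

definition feq ::
    "('o, 'a, 'z) cat_scheme \<Rightarrow> ('o, 'a, 'p, 'b) func \<Rightarrow> ('o, 'a, 'p, 'b) func \<Rightarrow> bool" where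
  "feq C F G \<longleftrightarrow> (\<forall>x \<in> Ob C. FO F x = FO G x) \<and> (\<forall>f \<in> Ar C. FA F f = FA G f)"

locale nat_transformation =
  fixes C :: "('o, 'a, 'z) cat_scheme"
    and D :: "('p, 'b, 'y) cat_scheme"
    and F G :: "('o, 'a, 'p, 'b) func"
    and \<eta> :: "'o \<Rightarrow> 'b"
  assumes component_hom: "x \<in> Ob C \<Longrightarrow> \<eta> x \<in> hom D (FO F x) (FO G x)"
    and naturality: "f \<in> hom C x y \<Longrightarrow> Cmp D (\<eta> y) (FA F f) = Cmp D (FA G f) (\<eta> x)"

definition teq :: "('o, 'a, 'z) cat_scheme \<Rightarrow> ('o \<Rightarrow> 'b) \<Rightarrow> ('o \<Rightarrow> 'b) \<Rightarrow> bool" where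
  "teq C \<eta> \<theta> \<longleftrightarrow> (\<forall>x \<in> Ob C. \<eta> x = \<theta> x)"

definition vcomp :: "('p, 'b, 'y) cat_scheme \<Rightarrow> ('o \<Rightarrow> 'b) \<Rightarrow> ('o \<Rightarrow> 'b) \<Rightarrow> 'o \<Rightarrow> 'b" where
  "vcomp D \<theta> \<eta> = (\<lambda>x. Cmp D (\<theta> x) (\<eta> x))"

definition lwhisker :: "('p, 'b, 'q, 'c) func \<Rightarrow> ('o \<Rightarrow> 'b) \<Rightarrow> 'o \<Rightarrow> 'c" where
  "lwhisker F \<eta> = (\<lambda>x. FA F (\<eta> x))"

definition rwhisker :: "('p \<Rightarrow> 'c) \<Rightarrow> ('o, 'a, 'p, 'b) func \<Rightarrow> 'o \<Rightarrow> 'c" where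
  "rwhisker \<eta> F = (\<lambda>x. \<eta> (FO F x))"

definition tid :: "('p, 'b, 'y) cat_scheme \<Rightarrow> ('o, 'a, 'p, 'b) func \<Rightarrow> 'o \<Rightarrow> 'b" where
  "tid D F = (\<lambda>x. Idn D (FO F x))"

section \<open>Symmetric strict monoidal groupoids\<close>

record ('o, 'a) moncat = "('o, 'a) cat" +
  TO :: "'o \<Rightarrow> 'o \<Rightarrow> 'o"
  TA :: "'a \<Rightarrow> 'a \<Rightarrow> 'a"
  MU :: "'o"
  Sym :: "'o \<Rightarrow> 'o \<Rightarrow> 'a"

locale ssm_groupoid = category C
  for C :: "('o, 'a, 'z) moncat_scheme" +
  assumes groupoid: "f \<in> Ar C \<Longrightarrow> isomorphism C f"
    and TO_in: "\<lbrakk>x \<in> Ob C; y \<in> Ob C\<rbrakk> \<Longrightarrow> TO C x y \<in> Ob C"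
    and MU_in: "MU C \<in> Ob C"
    and TA_hom: "\<lbrakk>f \<in> hom C x y; f' \<in> hom C x' y'\<rbrakk> \<Longrightarrow>
      TA C f f' \<in> hom C (TO C x x') (TO C y y')"
    and TA_idn: "\<lbrakk>x \<in> Ob C; y \<in> Ob C\<rbrakk> \<Longrightarrow>
      TA C (Idn C x) (Idn C y) = Idn C (TO C x y)"
    and TA_cmp: "\<lbrakk>f \<in> hom C x y; g \<in> hom C y z; f' \<in> hom C x' y'; g' \<in> hom C y' z'\<rbrakk> \<Longrightarrow>
      TA C (Cmp C g f) (Cmp C g' f') = Cmp C (TA C g g') (TA C f f')"
    and TO_assoc: "\<lbrakk>x \<in> Ob C; y \<in> Ob C; z \<in> Ob C\<rbrakk> \<Longrightarrow>
      TO C (TO C x y) z = TO C x (TO C y z)"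
    and TO_unit: "x \<in> Ob C \<Longrightarrow> TO C (MU C) x = x" "x \<in> Ob C \<Longrightarrow> TO C x (MU C) = x"
    and TA_assoc: "\<lbrakk>f \<in> Ar C; g \<in> Ar C; h \<in> Ar C\<rbrakk> \<Longrightarrow>
      TA C (TA C f g) h = TA C f (TA C g h)"
    and TA_unit: "f \<in> Ar C \<Longrightarrow> TA C (Idn C (MU C)) f = f"
      "f \<in> Ar C \<Longrightarrow> TA C f (Idn C (MU C)) = f"
    and Sym_hom: "\<lbrakk>x \<in> Ob C; y \<in> Ob C\<rbrakk> \<Longrightarrow> Sym C x y \<in> hom C (TO C x y) (TO C y x)"
    and Sym_nat: "\<lbrakk>f \<in> hom C x y; f' \<in> hom C x' y'\<rbrakk> \<Longrightarrow>
      Cmp C (Sym C y y') (TA C f f') = Cmp C (TA C f' f) (Sym C x x')"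
    and Sym_inv: "\<lbrakk>x \<in> Ob C; y \<in> Ob C\<rbrakk> \<Longrightarrow>
      Cmp C (Sym C y x) (Sym C x y) = Idn C (TO C x y)"
    and Sym_hexagon: "\<lbrakk>x \<in> Ob C; y \<in> Ob C; z \<in> Ob C\<rbrakk> \<Longrightarrow>
      Sym C x (TO C y z) = Cmp C (TA C (Idn C y) (Sym C x z)) (TA C (Sym C x y) (Idn C z))"

locale ssm_functor = cat_functor C D F
  for C :: "('o, 'a, 'z) moncat_scheme"
    and D :: "('p, 'b, 'y) moncat_scheme"
    and F :: "('o, 'a, 'p, 'b) func" +
  assumes map_TO: "\<lbrakk>x \<in> Ob C; y \<in> Ob C\<rbrakk> \<Longrightarrow> FO F (TO C x y) = TO D (FO F x) (FO F y)"
    and map_MU: "FO F (MU C) = MU D"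
    and map_TA: "\<lbrakk>f \<in> Ar C; g \<in> Ar C\<rbrakk> \<Longrightarrow> FA F (TA C f g) = TA D (FA F f) (FA F g)"
    and map_Sym: "\<lbrakk>x \<in> Ob C; y \<in> Ob C\<rbrakk> \<Longrightarrow> FA F (Sym C x y) = Sym D (FO F x) (FO F y)"

locale invertible_monoidal_transformation = nat_transformation C D F G \<eta>
  for C :: "('o, 'a, 'z) moncat_scheme"
    and D :: "('p, 'b, 'y) moncat_scheme"
    and F G :: "('o, 'a, 'p, 'b) func"
    and \<eta> :: "'o \<Rightarrow> 'b" +
  assumes invertible: "x \<in> Ob C \<Longrightarrow> isomorphism D (\<eta> x)"
    and component_TO: "\<lbrakk>x \<in> Ob C; y \<in> Ob C\<rbrakk> \<Longrightarrow> \<eta> (TO C x y) = TA D (\<eta> x) (\<eta> y)"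
    and component_MU: "\<eta> (MU C) = Idn D (MU D)"

section \<open>Coherent pseudo-simplicial objects\<close>

text \<open>\<open>face X r i\<close> is \<open>d\<^sub>i\<close> from degree \<open>r\<close> to degree \<open>r - 1\<close>, and \<open>degen X r i\<close> is \<open>s\<^sub>i\<close> from
  degree \<open>r\<close> to degree \<open>r + 1\<close>.\<close>

record ('x, 'y) presimp =
  deg :: "nat \<Rightarrow> ('x, 'y) moncat"
  face :: "nat \<Rightarrow> nat \<Rightarrow> ('x, 'y, 'x, 'y) func"
  degen :: "nat \<Rightarrow> nat \<Rightarrow> ('x, 'y, 'x, 'y) func"
  beta :: "nat \<Rightarrow> 'x \<Rightarrow> 'y"

locale presimplicial_ssm_groupoid =
  fixes X :: "('x, 'y) presimp"
  assumes deg_ssm: "ssm_groupoid (deg X r)"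
    and face_ssm: "i \<le> Suc r \<Longrightarrow> ssm_functor (deg X (Suc r)) (deg X r) (face X (Suc r) i)"
    and degen_ssm: "i \<le> r \<Longrightarrow> ssm_functor (deg X r) (deg X (Suc r)) (degen X r i)"
    and beta_trans: "invertible_monoidal_transformation (deg X (r + 2)) (deg X r)
      (face X (r + 1) (r + 1) \<odot> face X (r + 2) (r + 1))
      (face X (r + 1) (r + 1) \<odot> face X (r + 2) (r + 2))
      (beta X r)"

locale coherent_pseudosimplicial_ssm_groupoid = presimplicial_ssm_groupoid X
  for X :: "('x, 'y) presimp" +
  assumes face_face: "\<lbrakk>i < j; j \<le> r + 2; \<not> (i = r + 1 \<and> j = r + 2)\<rbrakk> \<Longrightarrow>
      feq (deg X (r + 2)) (face X (r + 1) i \<odot> face X (r + 2) j)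
        (face X (r + 1) (j - 1) \<odot> face X (r + 2) i)"
    and degen_degen: "\<lbrakk>i \<le> j; j \<le> r\<rbrakk> \<Longrightarrow>
      feq (deg X r) (degen X (r + 1) i \<odot> degen X r j) (degen X (r + 1) (j + 1) \<odot> degen X r i)"
    and face_degen_less: "\<lbrakk>i < j; j \<le> r\<rbrakk> \<Longrightarrow>
      feq (deg X r) (face X (r + 1) i \<odot> degen X r j) (degen X (r - 1) (j - 1) \<odot> face X r i)"
    and face_degen_id: "\<lbrakk>j \<le> r; i = j \<or> i = j + 1\<rbrakk> \<Longrightarrow>
      feq (deg X r) (face X (r + 1) i \<odot> degen X r j) idf"
    and face_degen_greater: "\<lbrakk>j + 1 < i; i \<le> r + 1\<rbrakk> \<Longrightarrow>
      feq (deg X r) (face X (r + 1) i \<odot> degen X r j) (degen X (r - 1) j \<odot> face X r (i - 1))"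
    and beta_cocycle: "teq (deg X (r + 3))
      (vcomp (deg X r)
        (lwhisker (face X (r + 1) (r + 1)) (beta X (r + 1)))
        (rwhisker (beta X r) (face X (r + 3) (r + 2))))
      (vcomp (deg X r)
        (rwhisker (beta X r) (face X (r + 3) (r + 3)))
        (rwhisker (beta X r) (face X (r + 3) (r + 1))))"
    and beta_face: "i \<le> r \<Longrightarrow> teq (deg X (r + 3))
      (lwhisker (face X (r + 1) i) (beta X (r + 1)))
      (rwhisker (beta X r) (face X (r + 3) i))"
    and beta_degen_top: "teq (deg X (r + 1))
      (rwhisker (beta X r) (degen X (r + 1) (r + 1)))
      (tid (deg X r)
        (face X (r + 1) (r + 1) \<odot> face X (r + 2) (r + 1) \<odot> degen X (r + 1) (r + 1)))"
    and beta_degen: "i \<le> r \<Longrightarrow> teq (deg X (r + 2))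
      (rwhisker (beta X (r + 1)) (degen X (r + 2) i))
      (lwhisker (degen X r i) (beta X r))"

section \<open>Finite ordinals\<close>

text \<open>The ordinal with \<open>n\<close> elements is \<open>{0, \<dots>, n - 1}\<close>, so that its elements are the positions of
  a list of length \<open>n\<close>.  Maps are extensional functions, so equality of maps is HOL equality.\<close>

datatype fmap = FMap (fsrc: nat) (fn: "nat \<Rightarrow> nat") (ftgt: nat)

definition Fin :: "(nat, fmap) cat" where
  "Fin = \<lparr>Ob = UNIV,
    Ar = {g. fn g \<in> {..<fsrc g} \<rightarrow>\<^sub>E {..<ftgt g}},
    Dom = fsrc,
    Cod = ftgt,
    Idn = (\<lambda>n. FMap n (\<lambda>j\<in>{..<n}. j) n),
    Cmp = (\<lambda>g f. FMap (fsrc f) (compose {..<fsrc f} (fn g) (fn f)) (ftgt g))\<rparr>"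

definition fin_fibre :: "fmap \<Rightarrow> nat \<Rightarrow> nat" where
  "fin_fibre g i = card {j \<in> {..<fsrc g}. fn g j = i}"

definition eps_list :: "fmap \<Rightarrow> nat \<Rightarrow> nat list" where
  "eps_list g i = filter (\<lambda>j. fn g j = i) [0..<fsrc g]"

definition eps :: "fmap \<Rightarrow> nat \<Rightarrow> nat \<Rightarrow> nat" where
  "eps g i a = eps_list g i ! a"

definition fin_fibre_map :: "fmap \<Rightarrow> fmap \<Rightarrow> nat \<Rightarrow> fmap" where
  "fin_fibre_map f g i =
    FMap (fin_fibre (Cmp Fin g f) i)
      (\<lambda>a\<in>{..<fin_fibre (Cmp Fin g f) i}.
        THE b. b < fin_fibre g i \<and> eps g i b = fn f (eps (Cmp Fin g f) i a))
      (fin_fibre g i)"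

text \<open>\<open>concat [eps_list g i. i \<leftarrow> [0..<ftgt g]]\<close> lists the values of the inverse of \<open>\<pi>\<^sub>g\<close>: the
  \<open>i\<close>-th summand of the ordinal sum is mapped by \<open>\<epsilon>\<close>.  As a permutation, \<open>\<pi>\<^sub>g\<close> is
  extended by the identity outside its domain.\<close>

definition pi_perm :: "fmap \<Rightarrow> nat \<Rightarrow> nat" where
  "pi_perm g j =
    (if j < fsrc g
     then THE p. p < fsrc g \<and> concat [eps_list g i. i \<leftarrow> [0..<ftgt g]] ! p = j
     else j)"

section \<open>Operadic categories\<close>

definition conn_rel :: "('o, 'a, 'z) cat_scheme \<Rightarrow> ('o \<times> 'o) set" where
  "conn_rel C =
    (let E = {(Dom C f, Cod C f) | f. f \<in> Ar C} in (E \<union> E\<inverse>)\<^sup>* \<inter> Ob C \<times> Ob C)"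

definition pi0 :: "('o, 'a, 'z) cat_scheme \<Rightarrow> 'o set set" where
  "pi0 C = Ob C // conn_rel C"

definition component :: "('o, 'a, 'z) cat_scheme \<Rightarrow> 'o \<Rightarrow> 'o set" where
  "component C x = conn_rel C `` {x}"

definition local_terminal :: "('o, 'a, 'z) cat_scheme \<Rightarrow> 'o \<Rightarrow> bool" where
  "local_terminal C u \<longleftrightarrow> u \<in> Ob C \<and> (\<forall>x \<in> component C u. \<exists>!f. f \<in> hom C x u)"

text \<open>Objects of the slice over \<open>R\<close> are arrows \<open>g\<close> into \<open>R\<close>; the pair \<open>(f, g)\<close> is the
  morphism \<open>f : g f \<rightarrow> g\<close>.\<close>

definition slice :: "('o, 'a, 'z) cat_scheme \<Rightarrow> 'o \<Rightarrow> ('a, 'a \<times> 'a) cat" where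
  "slice C R = \<lparr>Ob = {g \<in> Ar C. Cod C g = R},
    Ar = {(f, g). f \<in> Ar C \<and> g \<in> Ar C \<and> Cod C f = Dom C g \<and> Cod C g = R},
    Dom = (\<lambda>(f, g). Cmp C g f),
    Cod = snd,
    Idn = (\<lambda>g. (Idn C (Dom C g), g)),
    Cmp = (\<lambda>(f, g) (f', g'). (Cmp C f f', g))\<rparr>"

record ('o, 'a) opcat = "('o, 'a) cat" +
  chosen :: "'o set \<Rightarrow> 'o"
  crd :: "('o, 'a, nat, fmap) func"
  fibfun :: "'o \<Rightarrow> nat \<Rightarrow> ('a, 'a \<times> 'a, 'o, 'a) func"

definition lterm :: "('o, 'a) opcat \<Rightarrow> 'o \<Rightarrow> 'o" where
  "lterm Q R = chosen Q (component Q R)"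

definition tau :: "('o, 'a) opcat \<Rightarrow> 'o \<Rightarrow> 'a" where
  "tau Q R = (THE f. f \<in> hom Q R (lterm Q R))"

definition fib :: "('o, 'a) opcat \<Rightarrow> 'a \<Rightarrow> nat \<Rightarrow> 'o" where
  "fib Q g i = FO (fibfun Q (Cod Q g) i) g"

text \<open>\<open>fibmap Q f g i\<close> is the fibre map of \<open>f\<close> with respect to \<open>g\<close> at \<open>i\<close>, from the fibre of \<open>g f\<close>
  to that of \<open>g\<close>.\<close>

definition fibmap :: "('o, 'a) opcat \<Rightarrow> 'a \<Rightarrow> 'a \<Rightarrow> nat \<Rightarrow> 'a" where
  "fibmap Q f g i = FA (fibfun Q (Cod Q g) i) (f, g)"

locale operadic_category = category Q
  for Q :: "('o, 'a) opcat" +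
  assumes chosen_terminal: "K \<in> pi0 Q \<Longrightarrow> chosen Q K \<in> K \<and> local_terminal Q (chosen Q K)"
    and cardinality_functor: "cat_functor Q Fin (crd Q)"
    and fibre_functor: "\<lbrakk>R \<in> Ob Q; i < FO (crd Q) R\<rbrakk> \<Longrightarrow>
      cat_functor (slice Q R) Q (fibfun Q R i)"
    and A1: "local_terminal Q R \<Longrightarrow> FO (crd Q) R = 1"
    and A2: "\<lbrakk>R \<in> Ob Q; i < FO (crd Q) R\<rbrakk> \<Longrightarrow> fib Q (Idn Q R) i \<in> chosen Q ` pi0 Q"
    and A3_ob: "\<lbrakk>g \<in> hom Q S R; i < FO (crd Q) R\<rbrakk> \<Longrightarrow>
      FO (crd Q) (fib Q g i) = fin_fibre (FA (crd Q) g) i"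
    and A3_ar: "\<lbrakk>f \<in> hom Q T S; g \<in> hom Q S R; i < FO (crd Q) R\<rbrakk> \<Longrightarrow>
      FA (crd Q) (fibmap Q f g i) = fin_fibre_map (FA (crd Q) f) (FA (crd Q) g) i"
    and A4_ob: "R \<in> Ob Q \<Longrightarrow> fib Q (tau Q R) 0 = R"
    and A4_ar: "g \<in> hom Q S R \<Longrightarrow> fibmap Q g (tau Q R) 0 = g"
    and A5_ob: "\<lbrakk>f \<in> hom Q T S; g \<in> hom Q S R; i < FO (crd Q) R;
        j < fin_fibre (FA (crd Q) g) i\<rbrakk> \<Longrightarrow>
      fib Q (fibmap Q f g i) j = fib Q f (eps (FA (crd Q) g) i j)"
    and A5_ar: "\<lbrakk>h \<in> hom Q P T; f \<in> hom Q T S; g \<in> hom Q S R; i < FO (crd Q) R;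
        j < fin_fibre (FA (crd Q) g) i\<rbrakk> \<Longrightarrow>
      fibmap Q (fibmap Q h (Cmp Q g f) i) (fibmap Q f g i) j =
        fibmap Q h f (eps (FA (crd Q) g) i j)"

section \<open>The free symmetric strict monoidal groupoid on a set\<close>

text \<open>The permutation of an arrow is a permutation of the positions, extended by the identity to all
  natural numbers.\<close>

datatype 'x sarr = SArr (sdom: "'x list") (sperm: "nat \<Rightarrow> nat") (scod: "'x list")

definition perm_sum :: "nat \<Rightarrow> (nat \<Rightarrow> nat) \<Rightarrow> (nat \<Rightarrow> nat) \<Rightarrow> nat \<Rightarrow> nat" where
  "perm_sum n \<rho> \<sigma> k = (if k < n then \<rho> k else n + \<sigma> (k - n))"

definition block_swap :: "nat \<Rightarrow> nat \<Rightarrow> nat \<Rightarrow> nat" where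
  "block_swap n m k = (if k < n then m + k else if k < n + m then k - n else k)"

definition FreeSM :: "'x set \<Rightarrow> ('x list, 'x sarr) moncat" where
  "FreeSM A = \<lparr>Ob = lists A,
    Ar = {u. sdom u \<in> lists A \<and> scod u \<in> lists A \<and> length (sdom u) = length (scod u) \<and>
      sperm u permutes {..<length (sdom u)} \<and>
      (\<forall>i < length (sdom u). sdom u ! i = scod u ! sperm u i)},
    Dom = sdom,
    Cod = scod,
    Idn = (\<lambda>xs. SArr xs id xs),
    Cmp = (\<lambda>v u. SArr (sdom u) (sperm v \<circ> sperm u) (scod v)),
    TO = (@),
    TA = (\<lambda>u v. SArr (sdom u @ sdom v) (perm_sum (length (sdom u)) (sperm u) (sperm v))
      (scod u @ scod v)),
    MU = [],
    Sym = (\<lambda>xs ys. SArr (xs @ ys) (block_swap (length xs) (length ys)) (ys @ xs))\<rparr>"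

text \<open>The symmetric strict monoidal functor with value \<open>\<phi> x\<close> on the generator \<open>x\<close> sends an arrow with
  permutation \<open>\<rho>\<close> to the block permutation that moves the \<open>i\<close>-th block \<open>\<phi> (xs ! i)\<close> of the source to
  the \<open>\<rho> i\<close>-th block of the target.\<close>

definition block_offset :: "('x \<Rightarrow> 'y list) \<Rightarrow> 'x list \<Rightarrow> nat \<Rightarrow> nat" where
  "block_offset \<phi> xs i = length (concat (map \<phi> (take i xs)))"

definition block_positions :: "('x \<Rightarrow> 'y list) \<Rightarrow> 'x list \<Rightarrow> (nat \<times> nat) list" where
  "block_positions \<phi> xs = [(i, a). i \<leftarrow> [0..<length xs], a \<leftarrow> [0..<length (\<phi> (xs ! i))]]"

definition block_perm :: "('x \<Rightarrow> 'y list) \<Rightarrow> 'x sarr \<Rightarrow> nat \<Rightarrow> nat" where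
  "block_perm \<phi> u k =
    (if k < length (block_positions \<phi> (sdom u))
     then case block_positions \<phi> (sdom u) ! k of
       (i, a) \<Rightarrow> block_offset \<phi> (scod u) (sperm u i) + a
     else k)"

definition ext_functor :: "('x \<Rightarrow> 'y list) \<Rightarrow> ('x list, 'x sarr, 'y list, 'y sarr) func" where
  "ext_functor \<phi> = \<lparr>FO = (\<lambda>xs. concat (map \<phi> xs)),
    FA = (\<lambda>u. SArr (concat (map \<phi> (sdom u))) (block_perm \<phi> u) (concat (map \<phi> (scod u))))\<rparr>"

definition ext_transformation ::
    "('y list, 'y sarr) moncat \<Rightarrow> ('x \<Rightarrow> 'y sarr) \<Rightarrow> 'x list \<Rightarrow> 'y sarr" where
  "ext_transformation D \<eta> xs = foldr (\<lambda>x u. TA D (\<eta> x) u) xs (Idn D (MU D))"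

section \<open>The operadic nerve\<close>

text \<open>\<open>Chain T\<^sub>1 [f\<^sub>1, \<dots>, f\<^sub>r\<^sub>-\<^sub>1]\<close> is the generator
  \<open>T\<^sub>r \<rightarrow> \<dots> \<rightarrow> T\<^sub>2 \<rightarrow> T\<^sub>1\<close> of degree \<open>r \<ge> 1\<close>: the last object, and
  the arrows \<open>f\<^sub>j : T\<^sub>j\<^sub>+\<^sub>1 \<rightarrow> T\<^sub>j\<close> starting from the one into \<open>T\<^sub>1\<close>.\<close>

datatype ('o, 'a) gen = Comp "'o set" | Chain 'o "'a list"

fun is_chain :: "('o, 'a, 'z) cat_scheme \<Rightarrow> 'o \<Rightarrow> 'a list \<Rightarrow> bool" where
  "is_chain C T [] \<longleftrightarrow> T \<in> Ob C"
| "is_chain C T (f # fs) \<longleftrightarrow> f \<in> Ar C \<and> Cod C f = T \<and> is_chain C (Dom C f) fs"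

fun nerve_gen :: "('o, 'a) opcat \<Rightarrow> nat \<Rightarrow> ('o, 'a) gen set" where
  "nerve_gen Q 0 = Comp ` pi0 Q"
| "nerve_gen Q (Suc m) = {Chain T fs | T fs. is_chain Q T fs \<and> length fs = m}"

definition chain_obj :: "('o, 'a) opcat \<Rightarrow> 'o \<Rightarrow> 'a list \<Rightarrow> nat \<Rightarrow> 'o" where
  "chain_obj Q T fs k = (if k = 1 then T else Dom Q (fs ! (k - 2)))"

text \<open>\<open>omit Q k\<close> omits \<open>T\<^sub>k\<close>; the three cases for nonempty \<open>fs\<close> are \<open>k = 1\<close>, \<open>k = r\<close> and
  \<open>1 < k < r\<close>, where \<open>r = length fs + 1\<close>.\<close>

fun omit :: "('o, 'a) opcat \<Rightarrow> nat \<Rightarrow> ('o, 'a) gen \<Rightarrow> ('o, 'a) gen" where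
  "omit Q k (Comp K) = undefined"
| "omit Q k (Chain T fs) =
    (if fs = [] then Comp (component Q T)
     else if k = 1 then Chain (Dom Q (hd fs)) (tl fs)
     else if k = length fs + 1 then Chain T (butlast fs)
     else Chain T (take (k - 2) fs @ [Cmp Q (fs ! (k - 2)) (fs ! (k - 1))] @ drop k fs))"

text \<open>The argument \<open>h\<close> is the composite \<open>h\<^sub>j : T\<^sub>j\<^sub>+\<^sub>1 \<rightarrow> T\<^sub>1\<close> of the arrows already passed.\<close>

fun fibre_arrows :: "('o, 'a) opcat \<Rightarrow> nat \<Rightarrow> 'a \<Rightarrow> 'a list \<Rightarrow> 'a list" where
  "fibre_arrows Q i h [] = []"
| "fibre_arrows Q i h (f # fs) = fibmap Q f h i # fibre_arrows Q i (Cmp Q h f) fs"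

fun top_face :: "('o, 'a) opcat \<Rightarrow> ('o, 'a) gen \<Rightarrow> ('o, 'a) gen list" where
  "top_face Q (Comp K) = undefined"
| "top_face Q (Chain T []) =
    [Comp (component Q (fib Q (Idn Q T) i)). i \<leftarrow> [0..<FO (crd Q) T]]"
| "top_face Q (Chain T (f # fs)) =
    [Chain (fib Q f i) (fibre_arrows Q i f fs). i \<leftarrow> [0..<FO (crd Q) T]]"

definition nerve_face ::
    "('o, 'a) opcat \<Rightarrow> nat \<Rightarrow> nat \<Rightarrow>
      (('o, 'a) gen list, ('o, 'a) gen sarr, ('o, 'a) gen list, ('o, 'a) gen sarr) func" where
  "nerve_face Q r i =
    ext_functor (\<lambda>p. if i < r then [omit Q (r - i) p] else top_face Q p)"

fun degen_gen :: "('o, 'a) opcat \<Rightarrow> nat \<Rightarrow> nat \<Rightarrow> ('o, 'a) gen \<Rightarrow> ('o, 'a) gen" where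
  "degen_gen Q r i (Comp K) = Chain (chosen Q K) []"
| "degen_gen Q r i (Chain T fs) =
    (if i < r
     then Chain T (take (r - i - 1) fs @ [Idn Q (chain_obj Q T fs (r - i))] @ drop (r - i - 1) fs)
     else Chain (lterm Q T) (tau Q T # fs))"

definition nerve_degen ::
    "('o, 'a) opcat \<Rightarrow> nat \<Rightarrow> nat \<Rightarrow>
      (('o, 'a) gen list, ('o, 'a) gen sarr, ('o, 'a) gen list, ('o, 'a) gen sarr) func" where
  "nerve_degen Q r i = ext_functor (\<lambda>p. [degen_gen Q r i p])"

fun beta_perm :: "('o, 'a) opcat \<Rightarrow> ('o, 'a) gen \<Rightarrow> nat \<Rightarrow> nat" where
  "beta_perm Q (Chain T (f # fs)) = pi_perm (FA (crd Q) f)"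
| "beta_perm Q _ = undefined"

definition beta_gen :: "('o, 'a) opcat \<Rightarrow> nat \<Rightarrow> ('o, 'a) gen \<Rightarrow> ('o, 'a) gen sarr" where
  "beta_gen Q r p =
    SArr (FO (nerve_face Q (r + 1) (r + 1) \<odot> nerve_face Q (r + 2) (r + 1)) [p])
      (beta_perm Q p)
      (FO (nerve_face Q (r + 1) (r + 1) \<odot> nerve_face Q (r + 2) (r + 2)) [p])"

definition operadic_nerve ::
    "('o, 'a) opcat \<Rightarrow> (('o, 'a) gen list, ('o, 'a) gen sarr) presimp" where
  "operadic_nerve Q = \<lparr>deg = (\<lambda>r. FreeSM (nerve_gen Q r)),
    face = nerve_face Q,
    degen = nerve_degen Q,
    beta = (\<lambda>r. ext_transformation (FreeSM (nerve_gen Q r)) (beta_gen Q r))\<rparr>"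

end

theory Submission
  imports Defs
begin

text \<open>
  Every operator of the nerve is the symmetric monoidal functor given by a map \<open>\<phi>\<close> on
  generators, and composites of such functors are again of this form.  A strict identity between
  operators can therefore be tested on single chains.  Away from the top face and the top degeneracy
  the identities are those of the nerve of a category, with the order of indices reversed.  The top
  face commutes with omission of objects other than \<open>T\<^sub>1\<close> and with insertion of identities
  because taking fibres is functorial (\<open>fibre_arrows_omit_at\<close>,
  \<open>fibre_arrows_insert_idn\<close>).  The boundary cases involve terminal maps: the fibre of a
  chain over a terminal map is the chain itself (\<open>fibre_arrows_tau\<close>), and fibre maps over an
  identity are terminal maps (\<open>tau_fib\<close>).

  The top face applied twice differs from the omission of \<open>T\<^sub>1\<close> followed by the top face.  For
  a chain \<open>\<dots> \<rightarrow> T\<^sub>2 \<rightarrow> T\<^sub>1\<close> with last arrow \<open>f\<close> the two results have the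
  same entries, by the axiom on fibres of fibre maps (\<open>fibre_arrows_fibre_arrows\<close>), but the
  second lists them over \<open>|T\<^sub>2|\<close> and the first groups them by the fibres of \<open>|f|\<close>; the
  two-cell is the regrouping \<open>\<pi>\<close> of \<open>|f|\<close>.

  For the coherence equations, whiskerings and composites of monoidal transformations are monoidal,
  and monoidal transformations out of a free symmetric monoidal groupoid are determined by
  generators.  Sources and targets of the two sides agree by the strict identities, so only
  permutations have to be compared (\<open>teq_FreeSM_I\<close>).  In the equations with a lower face or a
  lower degeneracy both permutations are that of the same arrow \<open>f\<close>; after a top degeneracy
  \<open>f\<close> is a terminal map, over a one-element ordinal, and its permutation is trivial.  In the
  cocycle equation the permutations depend only on the two maps of finite ordinals underlying the
  last two arrows.  It is therefore proved for finite ordinals (\<open>pi_cocycle\<close>), by labelling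
  the entries with distinct numbers: an arrow into a list without repetitions is determined by its
  source and target.
\<close>

section \<open>Blocks of a concatenated list\<close>

lemma block_offset_0 [simp]: "block_offset \<phi> xs 0 = 0"
  by (simp add: block_offset_def)

lemma block_offset_Cons_Suc [simp]:
  "block_offset \<phi> (x # xs) (Suc i) = length (\<phi> x) + block_offset \<phi> xs i"
  by (simp add: block_offset_def)

lemma block_offset_Suc:
  "i < length xs \<Longrightarrow> block_offset \<phi> xs (Suc i) = block_offset \<phi> xs i + length (\<phi> (xs ! i))"
  by (simp add: block_offset_def take_Suc_conv_app_nth)

lemma block_offset_mono: "i \<le> j \<Longrightarrow> block_offset \<phi> xs i \<le> block_offset \<phi> xs j"
  unfolding block_offset_def by (metis concat_append le_add1 length_append le_Suc_ex map_append take_add)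

lemma block_offset_length: "block_offset \<phi> xs (length xs) = length (concat (map \<phi> xs))"
  by (simp add: block_offset_def)

lemma block_position_less:
  assumes "i < length xs" "a < length (\<phi> (xs ! i))"
  shows "block_offset \<phi> xs i + a < length (concat (map \<phi> xs))"
proof -
  have "block_offset \<phi> xs i + a < block_offset \<phi> xs (Suc i)"
    using assms by (simp add: block_offset_Suc)
  also have "\<dots> \<le> block_offset \<phi> xs (length xs)"
    using assms by (intro block_offset_mono) simp
  finally show ?thesis by (simp add: block_offset_length)
qed

lemma block_position_exhaust:
  assumes "k < length (concat (map \<phi> xs))"
  obtains i a where "i < length xs" "a < length (\<phi> (xs ! i))" "k = block_offset \<phi> xs i + a"
  using assms
proof (induction xs arbitrary: k thesis)
  case (Cons x xs)
  show ?case
  proof (cases "k < length (\<phi> x)")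
    case True
    then show ?thesis using Cons.prems(1)[of 0 k] by simp
  next
    case False
    then have "k - length (\<phi> x) < length (concat (map \<phi> xs))" using Cons.prems(2) by simp
    then obtain i a where "i < length xs" "a < length (\<phi> (xs ! i))"
      "k - length (\<phi> x) = block_offset \<phi> xs i + a" using Cons.IH by blast
    then show ?thesis using Cons.prems(1)[of "Suc i" a] False by simp
  qed
qed simp

lemma block_positions_Cons:
  "block_positions \<phi> (x # xs) =
    map (Pair 0) [0..<length (\<phi> x)] @ map (\<lambda>(i, a). (Suc i, a)) (block_positions \<phi> xs)"
proof -
  have "[0..<length (x # xs)] = 0 # map Suc [0..<length xs]"
    by (simp add: map_Suc_upt upt_conv_Cons del: upt_Suc)
  then show ?thesis
    by (simp add: block_positions_def map_concat comp_def del: upt_Suc)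
qed

lemma length_block_positions: "length (block_positions \<phi> xs) = length (concat (map \<phi> xs))"
  by (induction xs) (simp_all add: block_positions_Cons, simp add: block_positions_def)

lemma block_positions_nth:
  "\<lbrakk>i < length xs; a < length (\<phi> (xs ! i))\<rbrakk> \<Longrightarrow>
    block_positions \<phi> xs ! (block_offset \<phi> xs i + a) = (i, a)"
proof (induction xs arbitrary: i)
  case (Cons x xs)
  show ?case
  proof (cases i)
    case 0
    then show ?thesis using Cons.prems by (simp add: block_positions_Cons nth_append)
  next
    case (Suc j)
    then have "block_offset \<phi> xs j + a < length (block_positions \<phi> xs)"
      using Cons.prems by (simp add: length_block_positions block_position_less)
    then show ?thesis using Cons Suc by (simp add: block_positions_Cons nth_append)
  qed
qed simp

lemma block_position_unique:
  assumes "i < length xs" "a < length (\<phi> (xs ! i))" "j < length xs" "b < length (\<phi> (xs ! j))"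
    and "block_offset \<phi> xs i + a = block_offset \<phi> xs j + b"
  shows "i = j \<and> a = b"
  using block_positions_nth[of i xs a \<phi>, OF assms(1,2)]
    block_positions_nth[of j xs b \<phi>, OF assms(3,4)]
  unfolding assms(5) by simp

lemma concat_map_nth:
  "\<lbrakk>i < length xs; a < length (\<phi> (xs ! i))\<rbrakk> \<Longrightarrow>
    concat (map \<phi> xs) ! (block_offset \<phi> xs i + a) = \<phi> (xs ! i) ! a"
proof (induction xs arbitrary: i)
  case (Cons x xs)
  then show ?case by (cases i) (simp_all add: nth_append)
qed simp

lemma block_offset_cong:
  assumes "map (\<lambda>x. length (\<phi> x)) xs = map (\<lambda>y. length (\<psi> y)) ys"
  shows "block_offset \<phi> xs i = block_offset \<psi> ys i"
  using arg_cong[OF assms, of "\<lambda>l. sum_list (take i l)"]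
  by (simp add: block_offset_def length_concat take_map comp_def)

lemma block_offset_append:
  "block_offset \<phi> (xs @ ys) i =
    block_offset \<phi> xs i + block_offset \<phi> ys (i - length xs)"
  by (simp add: block_offset_def)

text \<open>A position inside a block of the inner list is the start of a block of the outer
  concatenation; locating it in two steps is what makes \<open>ext_functor\<close> compatible with composition.\<close>

lemma block_offset_concat:
  "\<lbrakk>i < length xs; a \<le> length (\<psi> (xs ! i))\<rbrakk> \<Longrightarrow>
    block_offset \<phi> (concat (map \<psi> xs)) (block_offset \<psi> xs i + a) =
    block_offset (\<lambda>x. concat (map \<phi> (\<psi> x))) xs i + block_offset \<phi> (\<psi> (xs ! i)) a"
proof (induction xs arbitrary: i)
  case (Cons x xs)
  then show ?case
    by (cases i) (simp_all add: block_offset_append, simp_all add: block_offset_def)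
qed simp

section \<open>The free symmetric strict monoidal groupoid\<close>

lemma FreeSM_sel [simp]:
  "Ob (FreeSM A) = lists A" "Dom (FreeSM A) = sdom" "Cod (FreeSM A) = scod"
  "Idn (FreeSM A) xs = SArr xs id xs"
  "Cmp (FreeSM A) v u = SArr (sdom u) (sperm v \<circ> sperm u) (scod v)"
  "TO (FreeSM A) = (@)"
  "TA (FreeSM A) u v = SArr (sdom u @ sdom v) (perm_sum (length (sdom u)) (sperm u) (sperm v))
      (scod u @ scod v)"
  "MU (FreeSM A) = []"
  "Sym (FreeSM A) xs ys = SArr (xs @ ys) (block_swap (length xs) (length ys)) (ys @ xs)"
  by (simp_all add: FreeSM_def)

lemma FreeSM_Ar_iff:
  "u \<in> Ar (FreeSM A) \<longleftrightarrow> sdom u \<in> lists A \<and> scod u \<in> lists A \<and>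
    length (sdom u) = length (scod u) \<and> sperm u permutes {..<length (sdom u)} \<and>
    (\<forall>i < length (sdom u). sdom u ! i = scod u ! sperm u i)"
  by (simp add: FreeSM_def)

lemma FreeSM_hom_iff:
  "u \<in> hom (FreeSM A) xs ys \<longleftrightarrow> u \<in> Ar (FreeSM A) \<and> sdom u = xs \<and> scod u = ys"
  by (simp add: hom_def)

lemma FreeSM_ArD:
  assumes "u \<in> Ar (FreeSM A)"
  shows "sdom u \<in> lists A" "scod u \<in> lists A" "length (scod u) = length (sdom u)"
    "sperm u permutes {..<length (sdom u)}"
proof -
  show "sdom u \<in> lists A" "scod u \<in> lists A" and len: "length (scod u) = length (sdom u)"
    using assms by (simp_all add: FreeSM_Ar_iff)
  show "sperm u permutes {..<length (sdom u)}"
    using assms len by (simp add: FreeSM_Ar_iff)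
qed

lemma FreeSM_ArI:
  "\<lbrakk>xs \<in> lists A; ys \<in> lists A; length xs = length ys; \<rho> permutes {..<length xs};
    \<And>i. i < length xs \<Longrightarrow> xs ! i = ys ! \<rho> i\<rbrakk> \<Longrightarrow> SArr xs \<rho> ys \<in> Ar (FreeSM A)"
  by (simp add: FreeSM_Ar_iff)

lemma sperm_less_iff:
  "u \<in> Ar (FreeSM A) \<Longrightarrow> sperm u i < length (sdom u) \<longleftrightarrow> i < length (sdom u)"
  using permutes_in_image[OF FreeSM_ArD(4)] by fastforce

lemma sperm_ge:
  "\<lbrakk>u \<in> Ar (FreeSM A); length (sdom u) \<le> i\<rbrakk> \<Longrightarrow> sperm u i = i"
  using permutes_not_in[OF FreeSM_ArD(4)] by fastforce

lemma sarr_nth: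
  "\<lbrakk>u \<in> Ar (FreeSM A); i < length (sdom u)\<rbrakk> \<Longrightarrow> scod u ! sperm u i = sdom u ! i"
  by (simp add: FreeSM_Ar_iff)

text \<open>Permutations of arrows fix all positions beyond the length, so only positions inside the
  list have to be compared.\<close>

lemma FreeSM_arrow_eqI:
  assumes "u \<in> Ar (FreeSM A)" "v \<in> Ar (FreeSM B)" "sdom u = sdom v" "scod u = scod v"
    and "\<And>k. k < length (sdom u) \<Longrightarrow> sperm u k = sperm v k"
  shows "u = v"
proof -
  have "sperm u k = sperm v k" for k
    using assms sperm_ge[of u A k] sperm_ge[of v B k] by (cases "k < length (sdom u)") auto
  then show ?thesis using assms by (intro sarr.expand) auto
qed

lemma perm_sum_permutes:
  assumes "\<rho> permutes {..<n}" "\<sigma> permutes {..<m}"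
  shows "perm_sum n \<rho> \<sigma> permutes {..<n + m}"
proof (rule bij_imp_permutes)
  have \<rho>: "\<rho> i < n \<longleftrightarrow> i < n" for i using permutes_in_image[OF assms(1)] by auto
  have \<sigma>: "\<sigma> i < m \<longleftrightarrow> i < m" for i using permutes_in_image[OF assms(2)] by auto
  have inj: "inj_on (perm_sum n \<rho> \<sigma>) {..<n + m}"
  proof (rule inj_onI)
    fix x y assume "perm_sum n \<rho> \<sigma> x = perm_sum n \<rho> \<sigma> y"
    then show "x = y"
      using \<rho>[of x] \<rho>[of y] permutes_inj[OF assms(1)] permutes_inj[OF assms(2)]
      by (auto simp: perm_sum_def inj_eq split: if_splits)
  qed
  moreover have "perm_sum n \<rho> \<sigma> ` {..<n + m} \<subseteq> {..<n + m}"
  proof (rule image_subsetI)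
    fix x assume "x \<in> {..<n + m}"
    then show "perm_sum n \<rho> \<sigma> x \<in> {..<n + m}"
      using \<rho>[of x] \<sigma>[of "x - n"] by (auto simp: perm_sum_def)
  qed
  ultimately show "bij_betw (perm_sum n \<rho> \<sigma>) {..<n + m} {..<n + m}"
    by (simp add: bij_betw_def endo_inj_surj)
next
  fix x assume "x \<notin> {..<n + m}"
  then show "perm_sum n \<rho> \<sigma> x = x"
    using permutes_not_in[OF assms(2), of "x - n"] by (simp add: perm_sum_def)
qed

lemma perm_sum_assoc:
  "perm_sum (n + m) (perm_sum n \<rho> \<sigma>) \<tau> = perm_sum n \<rho> (perm_sum m \<sigma> \<tau>)"
proof
  fix k
  consider "k < n" | "n \<le> k" "k < n + m" | "n + m \<le> k" by linarith
  then show "perm_sum (n + m) (perm_sum n \<rho> \<sigma>) \<tau> k = perm_sum n \<rho> (perm_sum m \<sigma> \<tau>) k"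
    by cases (simp_all add: perm_sum_def less_diff_conv2)
qed

lemma block_swap_hexagon:
  "block_swap n (m + l) = perm_sum m id (block_swap n l) \<circ> perm_sum (n + m) (block_swap n m) id"
proof
  fix k
  consider "k < n" | "n \<le> k" "k < n + m" | "n + m \<le> k" "k < n + m + l" | "n + m + l \<le> k"
    by linarith
  then show "block_swap n (m + l) k =
    (perm_sum m id (block_swap n l) \<circ> perm_sum (n + m) (block_swap n m) id) k"
    by cases (simp_all add: perm_sum_def block_swap_def less_diff_conv2)
qed

lemma block_swap_permutes: "block_swap n m permutes {..<n + m}"
proof (rule bij_imp_permutes)
  have "inj_on (block_swap n m) {..<n + m}"
    by (rule inj_onI) (auto simp: block_swap_def split: if_splits)
  moreover have "block_swap n m ` {..<n + m} \<subseteq> {..<n + m}"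
    by (auto simp: block_swap_def)
  ultimately show "bij_betw (block_swap n m) {..<n + m} {..<n + m}"
    by (simp add: bij_betw_def endo_inj_surj)
qed (simp add: block_swap_def)

lemma FreeSM_Idn_Ar: "xs \<in> lists A \<Longrightarrow> SArr xs id xs \<in> Ar (FreeSM A)"
  by (auto simp: FreeSM_Ar_iff permutes_id)

lemma FreeSM_Cmp_Ar:
  assumes "u \<in> Ar (FreeSM A)" "v \<in> Ar (FreeSM A)" "scod u = sdom v"
  shows "SArr (sdom u) (sperm v \<circ> sperm u) (scod v) \<in> Ar (FreeSM A)"
proof (rule FreeSM_ArI)
  have l: "length (sdom u) = length (sdom v)"
    using FreeSM_ArD(3)[OF assms(1)] assms(3) by simp
  show "sperm v \<circ> sperm u permutes {..<length (sdom u)}"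
    using FreeSM_ArD(4)[OF assms(1)] FreeSM_ArD(4)[OF assms(2)] l by (simp add: permutes_compose)
  show "sdom u ! i = scod v ! (sperm v \<circ> sperm u) i" if "i < length (sdom u)" for i
    using that assms l sperm_less_iff[OF assms(1), of i] by (simp add: sarr_nth flip: sarr_nth[of u])
qed (use assms FreeSM_ArD(1-3)[OF assms(1)] FreeSM_ArD(1-3)[OF assms(2)] in simp_all)

lemma FreeSM_TA_Ar:
  assumes "u \<in> Ar (FreeSM A)" "v \<in> Ar (FreeSM A)"
  shows "SArr (sdom u @ sdom v) (perm_sum (length (sdom u)) (sperm u) (sperm v)) (scod u @ scod v)
    \<in> Ar (FreeSM A)"
proof (rule FreeSM_ArI)
  note u = FreeSM_ArD[OF assms(1)] and v = FreeSM_ArD[OF assms(2)]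
  show "perm_sum (length (sdom u)) (sperm u) (sperm v) permutes {..<length (sdom u @ sdom v)}"
    using u(4) v(4) by (simp add: perm_sum_permutes)
  show "(sdom u @ sdom v) ! i = (scod u @ scod v) ! perm_sum (length (sdom u)) (sperm u) (sperm v) i"
    if "i < length (sdom u @ sdom v)" for i
    using that u(3) sperm_less_iff[OF assms(1), of i] assms
    by (simp add: perm_sum_def nth_append sarr_nth)
qed (use FreeSM_ArD(1-3)[OF assms(1)] FreeSM_ArD(1-3)[OF assms(2)] in simp_all)

lemma FreeSM_Sym_Ar:
  assumes "xs \<in> lists A" "ys \<in> lists A"
  shows "SArr (xs @ ys) (block_swap (length xs) (length ys)) (ys @ xs) \<in> Ar (FreeSM A)"
proof (rule FreeSM_ArI)
  show "block_swap (length xs) (length ys) permutes {..<length (xs @ ys)}"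
    using block_swap_permutes by simp
  show "(xs @ ys) ! i = (ys @ xs) ! block_swap (length xs) (length ys) i"
    if "i < length (xs @ ys)" for i
    using that by (auto simp: block_swap_def nth_append)
qed (use assms in simp_all)

lemma FreeSM_isomorphism:
  assumes "u \<in> Ar (FreeSM A)"
  shows "isomorphism (FreeSM A) u"
proof -
  note p = FreeSM_ArD(4)[OF assms]
  \<comment> \<open>Arrows between entries are identities, so inverting the permutation inverts the arrow.\<close>
  let ?v = "SArr (scod u) (inv (sperm u)) (sdom u)"
  have "?v \<in> Ar (FreeSM A)"
  proof (rule FreeSM_ArI)
    show "inv (sperm u) permutes {..<length (scod u)}"
      using permutes_inv[OF p] FreeSM_ArD(3)[OF assms] by simp
    show "scod u ! i = sdom u ! inv (sperm u) i" if "i < length (scod u)" for i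
    proof -
      have "inv (sperm u) i < length (sdom u)"
        using that sperm_less_iff[OF assms, of "inv (sperm u) i"] FreeSM_ArD(3)[OF assms]
        by (simp add: permutes_inverses(1)[OF p])
      then show ?thesis
        using sarr_nth[OF assms, of "inv (sperm u) i"] by (simp add: permutes_inverses(1)[OF p])
    qed
  qed (use FreeSM_ArD(1-3)[OF assms] in simp_all)
  then have "?v \<in> hom (FreeSM A) (scod u) (sdom u)" by (simp add: FreeSM_hom_iff)
  moreover have "inv (sperm u) \<circ> sperm u = id" "sperm u \<circ> inv (sperm u) = id"
    using permutes_inv_o[OF p] by auto
  ultimately show ?thesis
    using assms unfolding isomorphism_def by (auto intro!: bexI[of _ ?v])
qed

theorem FreeSM_ssm_groupoid: "ssm_groupoid (FreeSM A)"
proof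
  fix f x y f' x' y'
  assume "f \<in> hom (FreeSM A) x y" "f' \<in> hom (FreeSM A) x' y'"
  then have f: "f \<in> Ar (FreeSM A)" "sdom f = x" "scod f = y"
    and f': "f' \<in> Ar (FreeSM A)" "sdom f' = x'" "scod f' = y'"
    by (simp_all add: FreeSM_hom_iff)
  have "(block_swap (length x) (length x') \<circ> perm_sum (length x) (sperm f) (sperm f')) k =
      (perm_sum (length x') (sperm f') (sperm f) \<circ> block_swap (length x) (length x')) k" for k
    using sperm_less_iff[OF f(1), of k] sperm_ge[OF f(1), of "k - length x'"]
      sperm_less_iff[OF f'(1), of "k - length x"] sperm_ge[OF f'(1), of "k - length x"] f(2) f'(2)
    by (auto simp: block_swap_def perm_sum_def)
  then show "Cmp (FreeSM A) (Sym (FreeSM A) y y') (TA (FreeSM A) f f') =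
    Cmp (FreeSM A) (TA (FreeSM A) f' f) (Sym (FreeSM A) x x')"
    using f f' FreeSM_ArD(3)[OF f(1)] FreeSM_ArD(3)[OF f'(1)] by (simp add: fun_eq_iff)
next
  fix f g f' g' x y z x' y' z'
  assume *: "f \<in> hom (FreeSM A) x y" "g \<in> hom (FreeSM A) y z"
    "f' \<in> hom (FreeSM A) x' y'" "g' \<in> hom (FreeSM A) y' z'"
  then have f: "f \<in> Ar (FreeSM A)" "sdom f = x" "scod f = y" by (simp_all add: FreeSM_hom_iff)
  then show "TA (FreeSM A) (Cmp (FreeSM A) g f) (Cmp (FreeSM A) g' f') =
    Cmp (FreeSM A) (TA (FreeSM A) g g') (TA (FreeSM A) f f')"
    using * sperm_less_iff[OF f(1)] FreeSM_ArD(3)[OF f(1)]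
    by (simp add: perm_sum_def fun_eq_iff FreeSM_hom_iff)
next
  fix f assume f: "f \<in> Ar (FreeSM A)"
  show "TA (FreeSM A) f (Idn (FreeSM A) (MU (FreeSM A))) = f"
    using sperm_ge[OF f] by (intro sarr.expand) (simp add: perm_sum_def fun_eq_iff)
  show "TA (FreeSM A) (Idn (FreeSM A) (MU (FreeSM A))) f = f"
    by (intro sarr.expand) (simp add: perm_sum_def fun_eq_iff)
next
  fix f assume "f \<in> Ar (FreeSM A)"
  then show "Dom (FreeSM A) f \<in> Ob (FreeSM A)" "Cod (FreeSM A) f \<in> Ob (FreeSM A)"
    "isomorphism (FreeSM A) f"
    by (simp_all add: FreeSM_ArD(1,2) FreeSM_isomorphism del: in_lists_conv_set)
next
  fix x assume "x \<in> Ob (FreeSM A)"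
  then show "Idn (FreeSM A) x \<in> hom (FreeSM A) x x"
    by (simp add: FreeSM_hom_iff FreeSM_Idn_Ar del: in_lists_conv_set)
next
  fix f g x y z assume fg: "f \<in> hom (FreeSM A) x y" "g \<in> hom (FreeSM A) y z"
  then have "f \<in> Ar (FreeSM A)" "g \<in> Ar (FreeSM A)" "scod f = sdom g"
    by (simp_all add: FreeSM_hom_iff)
  from FreeSM_Cmp_Ar[OF this] fg show "Cmp (FreeSM A) g f \<in> hom (FreeSM A) x z"
    by (simp add: FreeSM_hom_iff)
next
  fix f f' x y x' y' assume "f \<in> hom (FreeSM A) x y" "f' \<in> hom (FreeSM A) x' y'"
  then show "TA (FreeSM A) f f' \<in>
      hom (FreeSM A) (TO (FreeSM A) x x') (TO (FreeSM A) y y')"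
    by (auto simp: FreeSM_hom_iff FreeSM_TA_Ar)
next
  fix x y assume "x \<in> Ob (FreeSM A)" "y \<in> Ob (FreeSM A)"
  then show "Sym (FreeSM A) x y \<in> hom (FreeSM A) (TO (FreeSM A) x y) (TO (FreeSM A) y x)"
    by (simp add: FreeSM_hom_iff FreeSM_Sym_Ar del: in_lists_conv_set)
next
  fix f x y assume "f \<in> hom (FreeSM A) x y"
  then show "Cmp (FreeSM A) f (Idn (FreeSM A) x) = f" "Cmp (FreeSM A) (Idn (FreeSM A) y) f = f"
    by (auto simp: FreeSM_hom_iff)
next
  fix x y assume "x \<in> Ob (FreeSM A)" "y \<in> Ob (FreeSM A)"
  show "TA (FreeSM A) (Idn (FreeSM A) x) (Idn (FreeSM A) y) = Idn (FreeSM A) (TO (FreeSM A) x y)"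
    by (simp add: perm_sum_def fun_eq_iff)
  show "Cmp (FreeSM A) (Sym (FreeSM A) y x) (Sym (FreeSM A) x y) = Idn (FreeSM A) (TO (FreeSM A) x y)"
    by (auto simp: block_swap_def fun_eq_iff)
next
  fix f g h
  show "TA (FreeSM A) (TA (FreeSM A) f g) h = TA (FreeSM A) f (TA (FreeSM A) g h)"
    by (simp add: perm_sum_assoc)
next
  fix x y z
  show "Sym (FreeSM A) x (TO (FreeSM A) y z) =
    Cmp (FreeSM A) (TA (FreeSM A) (Idn (FreeSM A) y) (Sym (FreeSM A) x z))
     (TA (FreeSM A) (Sym (FreeSM A) x y) (Idn (FreeSM A) z))"
    by (simp add: block_swap_hexagon)
qed (simp_all add: comp_assoc)

section \<open>Functors out of the free symmetric strict monoidal groupoid\<close>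

lemma ext_functor_sel [simp]:
  "FO (ext_functor \<phi>) xs = concat (map \<phi> xs)"
  "FA (ext_functor \<phi>) u =
    SArr (concat (map \<phi> (sdom u))) (block_perm \<phi> u) (concat (map \<phi> (scod u)))"
  by (simp_all add: ext_functor_def)

lemma block_perm_at:
  "\<lbrakk>i < length (sdom u); a < length (\<phi> (sdom u ! i))\<rbrakk> \<Longrightarrow>
    block_perm \<phi> u (block_offset \<phi> (sdom u) i + a) = block_offset \<phi> (scod u) (sperm u i) + a"
  using block_position_less[of i "sdom u" a \<phi>]
  by (simp add: block_perm_def length_block_positions block_positions_nth)

lemma block_perm_ge:
  "length (concat (map \<phi> (sdom u))) \<le> k \<Longrightarrow> block_perm \<phi> u k = k"
  by (simp add: block_perm_def length_block_positions)

lemma concat_map_in_lists: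
  "\<lbrakk>\<And>x. x \<in> A \<Longrightarrow> \<phi> x \<in> lists B; xs \<in> lists A\<rbrakk> \<Longrightarrow> concat (map \<phi> xs) \<in> lists B"
  by auto blast

text \<open>An arrow only permutes the entries, and the total length is a sum over the entries.\<close>

lemma length_concat_sarr:
  assumes "u \<in> Ar (FreeSM A)"
  shows "length (concat (map \<phi> (scod u))) = length (concat (map \<phi> (sdom u)))"
proof -
  have len: "length (concat (map \<phi> xs)) = (\<Sum>i<length xs. length (\<phi> (xs ! i)))" for xs
    by (simp add: length_concat sum_list_sum_nth comp_def atLeast0LessThan)
  have "(\<Sum>i<length (sdom u). length (\<phi> (scod u ! i))) =
      (\<Sum>i<length (sdom u). length (\<phi> (scod u ! sperm u i)))"
    using sum.permute[OF FreeSM_ArD(4)[OF assms], of "\<lambda>i. length (\<phi> (scod u ! i))"] by (simp add: comp_def)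
  also have "\<dots> = (\<Sum>i<length (sdom u). length (\<phi> (sdom u ! i)))"
    by (rule sum.cong) (simp_all add: sarr_nth[OF assms])
  finally show ?thesis
    unfolding len FreeSM_ArD(3)[OF assms] .
qed

text \<open>The block permutation is injective because a position determines its block and its place
  inside the block; on a finite set this suffices.\<close>

lemma ext_functor_Ar:
  assumes \<phi>: "\<And>x. x \<in> A \<Longrightarrow> \<phi> x \<in> lists B" and u: "u \<in> Ar (FreeSM A)"
  shows "FA (ext_functor \<phi>) u \<in> Ar (FreeSM B)"
proof -
  let ?N = "length (concat (map \<phi> (sdom u)))"
  have at: "sperm u i < length (scod u)" "scod u ! sperm u i = sdom u ! i"
    if "i < length (sdom u)" for i
    using that sperm_less_iff[OF u] FreeSM_ArD(3)[OF u] sarr_nth[OF u] by auto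
  have "inj_on (block_perm \<phi> u) {..<?N}"
  proof (rule inj_onI)
    fix k l assume "k \<in> {..<?N}" "l \<in> {..<?N}" and eq: "block_perm \<phi> u k = block_perm \<phi> u l"
    then obtain i a j b where i: "i < length (sdom u)" "a < length (\<phi> (sdom u ! i))"
        "k = block_offset \<phi> (sdom u) i + a"
      and j: "j < length (sdom u)" "b < length (\<phi> (sdom u ! j))"
        "l = block_offset \<phi> (sdom u) j + b"
      by (metis block_position_exhaust lessThan_iff)
    then have "sperm u i = sperm u j \<and> a = b"
      using eq at by (intro block_position_unique[of _ "scod u" _ \<phi>]) (simp_all add: block_perm_at)
    then show "k = l" using i j permutes_inj[OF FreeSM_ArD(4)[OF u]] by (simp add: inj_eq)
  qed
  moreover have "block_perm \<phi> u ` {..<?N} \<subseteq> {..<?N}"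
  proof (rule image_subsetI)
    fix k assume "k \<in> {..<?N}"
    then obtain i a where "i < length (sdom u)" "a < length (\<phi> (sdom u ! i))"
        "k = block_offset \<phi> (sdom u) i + a"
      by (metis block_position_exhaust lessThan_iff)
    then show "block_perm \<phi> u k \<in> {..<?N}"
      using at block_position_less[of "sperm u i" "scod u" a \<phi>] length_concat_sarr[OF u, of \<phi>]
      by (simp add: block_perm_at)
  qed
  ultimately have "bij_betw (block_perm \<phi> u) {..<?N} {..<?N}"
    by (simp add: bij_betw_def endo_inj_surj)
  then have "block_perm \<phi> u permutes {..<?N}"
    by (rule bij_imp_permutes) (simp add: block_perm_ge)
  moreover have "concat (map \<phi> (sdom u)) ! k = concat (map \<phi> (scod u)) ! block_perm \<phi> u k"
    if "k < ?N" for k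
    using that at by (elim block_position_exhaust) (simp add: block_perm_at concat_map_nth)
  moreover have "concat (map \<phi> (sdom u)) \<in> lists B" "concat (map \<phi> (scod u)) \<in> lists B"
    using FreeSM_ArD(1,2)[OF u] \<phi> by (meson concat_map_in_lists)+
  ultimately show ?thesis
    unfolding ext_functor_sel using length_concat_sarr[OF u, of \<phi>]
    by (intro FreeSM_ArI) (simp_all)
qed

lemma ext_functor_Idn:
  "FA (ext_functor \<phi>) (SArr xs id xs) = SArr (concat (map \<phi> xs)) id (concat (map \<phi> xs))"
proof -
  have "block_perm \<phi> (SArr xs id xs) k = k" for k
  proof (cases "k < length (concat (map \<phi> xs))")
    case True
    then show ?thesis
      by (elim block_position_exhaust) (use block_perm_at[of _ "SArr xs id xs"] in simp)
  qed (simp add: block_perm_ge)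
  then show ?thesis by (simp add: fun_eq_iff)
qed

lemma ext_functor_Cmp:
  assumes u: "u \<in> Ar (FreeSM A)" and v: "v \<in> Ar (FreeSM A)" and uv: "scod u = sdom v"
  shows "block_perm \<phi> (SArr (sdom u) (sperm v \<circ> sperm u) (scod v)) =
    block_perm \<phi> v \<circ> block_perm \<phi> u" (is "block_perm \<phi> ?w = _")
proof
  fix k
  show "block_perm \<phi> ?w k = (block_perm \<phi> v \<circ> block_perm \<phi> u) k"
  proof (cases "k < length (concat (map \<phi> (sdom u)))")
    case True
    then obtain i a where i: "i < length (sdom u)" "a < length (\<phi> (sdom u ! i))"
        "k = block_offset \<phi> (sdom u) i + a"
      by (metis block_position_exhaust)
    moreover have "sperm u i < length (sdom v)" "sdom v ! sperm u i = sdom u ! i"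
      using i sperm_less_iff[OF u] FreeSM_ArD(3)[OF u] sarr_nth[OF u] uv by auto
    ultimately show ?thesis
      using block_perm_at[of i ?w a \<phi>] block_perm_at[of "sperm u i" v a \<phi>]
      by (simp add: block_perm_at uv)
  next
    case False
    then show ?thesis
      using length_concat_sarr[OF u, of \<phi>] uv by (simp add: block_perm_ge)
  qed
qed

lemma ext_functor_TA:
  assumes u: "u \<in> Ar (FreeSM A)" and v: "v \<in> Ar (FreeSM A)"
  shows "block_perm \<phi> (SArr (sdom u @ sdom v) (perm_sum (length (sdom u)) (sperm u) (sperm v))
      (scod u @ scod v)) =
    perm_sum (length (concat (map \<phi> (sdom u)))) (block_perm \<phi> u) (block_perm \<phi> v)"
    (is "block_perm \<phi> ?w = perm_sum ?N _ _")
proof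
  note l = FreeSM_ArD(3)[OF u]
  fix k
  consider (left) "k < ?N" | (right) "?N \<le> k" "k - ?N < length (concat (map \<phi> (sdom v)))"
    | (outside) "?N \<le> k" "length (concat (map \<phi> (sdom v))) \<le> k - ?N"
    by linarith
  then show "block_perm \<phi> ?w k = perm_sum ?N (block_perm \<phi> u) (block_perm \<phi> v) k"
  proof cases
    case left
    then obtain i a where i: "i < length (sdom u)" "a < length (\<phi> (sdom u ! i))"
        "k = block_offset \<phi> (sdom u) i + a"
      by (metis block_position_exhaust)
    then show ?thesis
      using block_perm_at[of i ?w a \<phi>] left sperm_less_iff[OF u, of i] l
      by (simp add: block_perm_at block_offset_append nth_append perm_sum_def)
  next
    case right
    then obtain i a where i: "i < length (sdom v)" "a < length (\<phi> (sdom v ! i))"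
        "k - ?N = block_offset \<phi> (sdom v) i + a"
      by (metis block_position_exhaust)
    have k: "k = ?N + block_offset \<phi> (sdom v) i + a" using i(3) right(1) by linarith
    have "block_offset \<phi> (sdom u @ sdom v) (length (sdom u) + i) =
        ?N + block_offset \<phi> (sdom v) i" for i
      by (simp add: block_offset_def)
    moreover have "block_offset \<phi> (scod u @ scod v) (length (sdom u) + i) =
        ?N + block_offset \<phi> (scod v) i" for i
      using length_concat_sarr[OF u, of \<phi>] l by (simp add: block_offset_def)
    ultimately show ?thesis
      unfolding k using block_perm_at[of "length (sdom u) + i" ?w a \<phi>] i(1,2)
      by (simp add: block_perm_at perm_sum_def add.assoc)
  next
    case outside
    then show ?thesis by (simp add: block_perm_ge perm_sum_def)
  qed
qed

lemma ext_functor_Sym: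
  "block_perm \<phi> (SArr (xs @ ys) (block_swap (length xs) (length ys)) (ys @ xs)) =
    block_swap (length (concat (map \<phi> xs))) (length (concat (map \<phi> ys)))"
    (is "block_perm \<phi> ?w = block_swap ?N ?M")
proof
  fix k
  consider (left) "k < ?N" | (right) "?N \<le> k" "k - ?N < ?M" | (outside) "?N + ?M \<le> k"
    by linarith
  then show "block_perm \<phi> ?w k = block_swap ?N ?M k"
  proof cases
    case left
    then obtain i a where i: "i < length xs" "a < length (\<phi> (xs ! i))"
        "k = block_offset \<phi> xs i + a"
      by (metis block_position_exhaust)
    moreover have "block_offset \<phi> (xs @ ys) i = block_offset \<phi> xs i"
      "block_offset \<phi> (ys @ xs) (length ys + i) = ?M + block_offset \<phi> xs i"
      using i by (simp_all add: block_offset_def)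
    ultimately show ?thesis
      using block_perm_at[of i ?w a \<phi>] left
      by (simp add: nth_append block_swap_def)
  next
    case right
    then obtain i a where i: "i < length ys" "a < length (\<phi> (ys ! i))"
        "k - ?N = block_offset \<phi> ys i + a"
      by (metis block_position_exhaust)
    have k: "k = ?N + block_offset \<phi> ys i + a" using i(3) right(1) by linarith
    have "block_offset \<phi> (xs @ ys) (length xs + i) = ?N + block_offset \<phi> ys i"
      "block_offset \<phi> (ys @ xs) i = block_offset \<phi> ys i"
      using i by (simp_all add: block_offset_def)
    then show ?thesis
      unfolding k using block_perm_at[of "length xs + i" ?w a \<phi>] i(1,2)
        block_position_less[of i ys a \<phi>]
      by (simp add: block_swap_def)
  next
    case outside
    then show ?thesis by (simp add: block_perm_ge block_swap_def)
  qed
qed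

theorem ext_functor_ssm:
  assumes \<phi>: "\<And>x. x \<in> A \<Longrightarrow> \<phi> x \<in> lists B"
  shows "ssm_functor (FreeSM A) (FreeSM B) (ext_functor \<phi>)"
proof
  fix x assume "x \<in> Ob (FreeSM A)"
  then show "FO (ext_functor \<phi>) x \<in> Ob (FreeSM B)"
    using concat_map_in_lists[of A \<phi> B x] \<phi> by (simp del: in_lists_conv_set)
  show "FA (ext_functor \<phi>) (Idn (FreeSM A) x) = Idn (FreeSM B) (FO (ext_functor \<phi>) x)"
    using ext_functor_Idn[of \<phi> x] by simp
next
  fix u x y assume "u \<in> hom (FreeSM A) x y"
  then show "FA (ext_functor \<phi>) u \<in>
      hom (FreeSM B) (FO (ext_functor \<phi>) x) (FO (ext_functor \<phi>) y)"
    using ext_functor_Ar[of A \<phi> B u, OF \<phi>] by (auto simp: FreeSM_hom_iff)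
next
  fix u v x y z assume "u \<in> hom (FreeSM A) x y" "v \<in> hom (FreeSM A) y z"
  then show "FA (ext_functor \<phi>) (Cmp (FreeSM A) v u) =
      Cmp (FreeSM B) (FA (ext_functor \<phi>) v) (FA (ext_functor \<phi>) u)"
    by (auto simp: FreeSM_hom_iff ext_functor_Cmp)
next
  fix u v assume "u \<in> Ar (FreeSM A)" "v \<in> Ar (FreeSM A)"
  then show "FA (ext_functor \<phi>) (TA (FreeSM A) u v) =
      TA (FreeSM B) (FA (ext_functor \<phi>) u) (FA (ext_functor \<phi>) v)"
    by (simp add: ext_functor_TA)
qed (simp_all add: ext_functor_Sym)

text \<open>A block permutation sees only the lengths of the blocks.  This is what allows the entries
  of a nerve object to be replaced by numerical labels when permutations are compared.\<close>

lemma block_perm_cong: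
  assumes "sperm u = sperm v"
    and "map (\<lambda>x. length (\<phi> x)) (sdom u) = map (\<lambda>y. length (\<psi> y)) (sdom v)"
    and "map (\<lambda>x. length (\<phi> x)) (scod u) = map (\<lambda>y. length (\<psi> y)) (scod v)"
  shows "block_perm \<phi> u = block_perm \<psi> v"
proof -
  have len: "length (sdom u) = length (sdom v)"
    using arg_cong[OF assms(2), of length] by simp
  have "length (\<phi> (sdom u ! i)) = length (\<psi> (sdom v ! i))" if "i < length (sdom u)" for i
    using arg_cong[OF assms(2), of "\<lambda>l. l ! i"] that len by simp
  then have "block_positions \<phi> (sdom u) = block_positions \<psi> (sdom v)"
    using len by (auto simp: block_positions_def intro!: arg_cong[of _ _ concat])
  then show ?thesis
    using assms(1) block_offset_cong[OF assms(3)] by (simp add: block_perm_def fun_eq_iff)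
qed

lemma ext_functor_cong:
  assumes "\<And>x. x \<in> A \<Longrightarrow> \<phi> x = \<psi> x"
  shows "feq (FreeSM A) (ext_functor \<phi>) (ext_functor \<psi>)"
proof -
  have m: "map \<phi> xs = map \<psi> xs" if "xs \<in> lists A" for xs
    using that assms by auto
  have "FA (ext_functor \<phi>) u = FA (ext_functor \<psi>) u" if "u \<in> Ar (FreeSM A)" for u
  proof -
    have "map \<phi> (sdom u) = map \<psi> (sdom u)" "map \<phi> (scod u) = map \<psi> (scod u)"
      using FreeSM_ArD(1,2)[OF that] m by blast+
    moreover have "block_perm \<phi> u = block_perm \<psi> u"
      by (rule block_perm_cong) (use FreeSM_ArD(1,2)[OF that] assms in auto)
    ultimately show ?thesis by (simp only: ext_functor_sel)
  qed
  moreover have "FO (ext_functor \<phi>) xs = FO (ext_functor \<psi>) xs" if "xs \<in> lists A" for xs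
    by (simp only: ext_functor_sel m[OF that])
  ultimately show ?thesis
    unfolding feq_def by (simp del: ext_functor_sel in_lists_conv_set)
qed

lemma ext_functor_idf: "feq (FreeSM A) (ext_functor (\<lambda>x. [x])) idf"
proof -
  have "FA (ext_functor (\<lambda>x. [x])) u = u" if u: "u \<in> Ar (FreeSM A)" for u
  proof (rule FreeSM_arrow_eqI)
    show "FA (ext_functor (\<lambda>x. [x])) u \<in> Ar (FreeSM A)"
      by (rule ext_functor_Ar[OF _ u]) simp
    show "sperm (FA (ext_functor (\<lambda>x. [x])) u) k = sperm u k"
      if "k < length (sdom (FA (ext_functor (\<lambda>x. [x])) u))" for k
    proof -
      have "k < length (sdom u)" using that by (simp add: length_concat comp_def sum_list_triv)
      moreover have "block_offset (\<lambda>x. [x]) xs i = i" if "i \<le> length xs" for i and xs :: "'a list"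
        using that by (simp add: block_offset_def)
      ultimately show ?thesis
        using block_perm_at[of k u 0 "\<lambda>x. [x]"] sperm_less_iff[OF u, of k] FreeSM_ArD(3)[OF u]
        by simp
    qed
  qed (use u in simp_all)
  then show ?thesis by (simp add: feq_def idf_def)
qed

text \<open>A composite of functors that are given on generators is again given on generators, so an
  equation between composites of operators of the nerve can be tested on generators.\<close>

lemma ext_functor_fcomp:
  assumes \<psi>: "\<And>x. x \<in> A \<Longrightarrow> \<psi> x \<in> lists B" and \<phi>: "\<And>y. y \<in> B \<Longrightarrow> \<phi> y \<in> lists D"
  shows "feq (FreeSM A) (ext_functor \<phi> \<odot> ext_functor \<psi>)
    (ext_functor (\<lambda>x. concat (map \<phi> (\<psi> x))))"
proof -
  let ?\<chi> = "\<lambda>x. concat (map \<phi> (\<psi> x))"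
  have cc: "concat (map \<phi> (concat (map \<psi> xs))) = concat (map ?\<chi> xs)" for xs
    by (induction xs) simp_all
  have "FA (ext_functor \<phi>) (FA (ext_functor \<psi>) u) = FA (ext_functor ?\<chi>) u"
    if u: "u \<in> Ar (FreeSM A)" for u
  proof (rule FreeSM_arrow_eqI)
    have \<chi>: "?\<chi> x \<in> lists D" if "x \<in> A" for x
      using concat_map_in_lists[OF \<phi> \<psi>[OF that]] by simp
    have v: "FA (ext_functor \<psi>) u \<in> Ar (FreeSM B)" using ext_functor_Ar[of A \<psi> B u] \<psi> u by blast
    show "FA (ext_functor \<phi>) (FA (ext_functor \<psi>) u) \<in> Ar (FreeSM D)"
      by (rule ext_functor_Ar[OF \<phi> v])
    show "FA (ext_functor ?\<chi>) u \<in> Ar (FreeSM D)"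
      by (rule ext_functor_Ar[OF \<chi> u])
    fix k assume "k < length (sdom (FA (ext_functor \<phi>) (FA (ext_functor \<psi>) u)))"
    then have "k < length (concat (map ?\<chi> (sdom u)))" by (simp add: cc)
    then obtain i b where i: "i < length (sdom u)" "b < length (?\<chi> (sdom u ! i))"
        "k = block_offset ?\<chi> (sdom u) i + b"
      by (rule block_position_exhaust)
    from i(2) obtain a c where a: "a < length (\<psi> (sdom u ! i))" "c < length (\<phi> (\<psi> (sdom u ! i) ! a))"
        "b = block_offset \<phi> (\<psi> (sdom u ! i)) a + c"
      by (rule block_position_exhaust)
    let ?j = "block_offset \<psi> (sdom u) i + a"
    have ui: "sperm u i < length (scod u)" "scod u ! sperm u i = sdom u ! i"
      using i sperm_less_iff[OF u] FreeSM_ArD(3)[OF u] sarr_nth[OF u] by auto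
    have k: "k = block_offset \<phi> (concat (map \<psi> (sdom u))) ?j + c"
      using block_offset_concat[of i "sdom u" a \<psi> \<phi>] i a by simp
    have "block_perm \<phi> (FA (ext_functor \<psi>) u) k =
        block_offset \<phi> (concat (map \<psi> (scod u))) (block_perm \<psi> u ?j) + c"
      unfolding k using block_perm_at[of ?j "FA (ext_functor \<psi>) u" c \<phi>] i(1) a(1,2)
        block_position_less[of i "sdom u" a \<psi>] concat_map_nth[of i "sdom u" a \<psi>]
      by simp
    also have "\<dots> = block_offset ?\<chi> (scod u) (sperm u i) + b"
      using block_offset_concat[of "sperm u i" "scod u" a \<psi> \<phi>] i a ui by (simp add: block_perm_at)
    also have "\<dots> = block_perm ?\<chi> u k"
      using i by (simp only: block_perm_at)
    finally show "sperm (FA (ext_functor \<phi>) (FA (ext_functor \<psi>) u)) k =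
      sperm (FA (ext_functor ?\<chi>) u) k" by simp
  qed (simp_all add: cc)
  then show ?thesis using cc by (simp add: feq_def fcomp_def)
qed

text \<open>With blocks of length one, the block permutation is the original permutation.\<close>

lemma ext_functor_singletons:
  assumes u: "u \<in> Ar (FreeSM A)"
  shows "FA (ext_functor (\<lambda>x. [f x])) u = SArr (map f (sdom u)) (sperm u) (map f (scod u))"
proof -
  have "block_perm (\<lambda>x. [f x]) u = block_perm (\<lambda>x. [x]) u"
    by (rule block_perm_cong) simp_all
  also have "\<dots> = sperm u"
    using ext_functor_idf[of A] u by (simp add: feq_def idf_def) (metis sarr.sel(2))
  finally show ?thesis by (simp add: concat_map_singleton)
qed

section \<open>Monoidal transformations\<close>

lemma feq_sym: "feq C F G \<Longrightarrow> feq C G F"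
  by (simp add: feq_def)

lemma feq_trans: "feq C F G \<Longrightarrow> feq C G H \<Longrightarrow> feq C F H"
  by (simp add: feq_def)

text \<open>In a groupoid invertibility of the components is automatic.\<close>

lemma invertible_monoidal_transformation_groupoidI:
  assumes "ssm_groupoid D" "nat_transformation C D F G \<eta>"
    and "\<And>x y. \<lbrakk>x \<in> Ob C; y \<in> Ob C\<rbrakk> \<Longrightarrow> \<eta> (TO C x y) = TA D (\<eta> x) (\<eta> y)"
    and "\<eta> (MU C) = Idn D (MU D)"
  shows "invertible_monoidal_transformation C D F G \<eta>"
proof -
  interpret D: ssm_groupoid D by fact
  interpret nat_transformation C D F G \<eta> by fact
  show ?thesis
    by unfold_locales (use assms(3,4) component_hom in \<open>auto simp: hom_def intro: D.groupoid\<close>)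
qed

lemma nat_transformation_feq:
  assumes "category C" "nat_transformation C D F G \<eta>" "feq C F F'" "feq C G G'"
  shows "nat_transformation C D F' G' \<eta>"
proof -
  interpret C: category C by fact
  interpret nat_transformation C D F G \<eta> by fact
  show ?thesis
  proof
    show "\<eta> x \<in> hom D (FO F' x) (FO G' x)" if "x \<in> Ob C" for x
      using component_hom[OF that] that assms(3,4) by (simp add: feq_def)
    show "Cmp D (\<eta> y) (FA F' f) = Cmp D (FA G' f) (\<eta> x)" if "f \<in> hom C x y" for f x y
      using naturality[OF that] that assms(3,4) by (simp add: feq_def hom_def)
  qed
qed

lemma monoidal_transformation_feq:
  assumes "category C" "invertible_monoidal_transformation C D F G \<eta>" "feq C F F'" "feq C G G'"
  shows "invertible_monoidal_transformation C D F' G' \<eta>"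
  using assms nat_transformation_feq
  by (fastforce simp: invertible_monoidal_transformation_def)

lemma rwhisker_monoidal:
  assumes "invertible_monoidal_transformation C D F G \<eta>" "ssm_functor B C H"
  shows "invertible_monoidal_transformation B D (F \<odot> H) (G \<odot> H) (rwhisker \<eta> H)"
proof -
  interpret invertible_monoidal_transformation C D F G \<eta> by fact
  interpret H: ssm_functor B C H by fact
  show ?thesis
    by unfold_locales
      (simp_all add: rwhisker_def fcomp_def H.map_TO H.map_MU H.ob_map component_hom
        naturality[OF H.ar_map] invertible component_TO component_MU)
qed

lemma lwhisker_monoidal:
  assumes "invertible_monoidal_transformation C D F G \<eta>" "ssm_functor D E H"
    and "cat_functor C D F" "cat_functor C D G" "category C" "ssm_groupoid D" "ssm_groupoid E"
  shows "invertible_monoidal_transformation C E (H \<odot> F) (H \<odot> G) (lwhisker H \<eta>)"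
proof -
  interpret invertible_monoidal_transformation C D F G \<eta> by fact
  interpret H: ssm_functor D E H by fact
  interpret F: cat_functor C D F by fact
  interpret G: cat_functor C D G by fact
  interpret D: ssm_groupoid D by fact
  interpret E: ssm_groupoid E by fact
  interpret C: category C by fact
  have Ar: "\<eta> x \<in> Ar D" if "x \<in> Ob C" for x
    using component_hom[OF that] by (simp add: hom_def)
  show ?thesis
  proof (rule invertible_monoidal_transformation_groupoidI[OF \<open>ssm_groupoid E\<close>])
    show "nat_transformation C E (H \<odot> F) (H \<odot> G) (lwhisker H \<eta>)"
    proof
      show "lwhisker H \<eta> x \<in> hom E (FO (H \<odot> F) x) (FO (H \<odot> G) x)" if "x \<in> Ob C" for x
        using H.ar_map[OF component_hom[OF that]] by (simp add: lwhisker_def fcomp_def)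
    next
      fix f x y assume f: "f \<in> hom C x y"
      then have "x \<in> Ob C" "y \<in> Ob C"
        using C.dom_in C.cod_in by (auto simp: hom_def)
      then show "Cmp E (lwhisker H \<eta> y) (FA (H \<odot> F) f) = Cmp E (FA (H \<odot> G) f) (lwhisker H \<eta> x)"
        using naturality[OF f] H.map_cmp[OF F.ar_map[OF f] component_hom]
          H.map_cmp[OF component_hom G.ar_map[OF f]]
        by (simp add: lwhisker_def fcomp_def)
    qed
  qed (simp_all add: lwhisker_def component_TO component_MU H.map_TA Ar H.map_idn D.MU_in H.map_MU)
qed

text \<open>The middle functors \<open>G\<close> and \<open>G'\<close> are only required to agree on \<open>C\<close>: in the pasting
  diagrams of the nerve they are two different composites of face operators, identified by a strict
  simplicial identity.\<close>

lemma vcomp_monoidal: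
  assumes "invertible_monoidal_transformation C D F G \<eta>"
    and "invertible_monoidal_transformation C D G' H \<theta>" and GG': "feq C G G'"
    and "cat_functor C D F" "cat_functor C D G'" "cat_functor C D H" "category C" "ssm_groupoid D"
  shows "invertible_monoidal_transformation C D F H (vcomp D \<theta> \<eta>)"
proof -
  interpret \<eta>: invertible_monoidal_transformation C D F G \<eta> by fact
  interpret \<theta>: invertible_monoidal_transformation C D G' H \<theta> by fact
  interpret F: cat_functor C D F by fact
  interpret G': cat_functor C D G' by fact
  interpret H: cat_functor C D H by fact
  interpret C: category C by fact
  interpret D: ssm_groupoid D by fact
  have \<eta>: "\<eta> x \<in> hom D (FO F x) (FO G' x)" if "x \<in> Ob C" for x
    using \<eta>.component_hom[OF that] GG' that by (simp add: feq_def)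
  show ?thesis
  proof (rule invertible_monoidal_transformation_groupoidI[OF \<open>ssm_groupoid D\<close>])
    show "nat_transformation C D F H (vcomp D \<theta> \<eta>)"
    proof
      show "vcomp D \<theta> \<eta> x \<in> hom D (FO F x) (FO H x)" if "x \<in> Ob C" for x
        using D.cmp_hom[OF \<eta>[OF that] \<theta>.component_hom[OF that]] by (simp add: vcomp_def)
    next
      fix f x y assume f: "f \<in> hom C x y"
      then have x: "x \<in> Ob C" and y: "y \<in> Ob C" and Ar: "f \<in> Ar C"
        using C.dom_in C.cod_in by (auto simp: hom_def)
      have "Cmp D (Cmp D (\<theta> y) (\<eta> y)) (FA F f) = Cmp D (\<theta> y) (Cmp D (\<eta> y) (FA F f))"
        using D.cmp_assoc[OF F.ar_map[OF f] \<eta>[OF y] \<theta>.component_hom[OF y]] by simp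
      also have "\<dots> = Cmp D (\<theta> y) (Cmp D (FA G' f) (\<eta> x))"
        using \<eta>.naturality[OF f] GG' Ar by (simp add: feq_def)
      also have "\<dots> = Cmp D (Cmp D (FA H f) (\<theta> x)) (\<eta> x)"
        using D.cmp_assoc[OF \<eta>[OF x] G'.ar_map[OF f] \<theta>.component_hom[OF y]]
          \<theta>.naturality[OF f] by simp
      also have "\<dots> = Cmp D (FA H f) (Cmp D (\<theta> x) (\<eta> x))"
        using D.cmp_assoc[OF \<eta>[OF x] \<theta>.component_hom[OF x] H.ar_map[OF f]] by simp
      finally show "Cmp D (vcomp D \<theta> \<eta> y) (FA F f) = Cmp D (FA H f) (vcomp D \<theta> \<eta> x)"
        by (simp add: vcomp_def)
    qed
    show "vcomp D \<theta> \<eta> (TO C x y) = TA D (vcomp D \<theta> \<eta> x) (vcomp D \<theta> \<eta> y)"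
      if "x \<in> Ob C" "y \<in> Ob C" for x y
      using D.TA_cmp[OF \<eta>[OF that(1)] \<theta>.component_hom[OF that(1)]
          \<eta>[OF that(2)] \<theta>.component_hom[OF that(2)]] that
      by (simp add: vcomp_def \<eta>.component_TO \<theta>.component_TO)
    show "vcomp D \<theta> \<eta> (MU C) = Idn D (MU D)"
      using D.cmp_idn[OF D.idn_hom[OF D.MU_in]]
      by (simp add: vcomp_def \<eta>.component_MU \<theta>.component_MU)
  qed
qed

lemma tid_monoidal:
  assumes "ssm_functor C D F" "category C" "ssm_groupoid D"
  shows "invertible_monoidal_transformation C D F F (tid D F)"
proof -
  interpret F: ssm_functor C D F by fact
  interpret C: category C by fact
  interpret D: ssm_groupoid D by fact
  show ?thesis
  proof (rule invertible_monoidal_transformation_groupoidI[OF \<open>ssm_groupoid D\<close>])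
    show "nat_transformation C D F F (tid D F)"
      by unfold_locales
        (simp_all add: tid_def D.idn_hom F.ob_map D.cmp_idn[OF F.ar_map] D.idn_cmp[OF F.ar_map])
  qed (simp_all add: tid_def F.map_TO F.map_MU F.ob_map D.TA_idn)
qed

text \<open>Every object is a concatenation of one-element lists.\<close>

lemma monoidal_transformation_determined_by_generators:
  assumes "invertible_monoidal_transformation (FreeSM A) D F G \<eta>"
    and "invertible_monoidal_transformation (FreeSM A) D F' G' \<theta>"
    and "\<And>x. x \<in> A \<Longrightarrow> \<eta> [x] = \<theta> [x]"
  shows "teq (FreeSM A) \<eta> \<theta>"
proof -
  interpret \<eta>: invertible_monoidal_transformation "FreeSM A" D F G \<eta> by fact
  interpret \<theta>: invertible_monoidal_transformation "FreeSM A" D F' G' \<theta> by fact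
  have "\<eta> xs = \<theta> xs" if "set xs \<subseteq> A" for xs
    using that
  proof (induction xs)
    case Nil
    then show ?case using \<eta>.component_MU \<theta>.component_MU by simp
  next
    case (Cons x xs)
    then have "xs \<in> lists A" "x \<in> A" by auto
    then show ?case
      using \<eta>.component_TO[of "[x]" xs] \<theta>.component_TO[of "[x]" xs] assms(3) Cons by simp
  qed
  then show ?thesis by (auto simp: teq_def)
qed

lemma ext_transformation_simps [simp]:
  "ext_transformation D \<eta> [] = Idn D (MU D)"
  "ext_transformation D \<eta> (x # xs) = TA D (\<eta> x) (ext_transformation D \<eta> xs)"
  by (simp_all add: ext_transformation_def)

lemma ext_transformation_hom:
  assumes "\<And>x. x \<in> A \<Longrightarrow> \<eta> x \<in> hom (FreeSM B) (a x) (b x)" "set xs \<subseteq> A"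
  shows "ext_transformation (FreeSM B) \<eta> xs \<in>
    hom (FreeSM B) (concat (map a xs)) (concat (map b xs))"
  using assms(2)
proof (induction xs)
  case Nil
  then show ?case using FreeSM_Idn_Ar[of "[]" B] by (simp add: FreeSM_hom_iff)
next
  case (Cons x xs)
  then have "\<eta> x \<in> hom (FreeSM B) (a x) (b x)" "ext_transformation (FreeSM B) \<eta> xs \<in>
    hom (FreeSM B) (concat (map a xs)) (concat (map b xs))"
    using assms(1) by auto
  then show ?case
    using ssm_groupoid.TA_hom[OF FreeSM_ssm_groupoid, of "\<eta> x" B "a x" "b x"] by fastforce
qed

lemma ext_transformation_singleton:
  assumes "u \<in> Ar (FreeSM B)" "\<eta> x = u"
  shows "ext_transformation (FreeSM B) \<eta> [x] = u"
  using ssm_groupoid.TA_unit(2)[OF FreeSM_ssm_groupoid assms(1)] assms(2) by simp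

lemma ext_transformation_at:
  assumes "\<And>x. x \<in> set xs \<Longrightarrow> sdom (\<eta> x) = a x" "i < length xs" "k < length (a (xs ! i))"
  shows "sperm (ext_transformation (FreeSM B) \<eta> xs) (block_offset a xs i + k) =
    block_offset a xs i + sperm (\<eta> (xs ! i)) k"
  using assms
proof (induction xs arbitrary: i)
  case (Cons x xs)
  then show ?case by (cases i) (simp_all add: perm_sum_def)
qed simp

text \<open>The counterpart of \<open>block_perm_cong\<close> for sums of arrows: it allows the entries to be
  replaced by labels.\<close>

lemma ext_transformation_sperm_cong:
  assumes "map (\<lambda>x. (length (sdom (\<eta> x)), sperm (\<eta> x))) xs =
    map (\<lambda>y. (length (sdom (\<theta> y)), sperm (\<theta> y))) ys"
  shows "sperm (ext_transformation (FreeSM B) \<eta> xs) = sperm (ext_transformation (FreeSM D) \<theta> ys)"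
  using assms
proof (induction xs arbitrary: ys)
  case Nil
  then show ?case by simp
next
  case (Cons x xs)
  then show ?case by (cases ys) fastforce+
qed

text \<open>Naturality holds because a block permutation moves whole blocks and the components act
  inside the blocks.\<close>

theorem ext_transformation_monoidal:
  assumes \<eta>: "\<And>x. x \<in> A \<Longrightarrow> \<eta> x \<in> hom (FreeSM B) (a x) (b x)"
  shows "invertible_monoidal_transformation (FreeSM A) (FreeSM B) (ext_functor a) (ext_functor b)
    (ext_transformation (FreeSM B) \<eta>)"
proof (rule invertible_monoidal_transformation_groupoidI[OF FreeSM_ssm_groupoid])
  let ?E = "ext_transformation (FreeSM B) \<eta>"
  have a: "a x \<in> lists B" and b: "b x \<in> lists B" and lab: "length (b x) = length (a x)"
    and dom: "sdom (\<eta> x) = a x" and Ar: "\<eta> x \<in> Ar (FreeSM B)" if "x \<in> A" for x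
    using \<eta>[OF that] FreeSM_ArD(1-3)[of "\<eta> x" B] by (auto simp: FreeSM_hom_iff)
  have E: "?E xs \<in> Ar (FreeSM B)" "sdom (?E xs) = concat (map a xs)"
    "scod (?E xs) = concat (map b xs)" if "xs \<in> lists A" for xs
    using ext_transformation_hom[of A \<eta> B a b xs] \<eta> that by (auto simp: FreeSM_hom_iff)
  have off: "block_offset b xs i = block_offset a xs i" if "xs \<in> lists A" for xs i
    using that lab by (intro block_offset_cong) auto
  have at: "sperm (?E xs) (block_offset a xs i + k) = block_offset a xs i + sperm (\<eta> (xs ! i)) k"
    if "xs \<in> lists A" "i < length xs" "k < length (a (xs ! i))" for xs i k
    using that dom by (intro ext_transformation_at) auto
  show "nat_transformation (FreeSM A) (FreeSM B) (ext_functor a) (ext_functor b) ?E"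
  proof
    fix xs assume "xs \<in> Ob (FreeSM A)"
    then show "?E xs \<in> hom (FreeSM B) (FO (ext_functor a) xs) (FO (ext_functor b) xs)"
      using E by (simp add: FreeSM_hom_iff del: in_lists_conv_set)
  next
    fix u xs ys assume "u \<in> hom (FreeSM A) xs ys"
    then have u: "u \<in> Ar (FreeSM A)" and xs: "sdom u = xs" "xs \<in> lists A"
      and ys: "scod u = ys" "ys \<in> lists A"
      using FreeSM_ArD(1,2)[of u A] by (auto simp: FreeSM_hom_iff)
    have ea: "FA (ext_functor a) u \<in> Ar (FreeSM B)" and eb: "FA (ext_functor b) u \<in> Ar (FreeSM B)"
      by (rule ext_functor_Ar[OF _ u]; simp add: a b del: in_lists_conv_set)+
    show "Cmp (FreeSM B) (?E ys) (FA (ext_functor a) u) =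
      Cmp (FreeSM B) (FA (ext_functor b) u) (?E xs)"
    proof (rule FreeSM_arrow_eqI)
      show "Cmp (FreeSM B) (?E ys) (FA (ext_functor a) u) \<in> Ar (FreeSM B)"
        unfolding FreeSM_sel
        by (rule FreeSM_Cmp_Ar) (use ea E(1)[OF ys(2)] in \<open>simp_all add: E(2)[OF ys(2)] ys(1)\<close>)
      show "Cmp (FreeSM B) (FA (ext_functor b) u) (?E xs) \<in> Ar (FreeSM B)"
        unfolding FreeSM_sel
        by (rule FreeSM_Cmp_Ar) (use eb E(1)[OF xs(2)] in \<open>simp_all add: E(3)[OF xs(2)] xs(1)\<close>)
      fix k assume "k < length (sdom (Cmp (FreeSM B) (?E ys) (FA (ext_functor a) u)))"
      then have "k < length (concat (map a xs))" using xs by (simp)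
      then obtain i t where i: "i < length xs" "t < length (a (xs ! i))" "k = block_offset a xs i + t"
        by (rule block_position_exhaust)
      then have ui: "sperm u i < length ys" "ys ! sperm u i = xs ! i"
        using sperm_less_iff[OF u] FreeSM_ArD(3)[OF u] sarr_nth[OF u] xs ys by auto
      have x: "xs ! i \<in> A" using i xs by auto
      have "sperm (\<eta> (xs ! i)) t < length (b (xs ! i))"
        using i sperm_less_iff[OF Ar[OF x]] dom[OF x] lab[OF x] by simp
      then show "sperm (Cmp (FreeSM B) (?E ys) (FA (ext_functor a) u)) k =
        sperm (Cmp (FreeSM B) (FA (ext_functor b) u) (?E xs)) k"
        using i ui xs ys at[OF xs(2) i(1,2)] at[OF ys(2) ui(1), of t]
          block_perm_at[of i u t a] block_perm_at[of i u "sperm (\<eta> (xs ! i)) t" b]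
        by (simp add: off)
    qed (use xs ys E in simp_all)
  qed
next
  fix xs ys assume "xs \<in> Ob (FreeSM A)" "ys \<in> Ob (FreeSM A)"
  then have "set xs \<subseteq> A" "set ys \<subseteq> A" by auto
  then show "ext_transformation (FreeSM B) \<eta> (TO (FreeSM A) xs ys) =
    TA (FreeSM B) (ext_transformation (FreeSM B) \<eta> xs) (ext_transformation (FreeSM B) \<eta> ys)"
  proof (induction xs)
    case Nil
    then show ?case
      using ext_transformation_hom[of A \<eta> B a b ys] \<eta>
        ssm_groupoid.TA_unit(1)[OF FreeSM_ssm_groupoid, of "ext_transformation (FreeSM B) \<eta> ys" B]
      by (auto simp: FreeSM_hom_iff)
  next
    case (Cons x xs)
    have "\<eta> x \<in> Ar (FreeSM B)" "ext_transformation (FreeSM B) \<eta> xs \<in> Ar (FreeSM B)"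
      "ext_transformation (FreeSM B) \<eta> ys \<in> Ar (FreeSM B)"
      using Cons.prems \<eta>[of x] ext_transformation_hom[of A \<eta> B a b] \<eta> by (auto simp: FreeSM_hom_iff)
    from ssm_groupoid.TA_assoc[OF FreeSM_ssm_groupoid this] Cons
    show ?case by (simp del: FreeSM_sel(7))
  qed
qed simp

section \<open>Chains of arrows in a category\<close>

text \<open>The arrows of a chain after omission of an object other than the last one: position \<open>n\<close> of the list
  of arrows stands for \<open>T\<^sub>n\<^sub>+\<^sub>2\<close>.  In contrast to the formula with \<open>take\<close> and \<open>drop\<close>, the recursion makes
  the simplicial identities provable by induction.\<close>

fun omit_at :: "('o, 'a, 'z) cat_scheme \<Rightarrow> nat \<Rightarrow> 'a list \<Rightarrow> 'a list" where
  "omit_at C n [] = []"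
| "omit_at C 0 [f] = []"
| "omit_at C 0 (f # g # fs) = Cmp C f g # fs"
| "omit_at C (Suc n) (f # fs) = f # omit_at C n fs"

text \<open>The arrows of a chain with last object \<open>T\<close> after insertion of the identity of \<open>T\<^sub>n\<^sub>+\<^sub>1\<close>.\<close>

fun insert_idn :: "('o, 'a, 'z) cat_scheme \<Rightarrow> 'o \<Rightarrow> nat \<Rightarrow> 'a list \<Rightarrow> 'a list" where
  "insert_idn C T 0 fs = Idn C T # fs"
| "insert_idn C T (Suc n) [] = []"
| "insert_idn C T (Suc n) (f # fs) = f # insert_idn C (Dom C f) n fs"

lemma two_le_length_E:
  assumes "2 \<le> length fs"
  obtains f g gs where "fs = f # g # gs"
  using assms by (auto simp: numeral_2_eq_2 Suc_le_length_iff)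

lemma length_omit_at: "n < length fs \<Longrightarrow> length (omit_at C n fs) = length fs - 1"
  by (induction C n fs rule: omit_at.induct) auto

lemma length_insert_idn: "n \<le> length fs \<Longrightarrow> length (insert_idn C T n fs) = Suc (length fs)"
  by (induction C T n fs rule: insert_idn.induct) auto

lemma omit_at_eq:
  "n < length fs \<Longrightarrow> omit_at C n fs =
    (if Suc n = length fs then butlast fs
     else take n fs @ [Cmp C (fs ! n) (fs ! Suc n)] @ drop (n + 2) fs)"
  by (induction C n fs rule: omit_at.induct) auto

lemma insert_idn_eq:
  "n \<le> length fs \<Longrightarrow> insert_idn C T n fs =
    take n fs @ [Idn C (if n = 0 then T else Dom C (fs ! (n - 1)))] @ drop n fs"
proof (induction C T n fs rule: insert_idn.induct)
  case (3 C T n f fs)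
  then show ?case by (cases n) auto
qed auto

lemma omit_Chain: "n < length fs \<Longrightarrow> omit Q (n + 2) (Chain T fs) = Chain T (omit_at Q n fs)"
  by (auto simp: omit_at_eq)

lemma omit_1_Chain: "omit Q 1 (Chain T (f # fs)) = Chain (Dom Q f) fs"
  by simp

lemma degen_gen_Chain:
  "\<lbrakk>i < r; r = Suc (length fs)\<rbrakk> \<Longrightarrow>
    degen_gen Q r i (Chain T fs) = Chain T (insert_idn Q T (r - i - 1) fs)"
  by (auto simp: insert_idn_eq chain_obj_def numeral_2_eq_2)

declare omit.simps(2) [simp del] degen_gen.simps(2) [simp del]

lemma degen_gen_top: "degen_gen Q r r (Chain T fs) = Chain (lterm Q T) (tau Q T # fs)"
  by (simp add: degen_gen.simps)

lemma omit_degree_1: "omit Q k (Chain T []) = Comp (component Q T)"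
  by (simp add: omit.simps)

context category
begin

lemma in_hom: "f \<in> Ar C \<Longrightarrow> f \<in> hom C (Dom C f) (Cod C f)"
  by (simp add: hom_def)

lemma Cmp_props:
  assumes "f \<in> Ar C" "g \<in> Ar C" "Cod C g = Dom C f"
  shows "Cmp C f g \<in> Ar C" "Dom C (Cmp C f g) = Dom C g" "Cod C (Cmp C f g) = Cod C f"
  using cmp_hom[of g "Dom C g" "Dom C f" f "Cod C f"] assms by (simp_all add: hom_def)

lemma Idn_props:
  assumes "x \<in> Ob C"
  shows "Idn C x \<in> Ar C" "Dom C (Idn C x) = x" "Cod C (Idn C x) = x"
  using idn_hom[OF assms] by (simp_all add: hom_def)

lemma Cmp_Idn [simp]: "f \<in> Ar C \<Longrightarrow> Cmp C f (Idn C (Dom C f)) = f"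
  and Idn_Cmp [simp]: "f \<in> Ar C \<Longrightarrow> Cmp C (Idn C (Cod C f)) f = f"
  using cmp_idn idn_cmp by (auto simp: hom_def)

lemma Cmp_assoc:
  "\<lbrakk>f \<in> Ar C; g \<in> Ar C; h \<in> Ar C; Cod C f = Dom C g; Cod C g = Dom C h\<rbrakk> \<Longrightarrow>
    Cmp C (Cmp C h g) f = Cmp C h (Cmp C g f)"
  using cmp_assoc[of f "Dom C f" "Dom C g" g "Dom C h" h "Cod C h"] by (simp add: hom_def)

lemma is_chain_Ob: "is_chain C T fs \<Longrightarrow> T \<in> Ob C"
  using cod_in by (cases fs) auto

lemma is_chain_omit_at: "is_chain C T fs \<Longrightarrow> is_chain C T (omit_at C n fs)"
proof (induction n arbitrary: T fs)
  case 0
  consider "fs = []" | f where "fs = [f]" | f g gs where "fs = f # g # gs"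
    by (metis neq_Nil_conv)
  then show ?case
    using 0 by cases (auto simp: Cmp_props cod_in)
next
  case (Suc n)
  then show ?case by (cases fs) auto
qed

lemma is_chain_insert_idn:
  "is_chain C T fs \<Longrightarrow> n \<le> length fs \<Longrightarrow> is_chain C T (insert_idn C T n fs)"
proof (induction n arbitrary: T fs)
  case 0
  then show ?case using is_chain_Ob[OF 0(1)] by (simp add: Idn_props)
next
  case (Suc n)
  then show ?case by (cases fs) auto
qed

lemma omit_at_omit_at:
  "\<lbrakk>is_chain C T fs; b \<le> a; Suc a < length fs\<rbrakk> \<Longrightarrow>
    omit_at C a (omit_at C b fs) = omit_at C b (omit_at C (Suc a) fs)"
proof (induction b arbitrary: a T fs)
  case 0
  from 0(3) have "2 \<le> length fs" by simp
  then obtain f g gs where fs: "fs = f # g # gs" by (rule two_le_length_E)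
  show ?case
  proof (cases a)
    case 0
    with fs 0 show ?thesis
      using \<open>is_chain C T fs\<close> by (cases gs) (auto simp: Cmp_assoc)
  qed (simp add: fs)
next
  case (Suc b)
  then show ?case by (cases fs; cases a) auto
qed

lemma insert_idn_insert_idn:
  "\<lbrakk>is_chain C T fs; b \<le> a; a \<le> length fs\<rbrakk> \<Longrightarrow>
    insert_idn C T (Suc a) (insert_idn C T b fs) = insert_idn C T b (insert_idn C T a fs)"
proof (induction b arbitrary: a T fs)
  case 0
  then show ?case using is_chain_Ob[OF 0(1)] by (simp add: Idn_props)
next
  case (Suc b)
  then show ?case by (cases fs; cases a) auto
qed

lemma omit_at_insert_idn_below:
  "\<lbrakk>b \<le> m; m < length fs\<rbrakk> \<Longrightarrow>
    omit_at C (Suc m) (insert_idn C T b fs) = insert_idn C T b (omit_at C m fs)"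
proof (induction b arbitrary: m T fs)
  case (Suc b)
  then show ?case by (cases fs; cases m) auto
qed simp

lemma omit_at_insert_idn_same:
  "\<lbrakk>is_chain C T fs; b \<le> length fs\<rbrakk> \<Longrightarrow> omit_at C b (insert_idn C T b fs) = fs"
proof (induction b arbitrary: T fs)
  case 0
  then show ?case by (cases fs) auto
next
  case (Suc b)
  then show ?case by (cases fs) auto
qed

lemma omit_at_insert_idn_Suc:
  "\<lbrakk>is_chain C T fs; b < length fs\<rbrakk> \<Longrightarrow> omit_at C b (insert_idn C T (Suc b) fs) = fs"
proof (induction b arbitrary: T fs)
  case 0
  then show ?case by (cases fs) auto
next
  case (Suc b)
  then show ?case by (cases fs) auto
qed

lemma omit_at_insert_idn_above:
  "\<lbrakk>is_chain C T fs; n + 2 \<le> b; b \<le> length fs\<rbrakk> \<Longrightarrow>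
    omit_at C n (insert_idn C T b fs) = insert_idn C T (b - 1) (omit_at C n fs)"
proof (induction n arbitrary: b T fs)
  case 0
  from 0 have "2 \<le> length fs" by simp
  then obtain f g gs where "fs = f # g # gs" by (rule two_le_length_E)
  moreover from 0 obtain c where "b = Suc (Suc c)"
    by (metis add_2_eq_Suc le_Suc_ex plus_nat.add_0)
  ultimately show ?case using 0 by (simp add: Cmp_props)
next
  case (Suc n)
  then obtain c f gs where b: "b = Suc c" and fs: "fs = f # gs"
    by (cases b; cases fs) auto
  then have "omit_at C n (insert_idn C (Dom C f) c gs) =
      insert_idn C (Dom C f) (c - 1) (omit_at C n gs)"
    using Suc by (intro Suc.IH) auto
  moreover obtain e where "c = Suc e" using Suc.prems b by (cases c) auto
  ultimately show ?case using b fs by simp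
qed

section \<open>Connected components\<close>

lemma equiv_conn_rel: "equiv (Ob C) (conn_rel C)"
proof (rule equivI)
  let ?E = "{(Dom C f, Cod C f) | f. f \<in> Ar C}"
  have "sym ((?E \<union> ?E\<inverse>)\<^sup>*)"
    by (rule sym_rtrancl) (auto simp: sym_def)
  then show "sym (conn_rel C)"
    by (auto simp: conn_rel_def Let_def sym_def)
  show "refl_on (Ob C) (conn_rel C)"
    by (auto simp: conn_rel_def Let_def refl_on_def)
  show "trans (conn_rel C)"
    unfolding conn_rel_def Let_def trans_def by (blast intro: rtrancl_trans)
  show "conn_rel C \<subseteq> Ob C \<times> Ob C"
    by (auto simp: conn_rel_def Let_def)
qed

lemma component_Dom_Cod:
  assumes "f \<in> Ar C"
  shows "component C (Dom C f) = component C (Cod C f)"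
proof -
  have "(Dom C f, Cod C f) \<in> conn_rel C"
    using assms dom_in cod_in by (auto simp: conn_rel_def Let_def intro!: r_into_rtrancl)
  then show ?thesis
    unfolding component_def by (rule equiv_class_eq[OF equiv_conn_rel])
qed

lemma component_in_pi0: "x \<in> Ob C \<Longrightarrow> component C x \<in> pi0 C"
  unfolding pi0_def component_def by (rule quotientI)

lemma in_component_self: "x \<in> Ob C \<Longrightarrow> x \<in> component C x"
  unfolding component_def by (rule equiv_class_self[OF equiv_conn_rel])

lemma component_eq_of_mem: "\<lbrakk>K \<in> pi0 C; x \<in> K\<rbrakk> \<Longrightarrow> component C x = K"
  unfolding pi0_def component_def
  by (metis Image_singleton_iff equiv_class_eq equiv_conn_rel quotientE)

end

section \<open>Terminal maps and fibres\<close>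

context operadic_category
begin

abbreviation crdn :: "'o \<Rightarrow> nat" where "crdn \<equiv> FO (crd Q)"

lemma lterm_props:
  assumes "R \<in> Ob Q"
  shows "lterm Q R \<in> Ob Q" "component Q (lterm Q R) = component Q R"
    "local_terminal Q (lterm Q R)"
proof -
  have "lterm Q R \<in> component Q R \<and> local_terminal Q (lterm Q R)"
    unfolding lterm_def by (rule chosen_terminal[OF component_in_pi0[OF assms]])
  then show "lterm Q R \<in> Ob Q" "component Q (lterm Q R) = component Q R"
    "local_terminal Q (lterm Q R)"
    using component_eq_of_mem[OF component_in_pi0[OF assms]] by (auto simp: local_terminal_def)
qed

lemma hom_lterm_unique:
  assumes "R \<in> Ob Q"
  shows "\<exists>!f. f \<in> hom Q R (lterm Q R)"
  using lterm_props[OF assms] in_component_self[OF assms] by (simp add: local_terminal_def)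

lemma tau_props:
  assumes "R \<in> Ob Q"
  shows "tau Q R \<in> Ar Q" "Dom Q (tau Q R) = R" "Cod Q (tau Q R) = lterm Q R"
  using theI'[OF hom_lterm_unique[OF assms]] unfolding tau_def by (simp_all add: hom_def)

lemma tau_eqI:
  assumes "f \<in> Ar Q" "Cod Q f = lterm Q (Dom Q f)"
  shows "tau Q (Dom Q f) = f"
  using hom_lterm_unique[OF dom_in[OF assms(1)]] tau_props[OF dom_in[OF assms(1)]] assms
  by (auto simp: hom_def)

lemma lterm_cong: "component Q S = component Q R \<Longrightarrow> lterm Q S = lterm Q R"
  by (simp add: lterm_def)

lemma lterm_Dom: "f \<in> Ar Q \<Longrightarrow> lterm Q (Dom Q f) = lterm Q (Cod Q f)"
  by (simp add: lterm_def component_Dom_Cod)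

lemma tau_Cmp:
  assumes "f \<in> Ar Q"
  shows "Cmp Q (tau Q (Cod Q f)) f = tau Q (Dom Q f)"
  using tau_eqI[of "Cmp Q (tau Q (Cod Q f)) f"] tau_props[OF cod_in[OF assms]] assms
  by (simp add: Cmp_props lterm_Dom)

lemma lterm_idem: "R \<in> Ob Q \<Longrightarrow> lterm Q (lterm Q R) = lterm Q R"
  by (rule lterm_cong) (rule lterm_props)

lemma tau_eq_Idn:
  assumes "R \<in> Ob Q" "lterm Q R = R"
  shows "tau Q R = Idn Q R"
  using tau_eqI[of "Idn Q R"] assms by (simp add: Idn_props)

lemma chosen_props:
  assumes "K \<in> pi0 Q"
  shows "chosen Q K \<in> Ob Q" "component Q (chosen Q K) = K" "lterm Q (chosen Q K) = chosen Q K"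
  using chosen_terminal[OF assms] component_eq_of_mem[OF assms]
  by (auto simp: local_terminal_def lterm_def)

lemma crd_lterm: "R \<in> Ob Q \<Longrightarrow> crdn (lterm Q R) = 1"
  using A1 lterm_props(3) by blast

lemma fib_Ob:
  assumes "h \<in> Ar Q" "i < crdn (Cod Q h)"
  shows "fib Q h i \<in> Ob Q"
  using cat_functor.ob_map[OF fibre_functor[OF cod_in[OF assms(1)] assms(2)], of h] assms
  by (simp add: fib_def slice_def)

lemma fibmap_props:
  assumes "f \<in> Ar Q" "h \<in> Ar Q" "Cod Q f = Dom Q h" "i < crdn (Cod Q h)"
  shows "fibmap Q f h i \<in> Ar Q" "Dom Q (fibmap Q f h i) = fib Q (Cmp Q h f) i"
    "Cod Q (fibmap Q f h i) = fib Q h i"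
  using cat_functor.ar_map[OF fibre_functor[OF cod_in[OF assms(2)] assms(4)],
      of "(f, h)" "Cmp Q h f" h] assms
  by (simp_all add: fib_def fibmap_def slice_def hom_def Cmp_props)

lemma fibmap_Idn:
  assumes "h \<in> Ar Q" "i < crdn (Cod Q h)"
  shows "fibmap Q (Idn Q (Dom Q h)) h i = Idn Q (fib Q h i)"
  using cat_functor.map_idn[OF fibre_functor[OF cod_in[OF assms(1)] assms(2)], of h] assms
  by (simp add: fib_def fibmap_def slice_def)

lemma fibmap_Cmp:
  assumes "f \<in> Ar Q" "g \<in> Ar Q" "h \<in> Ar Q" "Cod Q g = Dom Q f" "Cod Q f = Dom Q h"
    and "i < crdn (Cod Q h)"
  shows "fibmap Q (Cmp Q f g) h i = Cmp Q (fibmap Q f h i) (fibmap Q g (Cmp Q h f) i)"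
  using cat_functor.map_cmp[OF fibre_functor[OF cod_in[OF assms(3)] assms(6)],
      of "(g, Cmp Q h f)" "Cmp Q (Cmp Q h f) g" "Cmp Q h f" "(f, h)" h] assms
  by (simp add: fib_def fibmap_def slice_def hom_def Cmp_props)

lemma lterm_fib_Idn:
  assumes "R \<in> Ob Q" "i < crdn R"
  shows "lterm Q (fib Q (Idn Q R) i) = fib Q (Idn Q R) i"
  using A2[OF assms] chosen_props(3) by auto

text \<open>The fibres of an identity are chosen local terminals, so the fibre map of \<open>f\<close> over the
  identity is a map into a chosen local terminal.  It is the arrow that the top degeneracy appends to
  a chain of fibres.\<close>

lemma tau_fib:
  assumes "f \<in> Ar Q" "i < crdn (Cod Q f)"
  shows "tau Q (fib Q f i) = fibmap Q f (Idn Q (Cod Q f)) i"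
    and "lterm Q (fib Q f i) = fib Q (Idn Q (Cod Q f)) i"
proof -
  let ?m = "fibmap Q f (Idn Q (Cod Q f)) i"
  have R: "Cod Q f \<in> Ob Q" using assms cod_in by blast
  have m: "?m \<in> Ar Q" "Dom Q ?m = fib Q f i" "Cod Q ?m = fib Q (Idn Q (Cod Q f)) i"
    using fibmap_props[OF assms(1) Idn_props(1)[OF R]] assms Idn_props[OF R] by simp_all
  show l: "lterm Q (fib Q f i) = fib Q (Idn Q (Cod Q f)) i"
    using lterm_Dom[OF m(1)] lterm_fib_Idn[OF R assms(2)] m by simp
  show "tau Q (fib Q f i) = ?m"
    using tau_eqI[OF m(1)] m l by simp
qed

section \<open>Fibres of chains\<close>

lemma length_fibre_arrows [simp]: "length (fibre_arrows Q i h fs) = length fs"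
  by (induction fs arbitrary: h) auto

lemma is_chain_fibre_arrows:
  "\<lbrakk>h \<in> Ar Q; i < crdn (Cod Q h); is_chain Q (Dom Q h) fs\<rbrakk> \<Longrightarrow>
    is_chain Q (fib Q h i) (fibre_arrows Q i h fs)"
proof (induction fs arbitrary: h)
  case (Cons f fs)
  then show ?case using Cons.IH[of "Cmp Q h f"] by (simp add: fibmap_props Cmp_props)
qed (simp add: fib_Ob)

text \<open>Functoriality of the fibre functor: composition is preserved.\<close>

lemma fibre_arrows_omit_at:
  "\<lbrakk>h \<in> Ar Q; i < crdn (Cod Q h); is_chain Q (Dom Q h) fs\<rbrakk> \<Longrightarrow>
    fibre_arrows Q i h (omit_at Q n fs) = omit_at Q n (fibre_arrows Q i h fs)"
proof (induction n arbitrary: h fs)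
  case 0
  consider "fs = []" | f where "fs = [f]" | f g gs where "fs = f # g # gs"
    by (metis neq_Nil_conv)
  then show ?case
    using 0 by cases (simp_all add: fibmap_Cmp Cmp_assoc)
next
  case (Suc n)
  then show ?case by (cases fs) (simp_all add: Cmp_props)
qed

text \<open>Functoriality of the fibre functor: identities are preserved.\<close>

lemma fibre_arrows_insert_idn:
  "\<lbrakk>h \<in> Ar Q; i < crdn (Cod Q h); is_chain Q (Dom Q h) fs; n \<le> length fs\<rbrakk> \<Longrightarrow>
    fibre_arrows Q i h (insert_idn Q (Dom Q h) n fs) =
      insert_idn Q (fib Q h i) n (fibre_arrows Q i h fs)"
proof (induction n arbitrary: h fs)
  case 0
  then show ?case by (simp add: fibmap_Idn)
next
  case (Suc n)
  then obtain f gs where fs: "fs = f # gs" by (cases fs) auto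
  then show ?case using Suc.IH[of "Cmp Q h f" gs] Suc.prems by (simp add: Cmp_props fibmap_props)
qed

text \<open>Taking fibres over the terminal map changes nothing, and a composite with a terminal map is
  a terminal map, so the induction can proceed along the chain.\<close>

lemma fibre_arrows_tau:
  "is_chain Q S fs \<Longrightarrow> fibre_arrows Q 0 (tau Q S) fs = fs"
proof (induction fs arbitrary: S)
  case (Cons f fs)
  then show ?case using A4_ar[of f "Dom Q f" S] tau_Cmp[of f] by (auto simp: hom_def)
qed simp

text \<open>The axiom on fibres of fibre maps, iterated along a chain: the fibres over \<open>b\<close> of the
  chain of fibres over \<open>i\<close> are the fibres over \<open>\<epsilon> b\<close> of the original chain.\<close>

lemma fibre_arrows_fibre_arrows:
  "\<lbrakk>f \<in> Ar Q; h \<in> Ar Q; Cod Q h = Dom Q f; i < crdn (Cod Q f);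
    b < fin_fibre (FA (crd Q) f) i; is_chain Q (Dom Q h) fs\<rbrakk> \<Longrightarrow>
    fibre_arrows Q b (fibmap Q h f i) (fibre_arrows Q i (Cmp Q f h) fs) =
      fibre_arrows Q (eps (FA (crd Q) f) i b) h fs"
proof (induction fs arbitrary: h)
  case (Cons k ks)
  have "fibmap Q (fibmap Q k (Cmp Q f h) i) (fibmap Q h f i) b =
      fibmap Q k h (eps (FA (crd Q) f) i b)"
    using Cons.prems by (intro A5_ar[of k "Dom Q k" "Dom Q h"]) (auto simp: hom_def)
  moreover have "Cmp Q (fibmap Q h f i) (fibmap Q k (Cmp Q f h) i) = fibmap Q (Cmp Q h k) f i"
    using Cons.prems by (simp add: fibmap_Cmp)
  ultimately show ?case
    using Cons.IH[of "Cmp Q h k"] Cons.prems by (simp add: Cmp_props Cmp_assoc)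
qed simp

section \<open>Simplicial identities on generators\<close>

lemma gens_SucE:
  assumes "p \<in> nerve_gen Q (Suc m)"
  obtains T fs where "p = Chain T fs" "is_chain Q T fs" "length fs = m"
  using assms by auto

lemma gens_SucI: "\<lbrakk>is_chain Q T fs; length fs = m\<rbrakk> \<Longrightarrow> Chain T fs \<in> nerve_gen Q (Suc m)"
  by auto

text \<open>Omission of the last object \<open>T\<^sub>1\<close> drops an arrow at the front of the list; all other omissions
  are instances of \<open>omit_at\<close>, with index shifted by two.\<close>

lemma index_cases:
  assumes "1 \<le> (k::nat)" "k \<le> Suc m"
  obtains "k = 1" | n where "k = n + 2" "n < m"
proof (cases "k = 1")
  case False
  then have "k = (k - 2) + 2" "k - 2 < m" using assms by simp_all
  then show ?thesis using that(2) by blast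
qed (use that in simp)

lemma omit_in_gens:
  assumes p: "p \<in> nerve_gen Q (Suc r)" and k: "1 \<le> k" "k \<le> Suc r"
  shows "omit Q k p \<in> nerve_gen Q r"
proof -
  obtain T fs where T: "p = Chain T fs" "is_chain Q T fs" "length fs = r"
    using p by (rule gens_SucE)
  show ?thesis
  proof (cases r)
    case 0
    then show ?thesis using T by (simp add: omit_degree_1 component_in_pi0)
  next
    case (Suc m)
    from k show ?thesis
    proof (cases rule: index_cases)
      case 1
      then show ?thesis using T Suc by (cases fs) (auto simp: omit_1_Chain simp del: One_nat_def)
    next
      case (2 n)
      then show ?thesis
        using T Suc is_chain_omit_at[OF T(2)]
        by (simp add: omit_Chain length_omit_at del: add_2_eq_Suc')
    qed
  qed
qed

lemma top_face_in_gens: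
  assumes "p \<in> nerve_gen Q (Suc r)"
  shows "top_face Q p \<in> lists (nerve_gen Q r)"
proof -
  obtain T fs where T: "p = Chain T fs" "is_chain Q T fs" "length fs = r"
    using assms by (rule gens_SucE)
  show ?thesis
  proof (cases fs)
    case Nil
    then show ?thesis
      using T by (auto simp: Idn_props intro!: imageI component_in_pi0 fib_Ob)
  next
    case (Cons f gs)
    then show ?thesis
      using T by (auto intro!: is_chain_fibre_arrows)
  qed
qed

lemma degen_gen_in_gens:
  assumes "p \<in> nerve_gen Q r" "i \<le> r"
  shows "degen_gen Q r i p \<in> nerve_gen Q (Suc r)"
proof (cases r)
  case 0
  then show ?thesis using assms by (auto simp: chosen_props)
next
  case (Suc m)
  then obtain T fs where T: "p = Chain T fs" "is_chain Q T fs" "length fs = m"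
    using assms(1) gens_SucE by blast
  show ?thesis
  proof (cases "i < r")
    case True
    then show ?thesis
      using T Suc is_chain_insert_idn[OF T(2)]
      by (simp add: degen_gen_Chain length_insert_idn)
  next
    case False
    then show ?thesis
      using T Suc assms(2) tau_props[OF is_chain_Ob[OF T(2)]] by (auto simp: degen_gen_top)
  qed
qed

text \<open>The identities \<open>d\<^sub>i d\<^sub>j = d\<^sub>j\<^sub>-\<^sub>1 d\<^sub>i\<close> below the top face, written in terms of the omitted objects;
  as \<open>d\<^sub>i\<close> omits \<open>T\<^sub>r\<^sub>-\<^sub>i\<close>, the order of the indices is reversed.  In degree two the result is a component,
  and the two ends of an arrow lie in the same component.\<close>

lemma omit_omit:
  assumes p: "p \<in> nerve_gen Q (r + 2)" and ab: "1 \<le> b" "b \<le> a" "a \<le> Suc r"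
  shows "omit Q a (omit Q b p) = omit Q b (omit Q (Suc a) p)"
proof -
  obtain T fs where T: "p = Chain T fs" "is_chain Q T fs" "length fs = Suc r"
    using p gens_SucE by (metis add_2_eq_Suc')
  obtain f gs where fs: "fs = f # gs" "length gs = r" using T by (cases fs) auto
  consider (one) "b = 1" "a = 1" | (first) n where "b = 1" "a = n + 2" "n < r"
    | (both) m n where "b = m + 2" "a = n + 2" "m \<le> n" "n < r"
  proof (cases "a = 1"; cases "b = 1")
    assume "a \<noteq> 1" "b = 1"
    then show ?thesis using ab that(2)[of "a - 2"] by simp
  next
    assume "a \<noteq> 1" "b \<noteq> 1"
    then show ?thesis using ab that(3)[of "b - 2" "a - 2"] by simp
  qed (use ab that(1) in simp_all)
  then show ?thesis
  proof cases
    case one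
    show ?thesis
    proof (cases gs)
      case Nil
      then show ?thesis
        using one T fs omit_Chain[of 0 fs Q T] component_Dom_Cod[of f]
        by (simp add: omit_1_Chain omit_degree_1 numeral_2_eq_2 del: One_nat_def)
    next
      case (Cons g hs)
      then show ?thesis
        using one T fs omit_Chain[of 0 fs Q T]
        by (simp add: omit_1_Chain Cmp_props numeral_2_eq_2 del: One_nat_def)
    qed
  next
    case first
    then show ?thesis
      using T fs omit_Chain[of n gs Q "Dom Q f"] omit_Chain[of "Suc n" fs Q T]
      by (simp add: omit_1_Chain del: One_nat_def)
  next
    case both
    have "omit Q (Suc a) p = Chain T (omit_at Q (Suc n) fs)"
      using omit_Chain[of "Suc n" fs Q T] both T by simp
    moreover have "omit Q b p = Chain T (omit_at Q m fs)"
      using omit_Chain[of m fs Q T] both T by simp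
    moreover have "omit_at Q n (omit_at Q m fs) = omit_at Q m (omit_at Q (Suc n) fs)"
      using both T by (intro omit_at_omit_at) auto
    ultimately show ?thesis
      using omit_Chain[of n "omit_at Q m fs" Q T] omit_Chain[of m "omit_at Q (Suc n) fs" Q T] both T
      by (simp add: length_omit_at)
  qed
qed

text \<open>The top face commutes with the omission of an object other than \<open>T\<^sub>1\<close>.  For a chain of length
  two, omitting \<open>T\<^sub>2\<close> leaves the fibres of the identity, which lie in the same components as
  the fibres of \<open>f\<close>, by \<open>tau_fib\<close>.\<close>

lemma top_face_omit:
  assumes p: "p \<in> nerve_gen Q (r + 2)" and k: "1 \<le> k" "k \<le> Suc r"
  shows "top_face Q (omit Q (Suc k) p) = map (omit Q k) (top_face Q p)"
proof -
  obtain T fs where T: "p = Chain T fs" "is_chain Q T fs" "length fs = Suc r"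
    using p gens_SucE by (metis add_2_eq_Suc')
  obtain f gs where fs: "fs = f # gs" "length gs = r" using T by (cases fs) auto
  have f: "f \<in> Ar Q" "Cod Q f = T" "is_chain Q (Dom Q f) gs" using T fs by auto
  from k show ?thesis
  proof (cases rule: index_cases)
    case 1
    then have om: "omit Q (Suc k) p = Chain T (omit_at Q 0 fs)"
      using omit_Chain[of 0 fs Q T] T by (simp add: numeral_2_eq_2)
    show ?thesis
    proof (cases gs)
      case Nil
      have "component Q (fib Q (Idn Q T) i) = component Q (fib Q f i)" if "i < crdn T" for i
        using that f fib_Ob[of f i] tau_fib(2)[of f i] lterm_props(2)[of "fib Q f i"] by simp
      then show ?thesis
        using T fs om Nil 1 by (simp add: omit_degree_1)
    next
      case (Cons g hs)
      have "Dom Q (fibmap Q g f i) = fib Q (Cmp Q f g) i" if "i < crdn T" for i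
        using that f Cons by (intro fibmap_props) auto
      then show ?thesis
        using T fs om Cons 1 by (simp add: omit_1_Chain del: One_nat_def)
    qed
  next
    case (2 n)
    have "omit Q (Suc k) p = Chain T (f # omit_at Q n gs)"
      using omit_Chain[of "Suc n" fs Q T] T fs 2 by simp
    moreover have "omit Q k (Chain (fib Q f i) (fibre_arrows Q i f gs)) =
        Chain (fib Q f i) (fibre_arrows Q i f (omit_at Q n gs))" if "i < crdn T" for i
      using omit_Chain[of n "fibre_arrows Q i f gs" Q] that f fs 2
      by (simp add: fibre_arrows_omit_at)
    ultimately show ?thesis
      using T fs by simp
  qed
qed

lemma degen_gen_degen_gen:
  assumes p: "p \<in> nerve_gen Q r" and ij: "i \<le> j" "j \<le> r"
  shows "degen_gen Q (Suc r) i (degen_gen Q r j p) = degen_gen Q (Suc r) (Suc j) (degen_gen Q r i p)"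
proof (cases r)
  case 0
  then obtain K where K: "p = Comp K" "K \<in> pi0 Q" using p by auto
  have "i = 0" "j = 0" "Suc r = Suc (length ([] :: 'a list))" using 0 ij by auto
  moreover have "degen_gen Q (Suc 0) 0 (Chain (chosen Q K) []) = Chain (chosen Q K) [Idn Q (chosen Q K)]"
    by (simp add: degen_gen_Chain)
  ultimately show ?thesis
    using 0 K chosen_props[OF K(2)] tau_eq_Idn[of "chosen Q K"]
    by (simp only: degen_gen_top degen_gen.simps(1))
next
  case (Suc m)
  then obtain T fs where T: "p = Chain T fs" "is_chain Q T fs" "length fs = m"
    using p gens_SucE by blast
  have TO: "T \<in> Ob Q" by (rule is_chain_Ob[OF T(2)])
  consider (inner) "j < r" | (outer) "j = r" "i < r" | (top) "j = r" "i = r" using ij by linarith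
  then show ?thesis
  proof cases
    case inner
    then show ?thesis
      using T Suc ij insert_idn_insert_idn[OF T(2), of "r - j - 1" "r - i - 1"]
      by (simp add: degen_gen_Chain length_insert_idn Suc_diff_le)
  next
    case outer
    then show ?thesis
      using T Suc tau_props[OF TO] degen_gen_top[of Q "Suc r"]
      by (simp add: degen_gen_Chain degen_gen_top length_insert_idn Suc_diff_le)
  next
    case top
    then show ?thesis
      using T Suc TO degen_gen_top[of Q "Suc r"] lterm_idem[OF TO] tau_eq_Idn[OF lterm_props(1)[OF TO]]
      by (simp add: degen_gen_Chain degen_gen_top)
  qed
qed

lemma omit_degen_gen_less:
  assumes p: "p \<in> nerve_gen Q r" and ij: "i < j" "j \<le> r"
  shows "omit Q (Suc r - i) (degen_gen Q r j p) = degen_gen Q (r - 1) (j - 1) (omit Q (r - i) p)"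
proof -
  obtain m where r: "r = Suc m" using ij by (cases r) auto
  then obtain T fs where T: "p = Chain T fs" "is_chain Q T fs" "length fs = m"
    using p gens_SucE by blast
  have TO: "T \<in> Ob Q" by (rule is_chain_Ob[OF T(2)])
  show ?thesis
  proof (cases "j < r")
    case True
    define n where "n = r - i - 2"
    have n: "Suc r - i = Suc n + 2" "r - i = n + 2" "n < length fs" "r - j - 1 \<le> n"
      using ij True r T by (simp_all add: n_def)
    show ?thesis
      unfolding n(1,2)
      using T r ij True n(3,4) omit_Chain[of "Suc n" "insert_idn Q T (r - j - 1) fs" Q T]
        omit_Chain[of n fs Q T]
      by (simp add: degen_gen_Chain length_insert_idn length_omit_at omit_at_insert_idn_below)
  next
    case False
    then have j: "j = r" using ij by simp
    show ?thesis
    proof (cases fs)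
      case Nil
      then show ?thesis
        using T r ij j omit_Chain[of 0 "[tau Q T]" Q "lterm Q T"]
        by (simp add: degen_gen_top omit_degree_1 lterm_def[symmetric] numeral_2_eq_2)
    next
      case (Cons f gs)
      show ?thesis
      proof (cases "Suc i = r")
        case True
        then have "Suc r - i = 0 + 2" "r - i = 1" by auto
        then show ?thesis
          using T r j Cons tau_Cmp[of f] lterm_Dom[of f] omit_Chain[of 0 "tau Q T # fs" Q "lterm Q T"]
          by (auto simp: degen_gen_top omit_1_Chain simp del: One_nat_def)
      next
        case False
        define n where "n = r - i - 2"
        have n: "Suc r - i = Suc n + 2" "r - i = n + 2" "n < length fs"
          using ij j False r T by (simp_all add: n_def)
        show ?thesis
          unfolding n(1,2)
          using T r j n(3) omit_Chain[of "Suc n" "tau Q T # fs" Q "lterm Q T"] omit_Chain[of n fs Q T]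
          by (simp add: degen_gen_top)
      qed
    qed
  qed
qed

lemma omit_degen_gen_id:
  assumes p: "p \<in> nerve_gen Q r" and ij: "j \<le> r" "i = j \<or> i = Suc j" "i \<le> r"
  shows "omit Q (Suc r - i) (degen_gen Q r j p) = p"
proof (cases r)
  case 0
  then show ?thesis using p ij chosen_props(2) by (auto simp: omit_degree_1)
next
  case (Suc m)
  then obtain T fs where T: "p = Chain T fs" "is_chain Q T fs" "length fs = m"
    using p gens_SucE by blast
  have TO: "T \<in> Ob Q" by (rule is_chain_Ob[OF T(2)])
  show ?thesis
  proof (cases "j < r")
    case False
    then have "i = r" "j = r" using ij by auto
    then show ?thesis
      using T tau_props[OF TO] by (simp add: degen_gen_top omit_1_Chain[simplified])
  next
    case True
    define b where "b = r - j - 1"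
    have b: "b \<le> length fs" and deg: "degen_gen Q r j p = Chain T (insert_idn Q T b fs)"
      using T Suc True by (simp_all add: b_def degen_gen_Chain)
    show ?thesis
    proof (cases "i = j")
      case True
      then have k: "Suc r - i = b + 2" using \<open>j < r\<close> by (simp add: b_def)
      show ?thesis
        unfolding k using T b deg omit_Chain[of b "insert_idn Q T b fs" Q T]
        by (simp add: length_insert_idn omit_at_insert_idn_same[OF T(2)])
    next
      case False
      then have i: "i = Suc j" using ij by simp
      show ?thesis
      proof (cases b)
        case 0
        then have "Suc r - i = 1" using i \<open>j < r\<close> by (simp add: b_def)
        then show ?thesis
          using T 0 deg by (simp add: omit_1_Chain Idn_props[OF TO] del: One_nat_def)
      next
        case (Suc c)
        then have k: "Suc r - i = c + 2" using i \<open>j < r\<close> by (simp add: b_def)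
        show ?thesis
          unfolding k using T b deg Suc omit_Chain[of c "insert_idn Q T b fs" Q T]
          by (simp add: length_insert_idn omit_at_insert_idn_Suc[OF T(2)])
      qed
    qed
  qed
qed

lemma omit_degen_gen_greater:
  assumes p: "p \<in> nerve_gen Q r" and ij: "Suc j < i" "i \<le> r"
  shows "omit Q (Suc r - i) (degen_gen Q r j p) = degen_gen Q (r - 1) j (omit Q (Suc r - i) p)"
proof -
  obtain m where r: "r = Suc m" using ij by (cases r) auto
  then obtain T fs where T: "p = Chain T fs" "is_chain Q T fs" "length fs = m"
    using p gens_SucE by blast
  define b where "b = r - j - 1"
  have b: "b \<le> length fs" and deg: "degen_gen Q r j p = Chain T (insert_idn Q T b fs)"
    using T r ij by (simp_all add: b_def degen_gen_Chain)
  have k: "1 \<le> Suc r - i" "Suc r - i \<le> Suc m" "Suc r - i \<le> b" using ij r by (simp_all add: b_def)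
  have b': "r - 1 - j - 1 = b - 1" by (simp add: b_def)
  obtain f gs where fs: "fs = f # gs" using k b by (cases fs) auto
  from k(1,2) show ?thesis
  proof (cases rule: index_cases)
    case 1
    obtain c where "b = Suc c" using k(3) 1 by (cases b) auto
    then show ?thesis
      unfolding 1 using T r fs ij deg b b'
      by (simp add: omit_1_Chain degen_gen_Chain del: One_nat_def)
  next
    case (2 n)
    then show ?thesis
      using T r ij deg b b' k(3) omit_Chain[of n fs Q T] omit_Chain[of n "insert_idn Q T b fs" Q T]
        omit_at_insert_idn_above[OF T(2), of n b] degen_gen_Chain[of j "r - 1" "omit_at Q n fs" Q T]
      by (simp add: length_insert_idn length_omit_at)
  qed
qed

lemma top_face_degen_gen_top:
  assumes p: "p \<in> nerve_gen Q r"
  shows "top_face Q (degen_gen Q r r p) = [p]"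
proof (cases r)
  case 0
  then obtain K where K: "p = Comp K" "K \<in> pi0 Q" using p by auto
  then show ?thesis
    using 0 chosen_props[OF K(2)] crd_lterm[OF chosen_props(1)[OF K(2)]]
      A4_ob[OF chosen_props(1)[OF K(2)]]
    by (simp add: tau_eq_Idn)
next
  case (Suc m)
  then obtain T fs where T: "p = Chain T fs" "is_chain Q T fs" "length fs = m"
    using p gens_SucE by blast
  have TO: "T \<in> Ob Q" by (rule is_chain_Ob[OF T(2)])
  show ?thesis
    using T by (simp add: degen_gen_top crd_lterm[OF TO] A4_ob[OF TO] fibre_arrows_tau)
qed

text \<open>Away from the last object this is functoriality of fibres.  If the identity is inserted at
  \<open>T\<^sub>1\<close>, then the fibre chains end in the fibres of an identity, and their last arrow is the terminal
  map by \<open>tau_fib\<close>, as for the top degeneracy.\<close>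

lemma top_face_degen_gen:
  assumes p: "p \<in> nerve_gen Q r" and j: "j < r"
  shows "top_face Q (degen_gen Q r j p) = map (degen_gen Q (r - 1) j) (top_face Q p)"
proof -
  obtain m where r: "r = Suc m" using j by (cases r) auto
  then obtain T fs where T: "p = Chain T fs" "is_chain Q T fs" "length fs = m"
    using p gens_SucE by blast
  have TO: "T \<in> Ob Q" by (rule is_chain_Ob[OF T(2)])
  define b where "b = r - j - 1"
  have b: "b \<le> length fs" and deg: "degen_gen Q r j p = Chain T (insert_idn Q T b fs)"
    using T r j by (simp_all add: b_def degen_gen_Chain)
  show ?thesis
  proof (cases fs)
    case Nil
    have "chosen Q (component Q (fib Q (Idn Q T) i)) = fib Q (Idn Q T) i" if "i < crdn T" for i
      using lterm_fib_Idn[OF TO that] by (simp add: lterm_def)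
    then show ?thesis using Nil T b deg r by simp
  next
    case (Cons f gs)
    then have f: "f \<in> Ar Q" "Cod Q f = T" "is_chain Q (Dom Q f) gs" using T by auto
    show ?thesis
    proof (cases b)
      case 0
      then have "j = r - 1" using j by (simp add: b_def)
      moreover have "Cmp Q (Idn Q T) f = f" using Idn_Cmp[OF f(1)] f(2) by simp
      ultimately show ?thesis
        using T r deg 0 Cons f tau_fib[OF f(1)] by (simp add: degen_gen_top)
    next
      case (Suc c)
      have "degen_gen Q (r - 1) j (Chain (fib Q f i) (fibre_arrows Q i f gs)) =
          Chain (fib Q f i) (fibre_arrows Q i f (insert_idn Q (Dom Q f) c gs))" if "i < crdn T" for i
      proof -
        have c: "r - 1 - j - 1 = c" and len: "j < r - 1" "r - 1 = Suc (length (fibre_arrows Q i f gs))"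
          using Suc j r T Cons by (simp_all add: b_def)
        show ?thesis
          unfolding degen_gen_Chain[OF len] c
          using fibre_arrows_insert_idn[of f i gs c] f that b Suc Cons by simp
      qed
      then show ?thesis
        using T deg Suc Cons by simp
    qed
  qed
qed

end

section \<open>The bijection of a map of finite ordinals\<close>

lemma Fin_Ar_iff: "g \<in> Ar Fin \<longleftrightarrow> fn g \<in> {..<fsrc g} \<rightarrow>\<^sub>E {..<ftgt g}"
  by (simp add: Fin_def)

lemma Fin_sel [simp]:
  "Dom Fin = fsrc" "Cod Fin = ftgt"
  "Cmp Fin g f = FMap (fsrc f) (compose {..<fsrc f} (fn g) (fn f)) (ftgt g)"
  by (simp_all add: Fin_def)

lemma fn_less: "\<lbrakk>g \<in> Ar Fin; j < fsrc g\<rbrakk> \<Longrightarrow> fn g j < ftgt g"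
  by (auto simp: Fin_Ar_iff)

lemma set_eps_list: "set (eps_list g i) = {j. j < fsrc g \<and> fn g j = i}"
  by (auto simp: eps_list_def)

lemma distinct_eps_list: "distinct (eps_list g i)"
  by (simp add: eps_list_def)

lemma length_eps_list: "length (eps_list g i) = fin_fibre g i"
  using distinct_card[OF distinct_eps_list, of g i] by (simp add: set_eps_list fin_fibre_def)

lemma eps_list_eq_map: "eps_list g i = map (eps g i) [0..<fin_fibre g i]"
  using map_nth[of "eps_list g i"] by (simp add: eps_def[abs_def] length_eps_list)

lemma eps_props:
  assumes "b < fin_fibre g i"
  shows "eps g i b < fsrc g" "fn g (eps g i b) = i"
  using nth_mem[of b "eps_list g i"] assms by (auto simp: length_eps_list set_eps_list eps_def)

lemma eps_inj: "\<lbrakk>a < fin_fibre g i; b < fin_fibre g i\<rbrakk> \<Longrightarrow> eps g i a = eps g i b \<longleftrightarrow> a = b"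
  by (simp add: eps_def nth_eq_iff_index_eq distinct_eps_list length_eps_list)

lemma eps_surj:
  assumes "j < fsrc g" "fn g j = i"
  obtains b where "b < fin_fibre g i" "eps g i b = j"
proof -
  have "j \<in> set (eps_list g i)" using assms by (simp add: set_eps_list)
  then show ?thesis using that by (auto simp: in_set_conv_nth eps_def length_eps_list)
qed

text \<open>The values of the inverse of \<open>\<pi>\<^sub>g\<close>, in order.\<close>

definition pi_list :: "fmap \<Rightarrow> nat list" where
  "pi_list g = concat (map (eps_list g) [0..<ftgt g])"

lemma set_pi_list: "g \<in> Ar Fin \<Longrightarrow> set (pi_list g) = {..<fsrc g}"
  by (auto simp: pi_list_def set_eps_list fn_less)

lemma distinct_pi_list: "distinct (pi_list g)"
proof -
  have "distinct (concat (map (eps_list g) xs))" if "distinct xs" for xs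
    using that by (induction xs) (auto simp: distinct_eps_list set_eps_list)
  then show ?thesis by (simp add: pi_list_def)
qed

lemma length_pi_list: "g \<in> Ar Fin \<Longrightarrow> length (pi_list g) = fsrc g"
  using distinct_card[OF distinct_pi_list, of g] by (simp add: set_pi_list)

lemma pi_perm_props:
  assumes "g \<in> Ar Fin" "j < fsrc g"
  shows "pi_perm g j < fsrc g" "pi_list g ! pi_perm g j = j"
proof -
  have "\<exists>!p. p < fsrc g \<and> pi_list g ! p = j"
    using distinct_Ex1[OF distinct_pi_list, of j g] assms by (simp add: set_pi_list length_pi_list)
  from theI'[OF this] show "pi_perm g j < fsrc g" "pi_list g ! pi_perm g j = j"
    using assms(2) by (simp_all add: pi_perm_def pi_list_def)
qed

lemma pi_perm_permutes:
  assumes "g \<in> Ar Fin"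
  shows "pi_perm g permutes {..<fsrc g}"
proof (rule bij_imp_permutes)
  have "inj_on (pi_perm g) {..<fsrc g}"
    by (rule inj_onI) (metis assms lessThan_iff pi_perm_props(2))
  moreover have "pi_perm g ` {..<fsrc g} \<subseteq> {..<fsrc g}"
    using pi_perm_props(1)[OF assms] by auto
  ultimately show "bij_betw (pi_perm g) {..<fsrc g} {..<fsrc g}"
    by (simp add: bij_betw_def endo_inj_surj)
qed (simp add: pi_perm_def)

text \<open>The bijection \<open>\<pi>\<^sub>g\<close> is the arrow that regroups any list indexed by the source of \<open>g\<close> according
  to the fibres of \<open>g\<close>.\<close>

lemma pi_arrow:
  assumes g: "g \<in> Ar Fin" and E: "\<And>j. j < fsrc g \<Longrightarrow> E j \<in> A"
  shows "SArr (map E [0..<fsrc g]) (pi_perm g) (map E (pi_list g)) \<in> Ar (FreeSM A)"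
  using pi_perm_props[OF g] set_pi_list[OF g] pi_perm_permutes[OF g] E
  by (intro FreeSM_ArI) (auto simp: length_pi_list[OF g])

lemma pi_perm_singleton:
  assumes g: "g \<in> Ar Fin" and "ftgt g = 1"
  shows "pi_perm g = id"
proof -
  have "fn g j = 0" if "j < fsrc g" for j using fn_less[OF g that] assms(2) by simp
  then have "pi_list g = [0..<fsrc g]"
    using assms(2) by (simp add: pi_list_def eps_list_def)
  then have "pi_perm g j = j" for j
    using pi_perm_props[OF g, of j] by (cases "j < fsrc g") (auto simp: pi_perm_def)
  then show ?thesis by auto
qed

text \<open>The definite description in the fibre map is well posed because \<open>\<epsilon>\<close> is an injection onto
  the fibre.\<close>

lemma fin_fibre_map_props:
  assumes h: "h \<in> Ar Fin" and g: "g \<in> Ar Fin" and hg: "ftgt h = fsrc g"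
    and a: "a < fin_fibre (Cmp Fin g h) i"
  shows "fn (fin_fibre_map h g i) a < fin_fibre g i"
    and "eps g i (fn (fin_fibre_map h g i) a) = fn h (eps (Cmp Fin g h) i a)"
proof -
  let ?j = "eps (Cmp Fin g h) i a"
  have j: "?j < fsrc h" "fn g (fn h ?j) = i"
    using eps_props[OF a] by (auto simp: compose_def)
  moreover have "fn h ?j < fsrc g" using fn_less[OF h j(1)] hg by simp
  ultimately obtain b where "b < fin_fibre g i" "eps g i b = fn h ?j"
    by (metis eps_surj)
  then have "\<exists>!b. b < fin_fibre g i \<and> eps g i b = fn h ?j"
    using eps_inj by metis
  from theI'[OF this] show "fn (fin_fibre_map h g i) a < fin_fibre g i"
    "eps g i (fn (fin_fibre_map h g i) a) = fn h ?j"
    using a by (simp_all add: fin_fibre_map_def)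
qed

lemma fin_fibre_map_Ar:
  assumes "h \<in> Ar Fin" "g \<in> Ar Fin" "ftgt h = fsrc g"
  shows "fin_fibre_map h g i \<in> Ar Fin"
proof -
  let ?q = "fin_fibre_map h g i"
  have q: "fsrc ?q = fin_fibre (Cmp Fin g h) i" "ftgt ?q = fin_fibre g i"
    by (simp_all add: fin_fibre_map_def)
  show ?thesis
    unfolding Fin_Ar_iff q
  proof (rule PiE_I)
    show "fn ?q a \<in> {..<fin_fibre g i}" if "a \<in> {..<fin_fibre (Cmp Fin g h) i}" for a
      using fin_fibre_map_props(1)[OF assms, of a i] that by simp
  qed (simp add: fin_fibre_map_def)
qed

text \<open>The fibre of \<open>h\<^sup>g\<^sub>i\<close> over \<open>b\<close>, embedded into the source of \<open>h\<close>, is the fibre of \<open>h\<close> over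
  \<open>\<epsilon> b\<close>.\<close>

lemma eps_list_fin_fibre_map:
  assumes h: "h \<in> Ar Fin" and g: "g \<in> Ar Fin" and hg: "ftgt h = fsrc g"
    and b: "b < fin_fibre g i"
  shows "map (eps (Cmp Fin g h) i) (eps_list (fin_fibre_map h g i) b) = eps_list h (eps g i b)"
proof -
  let ?gh = "Cmp Fin g h" and ?q = "fin_fibre_map h g i" and ?c = "eps g i b"
  have "fn ?q a = b \<longleftrightarrow> fn h (eps ?gh i a) = ?c" if "a < fin_fibre ?gh i" for a
    using fin_fibre_map_props[OF h g hg that] eps_inj[OF _ b, of "fn ?q a"] by metis
  then have "eps_list ?q b = filter (\<lambda>a. fn h (eps ?gh i a) = ?c) [0..<fin_fibre ?gh i]"
    by (auto simp: eps_list_def fin_fibre_map_def intro!: filter_cong)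
  then have "map (eps ?gh i) (eps_list ?q b) = filter (\<lambda>j. fn h j = ?c) (eps_list ?gh i)"
    by (simp only: eps_list_eq_map filter_map comp_def)
  also have "\<dots> = filter (\<lambda>j. fn h j = ?c) [0..<fsrc h]"
    using eps_props(2)[OF b] by (auto simp: eps_list_def compose_def intro!: filter_cong)
  finally show ?thesis by (simp add: eps_list_def)
qed

text \<open>If the target has no repeated entry, then an arrow has no choice where to send an entry of
  its source.\<close>

lemma FreeSM_parallel_arrows_eq:
  assumes u: "u \<in> Ar (FreeSM A)" and v: "v \<in> Ar (FreeSM B)"
    and "sdom u = sdom v" "scod u = scod v" "distinct (scod u)"
  shows "u = v"
proof (rule FreeSM_arrow_eqI[OF u v])
  fix k assume k: "k < length (sdom u)"
  have "scod u ! sperm u k = scod u ! sperm v k"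
    using sarr_nth[OF u k] sarr_nth[OF v, of k] k assms by simp
  moreover have "sperm u k < length (scod u)" "sperm v k < length (scod u)"
    using k sperm_less_iff[OF u, of k] sperm_less_iff[OF v, of k] assms(3,4)
      FreeSM_ArD(3)[OF u] FreeSM_ArD(3)[OF v] by simp_all
  ultimately show "sperm u k = sperm v k"
    using assms(5) by (simp add: nth_eq_iff_index_eq)
qed (use assms in simp_all)

text \<open>The combinatorial content of the cocycle equation.  Regrouping the source of \<open>h\<close> first by the fibres
  of \<open>h\<close> and then by those of \<open>g\<close> is the same as regrouping it first by the fibres of \<open>g h\<close> and then, inside each
  of them, by the fibres of \<open>h\<^sup>g\<^sub>i\<close>.  Both composites are arrows of the free symmetric monoidal groupoid
  on the natural numbers, from the list of all elements of the source of \<open>h\<close> to the same list without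
  repetitions, so they coincide.\<close>

lemma pi_cocycle:
  assumes h: "h \<in> Ar Fin" and g: "g \<in> Ar Fin" and hg: "ftgt h = fsrc g"
  defines "gh \<equiv> Cmp Fin g h"
  defines "\<theta> \<equiv> \<lambda>i. SArr (eps_list gh i) (pi_perm (fin_fibre_map h g i))
    (concat (map (eps_list h) (eps_list g i)))"
  shows "block_perm (eps_list h) (SArr [0..<fsrc g] (pi_perm g) (pi_list g)) \<circ> pi_perm h =
    sperm (ext_transformation (FreeSM (UNIV :: nat set)) \<theta> [0..<ftgt g]) \<circ> pi_perm gh"
proof -
  let ?F = "FreeSM (UNIV :: nat set)"
  have gh: "gh \<in> Ar Fin" "fsrc gh = fsrc h" "ftgt gh = ftgt g"
    using h g hg by (auto simp: gh_def Fin_Ar_iff compose_def)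
  let ?u1 = "SArr [0..<fsrc h] (pi_perm h) (pi_list h)"
  let ?u2 = "FA (ext_functor (eps_list h)) (SArr [0..<fsrc g] (pi_perm g) (pi_list g))"
  let ?v1 = "SArr [0..<fsrc h] (pi_perm gh) (pi_list gh)"
  let ?v2 = "ext_transformation ?F \<theta> [0..<ftgt g]"
  have u1: "?u1 \<in> Ar ?F" using pi_arrow[OF h, of id UNIV] by simp
  have u2: "?u2 \<in> Ar ?F"
    by (rule ext_functor_Ar[of UNIV]) (use pi_arrow[OF g, of id UNIV] in simp_all)
  have v1: "?v1 \<in> Ar ?F" using pi_arrow[OF gh(1), of id UNIV] gh(2) by simp
  have "\<theta> i \<in> hom ?F (eps_list gh i) (concat (map (eps_list h) (eps_list g i)))" for i
  proof -
    let ?q = "fin_fibre_map h g i"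
    have q: "?q \<in> Ar Fin" "fsrc ?q = fin_fibre gh i" "ftgt ?q = fin_fibre g i"
      using fin_fibre_map_Ar[OF h g hg] by (simp_all add: fin_fibre_map_def gh_def)
    \<comment> \<open>Embedding the fibre of \<open>g h\<close> over \<open>i\<close> turns the regrouping by \<open>?q\<close> into the component \<open>\<theta> i\<close>.\<close>
    have "map (eps gh i) (pi_list ?q) =
        concat (map (\<lambda>b. map (eps gh i) (eps_list ?q b)) [0..<fin_fibre g i])"
      by (simp add: pi_list_def q(3) map_concat comp_def)
    also have "\<dots> = concat (map (\<lambda>b. eps_list h (eps g i b)) [0..<fin_fibre g i])"
      using eps_list_fin_fibre_map[OF h g hg] by (auto simp: gh_def intro!: arg_cong[of _ _ concat])
    also have "\<dots> = concat (map (eps_list h) (eps_list g i))"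
      by (simp add: eps_list_eq_map[of g] comp_def)
    finally show ?thesis
      using pi_arrow[OF q(1), of "eps gh i" UNIV] q(2)
      by (simp add: \<theta>_def FreeSM_hom_iff eps_list_eq_map[of gh])
  qed
  then have v2: "?v2 \<in> hom ?F (concat (map (eps_list gh) [0..<ftgt g]))
      (concat (map (\<lambda>i. concat (map (eps_list h) (eps_list g i))) [0..<ftgt g]))"
    by (intro ext_transformation_hom[of UNIV]) simp_all
  have cod: "concat (map (\<lambda>i. concat (map (eps_list h) (eps_list g i))) xs) =
      concat (map (eps_list h) (concat (map (eps_list g) xs)))" for xs
    by (induction xs) simp_all
  have "SArr (sdom ?u1) (sperm ?u2 \<circ> sperm ?u1) (scod ?u2) =
      SArr (sdom ?v1) (sperm ?v2 \<circ> sperm ?v1) (scod ?v2)"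
  proof (rule FreeSM_parallel_arrows_eq)
    show "SArr (sdom ?u1) (sperm ?u2 \<circ> sperm ?u1) (scod ?u2) \<in> Ar ?F"
      by (rule FreeSM_Cmp_Ar[OF u1 u2]) (simp add: pi_list_def hg)
    show "SArr (sdom ?v1) (sperm ?v2 \<circ> sperm ?v1) (scod ?v2) \<in> Ar ?F"
      by (rule FreeSM_Cmp_Ar[OF v1]) (use v2 gh in \<open>simp_all add: FreeSM_hom_iff pi_list_def\<close>)
    show "scod (SArr (sdom ?u1) (sperm ?u2 \<circ> sperm ?u1) (scod ?u2)) =
        scod (SArr (sdom ?v1) (sperm ?v2 \<circ> sperm ?v1) (scod ?v2))"
      using v2 by (simp add: FreeSM_hom_iff pi_list_def cod)
    have "distinct (concat (map (eps_list h) xs))" if "distinct xs" for xs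
      using that by (induction xs) (auto simp: distinct_eps_list set_eps_list)
    then show "distinct (scod (SArr (sdom ?u1) (sperm ?u2 \<circ> sperm ?u1) (scod ?u2)))"
      by (simp add: distinct_pi_list)
  qed simp
  then show ?thesis by simp
qed

section \<open>The operators of the nerve\<close>

lemma ssm_functor_fcomp:
  assumes "ssm_functor C D F" "ssm_functor D E G"
  shows "ssm_functor C E (G \<odot> F)"
proof -
  interpret F: ssm_functor C D F by fact
  interpret G: ssm_functor D E G by fact
  have F_Ar: "FA F f \<in> Ar D" if "f \<in> Ar C" for f
    using F.ar_map[of f "Dom C f" "Cod C f"] that by (simp add: hom_def)
  show ?thesis
    by unfold_locales
      (simp_all add: fcomp_def F.ob_map G.ob_map F.ar_map G.ar_map F.map_idn G.map_idn
        F.map_cmp G.map_cmp[OF F.ar_map F.ar_map] F.map_TO G.map_TO F.map_MU G.map_MU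
        F.map_TA G.map_TA F_Ar F.map_Sym G.map_Sym)
qed

lemma ext_functor_square:
  assumes "\<And>x. x \<in> A \<Longrightarrow> \<psi> x \<in> lists B" "\<And>y. y \<in> B \<Longrightarrow> \<phi> y \<in> lists D"
    and "\<And>x. x \<in> A \<Longrightarrow> \<psi>' x \<in> lists B'" "\<And>y. y \<in> B' \<Longrightarrow> \<phi>' y \<in> lists D"
    and "\<And>x. x \<in> A \<Longrightarrow> concat (map \<phi> (\<psi> x)) = concat (map \<phi>' (\<psi>' x))"
  shows "feq (FreeSM A) (ext_functor \<phi> \<odot> ext_functor \<psi>) (ext_functor \<phi>' \<odot> ext_functor \<psi>')"
proof -
  have 1: "feq (FreeSM A) (ext_functor \<phi> \<odot> ext_functor \<psi>) (ext_functor (\<lambda>x. concat (map \<phi> (\<psi> x))))"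
    by (rule ext_functor_fcomp, erule assms(1), erule assms(2))
  have 2: "feq (FreeSM A) (ext_functor (\<lambda>x. concat (map \<phi> (\<psi> x))))
      (ext_functor (\<lambda>x. concat (map \<phi>' (\<psi>' x))))"
    by (rule ext_functor_cong, erule assms(5))
  have 3: "feq (FreeSM A) (ext_functor \<phi>' \<odot> ext_functor \<psi>')
      (ext_functor (\<lambda>x. concat (map \<phi>' (\<psi>' x))))"
    by (rule ext_functor_fcomp, erule assms(3), erule assms(4))
  show ?thesis by (rule feq_trans[OF 1 feq_trans[OF 2 feq_sym[OF 3]]])
qed

definition face_gen :: "('o, 'a) opcat \<Rightarrow> nat \<Rightarrow> nat \<Rightarrow> ('o, 'a) gen \<Rightarrow> ('o, 'a) gen list" where
  "face_gen Q r i p = (if i < r then [omit Q (r - i) p] else top_face Q p)"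

lemma nerve_face_eq: "nerve_face Q r i = ext_functor (face_gen Q r i)"
  by (simp add: nerve_face_def face_gen_def[abs_def])

text \<open>The entry at \<open>i\<close> of the top face, uniformly for chains of length one and of greater length.\<close>

definition fibre_gen :: "('o, 'a) opcat \<Rightarrow> 'o \<Rightarrow> 'a list \<Rightarrow> nat \<Rightarrow> ('o, 'a) gen" where
  "fibre_gen Q T fs i = (case fs of [] \<Rightarrow> Comp (component Q (fib Q (Idn Q T) i))
    | f # gs \<Rightarrow> Chain (fib Q f i) (fibre_arrows Q i f gs))"

lemma top_face_eq: "top_face Q (Chain T fs) = map (fibre_gen Q T fs) [0..<FO (crd Q) T]"
  by (cases fs) (simp_all add: fibre_gen_def)

declare nerve_gen.simps [simp del]

context operadic_category
begin

abbreviation N :: "nat \<Rightarrow> (('o, 'a) gen list, ('o, 'a) gen sarr) moncat" where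
  "N r \<equiv> FreeSM (nerve_gen Q r)"

abbreviation nbeta :: "nat \<Rightarrow> ('o, 'a) gen list \<Rightarrow> ('o, 'a) gen sarr" where
  "nbeta r \<equiv> ext_transformation (N r) (beta_gen Q r)"

lemma face_gen_in: "p \<in> nerve_gen Q (Suc r) \<Longrightarrow> i \<le> Suc r \<Longrightarrow> face_gen Q (Suc r) i p \<in> lists (nerve_gen Q r)"
  using omit_in_gens[of p r "Suc r - i"] top_face_in_gens[of p r] by (auto simp: face_gen_def)

lemma nerve_face_ssm: "i \<le> Suc r \<Longrightarrow> ssm_functor (N (Suc r)) (N r) (nerve_face Q (Suc r) i)"
  unfolding nerve_face_eq using face_gen_in by (intro ext_functor_ssm) blast

lemma nerve_degen_ssm: "i \<le> r \<Longrightarrow> ssm_functor (N r) (N (Suc r)) (nerve_degen Q r i)"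
  unfolding nerve_degen_def using degen_gen_in_gens by (intro ext_functor_ssm) auto

lemma nerve_face_face:
  assumes "i < j" "j \<le> r + 2" "\<not> (i = r + 1 \<and> j = r + 2)"
  shows "feq (N (r + 2)) (nerve_face Q (r + 1) i \<odot> nerve_face Q (r + 2) j)
    (nerve_face Q (r + 1) (j - 1) \<odot> nerve_face Q (r + 2) i)"
  unfolding nerve_face_eq
proof (rule ext_functor_square[of _ _ "nerve_gen Q (r + 1)" _ "nerve_gen Q r" _ "nerve_gen Q (r + 1)"])
  fix p assume p: "p \<in> nerve_gen Q (r + 2)"
  show "concat (map (face_gen Q (r + 1) i) (face_gen Q (r + 2) j p)) =
    concat (map (face_gen Q (r + 1) (j - 1)) (face_gen Q (r + 2) i p))"
  proof (cases "j < r + 2")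
    case True
    then have "j - 1 < r + 1" using assms(1) by simp
    then show ?thesis
      using True assms omit_omit[OF p, of "r + 2 - j" "r + 1 - i"]
      by (simp add: face_gen_def Suc_diff_le)
  next
    case False
    then show ?thesis
      using assms top_face_omit[OF p, of "r + 1 - i"]
      by (simp add: face_gen_def[abs_def] Suc_diff_le concat_map_singleton)
  qed
qed (use assms face_gen_in[of _ "Suc r"] face_gen_in[of _ r] in
  \<open>simp_all del: in_lists_conv_set\<close>)

lemma nerve_degen_degen:
  assumes "i \<le> j" "j \<le> r"
  shows "feq (N r) (nerve_degen Q (r + 1) i \<odot> nerve_degen Q r j)
    (nerve_degen Q (r + 1) (j + 1) \<odot> nerve_degen Q r i)"
  unfolding nerve_degen_def
  by (rule ext_functor_square[of _ _ "nerve_gen Q (r + 1)" _ "nerve_gen Q (r + 2)"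
        _ "nerve_gen Q (r + 1)"])
    (use assms degen_gen_in_gens[of _ r] degen_gen_in_gens[of _ "Suc r"] in
      \<open>auto simp: degen_gen_degen_gen\<close>)

lemma nerve_face_degen_less:
  assumes "i < j" "j \<le> r"
  shows "feq (N r) (nerve_face Q (r + 1) i \<odot> nerve_degen Q r j)
    (nerve_degen Q (r - 1) (j - 1) \<odot> nerve_face Q r i)"
proof -
  obtain m where r: "r = Suc m" using assms by (cases r) auto
  show ?thesis
    unfolding nerve_degen_def nerve_face_eq
    by (rule ext_functor_square[of _ _ "nerve_gen Q (r + 1)" _ "nerve_gen Q r"
          _ "nerve_gen Q (r - 1)"])
      (use assms r degen_gen_in_gens[of _ r] degen_gen_in_gens[of _ m] face_gen_in[of _ r i]
        face_gen_in[of _ m i] in \<open>auto simp: face_gen_def omit_degen_gen_less\<close>)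
qed

lemma nerve_face_degen_id:
  assumes "j \<le> r" "i = j \<or> i = j + 1"
  shows "feq (N r) (nerve_face Q (r + 1) i \<odot> nerve_degen Q r j) idf"
proof (rule feq_trans[OF _ ext_functor_idf])
  have i: "i \<le> Suc r" using assms by auto
  have "feq (N r) (nerve_face Q (r + 1) i \<odot> nerve_degen Q r j)
    (ext_functor (\<lambda>p. concat (map (face_gen Q (r + 1) i) [degen_gen Q r j p])))"
    unfolding nerve_degen_def nerve_face_eq
    by (rule ext_functor_fcomp[of _ _ "nerve_gen Q (r + 1)" _ "nerve_gen Q r"])
      (use assms(1) degen_gen_in_gens[of _ r] face_gen_in[OF _ i] in
        \<open>simp_all del: in_lists_conv_set\<close>)
  moreover have "concat (map (face_gen Q (r + 1) i) [degen_gen Q r j p]) = [p]"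
    if p: "p \<in> nerve_gen Q r" for p
  proof (cases "i \<le> r")
    case True
    then show ?thesis using omit_degen_gen_id[OF p] assms by (auto simp: face_gen_def)
  next
    case False
    then have "i = Suc r" "j = r" using assms by auto
    then show ?thesis using top_face_degen_gen_top[OF p] by (simp add: face_gen_def)
  qed
  ultimately show "feq (N r) (nerve_face Q (r + 1) i \<odot> nerve_degen Q r j) (ext_functor (\<lambda>p. [p]))"
    by (rule feq_trans[OF _ ext_functor_cong])
qed

lemma nerve_face_degen_greater:
  assumes "j + 1 < i" "i \<le> r + 1"
  shows "feq (N r) (nerve_face Q (r + 1) i \<odot> nerve_degen Q r j)
    (nerve_degen Q (r - 1) j \<odot> nerve_face Q r (i - 1))"
proof -
  obtain m where r: "r = Suc m" using assms by (cases r) auto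
  have "concat (map (face_gen Q (r + 1) i) [degen_gen Q r j p]) =
    concat (map (\<lambda>q. [degen_gen Q (r - 1) j q]) (face_gen Q r (i - 1) p))"
    if p: "p \<in> nerve_gen Q r" for p
  proof (cases "i \<le> r")
    case True
    then have "r - (i - 1) = Suc r - i" "i - 1 < r" using assms by auto
    then show ?thesis using omit_degen_gen_greater[OF p, of j i] assms True by (simp add: face_gen_def)
  next
    case False
    then have "i = Suc r" "j < r" using assms by auto
    then show ?thesis
      using top_face_degen_gen[OF p, of j] by (simp add: face_gen_def concat_map_singleton)
  qed
  then show ?thesis
    unfolding nerve_degen_def nerve_face_eq
    by (intro ext_functor_square[of _ _ "nerve_gen Q (r + 1)" _ "nerve_gen Q r"
          _ "nerve_gen Q (r - 1)"])
      (use assms r degen_gen_in_gens[of _ r j] degen_gen_in_gens[of _ m j] face_gen_in[of _ r i]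
        face_gen_in[of _ m "i - 1"] in auto)
qed

section \<open>The two-cells of the nerve\<close>

lemma crd_arrow:
  assumes "f \<in> Ar Q"
  shows "FA (crd Q) f \<in> Ar Fin" "fsrc (FA (crd Q) f) = crdn (Dom Q f)"
    "ftgt (FA (crd Q) f) = crdn (Cod Q f)"
  using cat_functor.ar_map[OF cardinality_functor in_hom[OF assms]] by (simp_all add: hom_def)

lemma crd_Cmp:
  assumes "f \<in> Ar Q" "h \<in> Ar Q" "Cod Q h = Dom Q f"
  shows "FA (crd Q) (Cmp Q f h) = Cmp Fin (FA (crd Q) f) (FA (crd Q) h)"
  using cat_functor.map_cmp[OF cardinality_functor, of h "Dom Q h" "Dom Q f" f "Cod Q f"] assms
  by (simp add: hom_def)

lemma crd_fib: "\<lbrakk>f \<in> Ar Q; i < crdn (Cod Q f)\<rbrakk> \<Longrightarrow> crdn (fib Q f i) = fin_fibre (FA (crd Q) f) i"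
  using A3_ob[OF in_hom] by blast

text \<open>The second application of the top face to the fibre over \<open>i\<close> yields the entries of
  the top face of the chain without \<open>T\<^sub>1\<close>, at the elements of the fibre of \<open>|f|\<close> over \<open>i\<close>.\<close>

lemma top_face_fibre_gen:
  assumes f: "f \<in> Ar Q" and fs: "is_chain Q (Dom Q f) fs" and i: "i < crdn (Cod Q f)"
  shows "top_face Q (fibre_gen Q T (f # fs) i) =
    map (fibre_gen Q (Dom Q f) fs) (eps_list (FA (crd Q) f) i)"
proof -
  have S: "Dom Q f \<in> Ob Q" using f dom_in by blast
  have "fibre_gen Q (fib Q f i) (fibre_arrows Q i f fs) b =
      fibre_gen Q (Dom Q f) fs (eps (FA (crd Q) f) i b)" if b: "b < fin_fibre (FA (crd Q) f) i" for b
  proof (cases fs)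
    case Nil
    \<comment> \<open>The fibre map of an identity is the identity of the fibre.\<close>
    have "fib Q (fibmap Q (Idn Q (Dom Q f)) f i) b =
        fib Q (Idn Q (Dom Q f)) (eps (FA (crd Q) f) i b)"
      using A5_ob[OF idn_hom[OF S] in_hom[OF f] i b] .
    then show ?thesis using Nil fibmap_Idn[OF f i] by (simp add: fibre_gen_def)
  next
    case (Cons h hs)
    then have h: "h \<in> Ar Q" "Cod Q h = Dom Q f" "is_chain Q (Dom Q h) hs" using fs by auto
    have "h \<in> hom Q (Dom Q h) (Dom Q f)" using h by (simp add: hom_def)
    from A5_ob[OF this in_hom[OF f] i b] Cons show ?thesis
      using fibre_arrows_fibre_arrows[OF f h(1,2) i b h(3)] by (simp add: fibre_gen_def)
  qed
  then show ?thesis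
    by (simp add: fibre_gen_def[of Q T] top_face_eq crd_fib[OF f i] eps_list_eq_map)
qed

lemma top_face_top_face:
  assumes "is_chain Q T (f # fs)"
  shows "concat (map (top_face Q) (top_face Q (Chain T (f # fs)))) =
    map (fibre_gen Q (Dom Q f) fs) (pi_list (FA (crd Q) f))"
proof -
  have f: "f \<in> Ar Q" "Cod Q f = T" "is_chain Q (Dom Q f) fs" using assms by auto
  have "map (top_face Q) (top_face Q (Chain T (f # fs))) =
      map (\<lambda>i. map (fibre_gen Q (Dom Q f) fs) (eps_list (FA (crd Q) f) i)) [0..<crdn T]"
    using top_face_fibre_gen[OF f(1,3)] f(2) by (simp add: top_face_eq del: top_face.simps)
  then show ?thesis
    using crd_arrow(3)[OF f(1)] f(2) by (simp add: pi_list_def map_concat comp_def del: top_face.simps)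
qed

lemma gens_Suc_SucE:
  assumes "p \<in> nerve_gen Q (Suc (Suc m))"
  obtains T f fs where "p = Chain T (f # fs)" "is_chain Q T (f # fs)" "length fs = m"
    "f \<in> Ar Q" "Cod Q f = T" "is_chain Q (Dom Q f) fs"
proof -
  obtain T gs where T: "p = Chain T gs" "is_chain Q T gs" "length gs = Suc m"
    using assms by (rule gens_SucE)
  then obtain f fs where "gs = f # fs" by (cases gs) auto
  with T show ?thesis using that by auto
qed

text \<open>Source and target of the two-cell have the same entries: the source lists them over \<open>|T\<^sub>2|\<close>, and
  the target lists them fibrewise over \<open>|T\<^sub>1|\<close>.\<close>

lemma beta_gen_Chain:
  assumes "is_chain Q T (f # fs)"
  shows "beta_gen Q r (Chain T (f # fs)) =
    SArr (map (fibre_gen Q (Dom Q f) fs) [0..<fsrc (FA (crd Q) f)]) (pi_perm (FA (crd Q) f))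
      (map (fibre_gen Q (Dom Q f) fs) (pi_list (FA (crd Q) f)))"
  using top_face_top_face[OF assms] assms omit_1_Chain[of Q T f fs]
  by (simp add: beta_gen_def fcomp_def nerve_face_eq face_gen_def[abs_def] top_face_eq crd_arrow
    del: top_face.simps)

lemma beta_gen_hom:
  assumes p: "p \<in> nerve_gen Q (r + 2)"
  shows "beta_gen Q r p \<in> hom (N r)
    (concat (map (face_gen Q (r + 1) (r + 1)) (face_gen Q (r + 2) (r + 1) p)))
    (concat (map (face_gen Q (r + 1) (r + 1)) (face_gen Q (r + 2) (r + 2) p)))"
proof -
  obtain T f fs where T: "p = Chain T (f # fs)" "is_chain Q T (f # fs)" "length fs = r"
    "f \<in> Ar Q" "Cod Q f = T" "is_chain Q (Dom Q f) fs"
    by (rule gens_Suc_SucE[of p r]) (use p in simp_all)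
  have "Chain (Dom Q f) fs \<in> nerve_gen Q (Suc r)" using T gens_SucI by blast
  from top_face_in_gens[OF this]
  have "fibre_gen Q (Dom Q f) fs j \<in> nerve_gen Q r" if "j < fsrc (FA (crd Q) f)" for j
    using that crd_arrow(2)[OF T(4)] by (auto simp: top_face_eq simp del: top_face.simps)
  from pi_arrow[OF crd_arrow(1)[OF T(4)] this] show ?thesis
    using beta_gen_Chain[OF T(2), of r] T(1)
    by (auto simp: FreeSM_hom_iff beta_gen_def fcomp_def nerve_face_eq)
qed

lemma nbeta_monoidal:
  "invertible_monoidal_transformation (N (r + 2)) (N r)
    (nerve_face Q (r + 1) (r + 1) \<odot> nerve_face Q (r + 2) (r + 1))
    (nerve_face Q (r + 1) (r + 1) \<odot> nerve_face Q (r + 2) (r + 2)) (nbeta r)"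
proof (rule monoidal_transformation_feq[OF _ ext_transformation_monoidal[OF beta_gen_hom]])
  show "category (N (r + 2))" using FreeSM_ssm_groupoid ssm_groupoid.axioms(1) by blast
  have "feq (N (r + 2)) (ext_functor
      (\<lambda>p. concat (map (face_gen Q (r + 1) (r + 1)) (face_gen Q (r + 2) j p))))
      (nerve_face Q (r + 1) (r + 1) \<odot> nerve_face Q (r + 2) j)" if "j \<le> r + 2" for j
    unfolding nerve_face_eq
    by (rule feq_sym, rule ext_functor_fcomp[of _ _ "nerve_gen Q (r + 1)" _ "nerve_gen Q r"])
      (use that face_gen_in[of _ "Suc r" j] face_gen_in[of _ r "Suc r"] in
        \<open>simp_all del: in_lists_conv_set\<close>)
  from this[of "r + 1"] this[of "r + 2"]
  show "feq (N (r + 2)) (ext_functor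
      (\<lambda>p. concat (map (face_gen Q (r + 1) (r + 1)) (face_gen Q (r + 2) (r + 1) p))))
      (nerve_face Q (r + 1) (r + 1) \<odot> nerve_face Q (r + 2) (r + 1))"
    "feq (N (r + 2)) (ext_functor
      (\<lambda>p. concat (map (face_gen Q (r + 1) (r + 1)) (face_gen Q (r + 2) (r + 2) p))))
      (nerve_face Q (r + 1) (r + 1) \<odot> nerve_face Q (r + 2) (r + 2))" by simp_all
qed

lemma nbeta_singleton:
  assumes "p \<in> nerve_gen Q (r + 2)"
  shows "nbeta r [p] = beta_gen Q r p"
  by (rule ext_transformation_singleton[OF _ refl])
    (use beta_gen_hom[OF assms] in \<open>simp only: FreeSM_hom_iff\<close>)

end

section \<open>Coherence\<close>

lemma fcomp_assoc: "(F \<odot> G) \<odot> H = F \<odot> (G \<odot> H)"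
  by (simp add: fcomp_def)

lemma feq_refl: "feq C F F"
  by (simp add: feq_def)

lemma feq_fcomp_left: "feq C F G \<Longrightarrow> feq C (H \<odot> F) (H \<odot> G)"
  by (simp add: feq_def fcomp_def)

lemma feq_fcomp_right:
  assumes "cat_functor C D H" "feq D F G"
  shows "feq C (F \<odot> H) (G \<odot> H)"
proof -
  interpret cat_functor C D H by fact
  have "FA H f \<in> Ar D" if "f \<in> Ar C" for f
    using ar_map[of f "Dom C f" "Cod C f"] that by (simp add: hom_def)
  then show ?thesis using assms(2) by (simp add: feq_def fcomp_def ob_map)
qed

lemma ssm_functorD: "ssm_functor C D F \<Longrightarrow> cat_functor C D F"
  by (rule ssm_functor.axioms(1))

lemma FreeSM_category: "category (FreeSM A)"
  using FreeSM_ssm_groupoid ssm_groupoid.axioms(1) by blast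

text \<open>To compare two pastings of two-cells it suffices to identify their source and target
  functors, which is a matter of strict simplicial identities, and to compare permutations at generators.\<close>

lemma teq_FreeSM_I:
  assumes \<eta>: "invertible_monoidal_transformation (FreeSM A) (FreeSM B) F G \<eta>"
    and \<theta>: "invertible_monoidal_transformation (FreeSM A) (FreeSM B) F' G' \<theta>"
    and F: "feq (FreeSM A) F F'" and G: "feq (FreeSM A) G G'"
    and perm: "\<And>x. x \<in> A \<Longrightarrow> sperm (\<eta> [x]) = sperm (\<theta> [x])"
  shows "teq (FreeSM A) \<eta> \<theta>"
proof (rule monoidal_transformation_determined_by_generators[OF \<eta> \<theta>])
  fix x assume x: "x \<in> A"
  then have Ob: "[x] \<in> Ob (FreeSM A)" by simp
  have "\<eta> [x] \<in> hom (FreeSM B) (FO F [x]) (FO G [x])"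
    by (rule nat_transformation.component_hom[OF invertible_monoidal_transformation.axioms(1)[OF \<eta>] Ob])
  moreover have "\<theta> [x] \<in> hom (FreeSM B) (FO F' [x]) (FO G' [x])"
    by (rule nat_transformation.component_hom[OF invertible_monoidal_transformation.axioms(1)[OF \<theta>] Ob])
  moreover have "FO F [x] = FO F' [x]" "FO G [x] = FO G' [x]"
    using F G Ob unfolding feq_def by blast+
  ultimately show "\<eta> [x] = \<theta> [x]"
    using perm[OF x] by (intro sarr.expand) (simp add: FreeSM_hom_iff)
qed

context operadic_category
begin

lemma nerve_face_ssm_shifts:
  "i \<le> r + 1 \<Longrightarrow> ssm_functor (N (r + 1)) (N r) (nerve_face Q (r + 1) i)"
  "i \<le> r + 2 \<Longrightarrow> ssm_functor (N (r + 2)) (N (r + 1)) (nerve_face Q (r + 2) i)"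
  "i \<le> r + 3 \<Longrightarrow> ssm_functor (N (r + 3)) (N (r + 2)) (nerve_face Q (r + 3) i)"
  using nerve_face_ssm[of i r] nerve_face_ssm[of i "r + 1"] nerve_face_ssm[of i "r + 2"]
  by (simp_all add: numeral_3_eq_3)

lemma nbeta_face_monoidal:
  assumes "j \<le> r + 3"
  shows "invertible_monoidal_transformation (N (r + 3)) (N r)
    (nerve_face Q (r + 1) (r + 1) \<odot> nerve_face Q (r + 2) (r + 1) \<odot> nerve_face Q (r + 3) j)
    (nerve_face Q (r + 1) (r + 1) \<odot> nerve_face Q (r + 2) (r + 2) \<odot> nerve_face Q (r + 3) j)
    (rwhisker (nbeta r) (nerve_face Q (r + 3) j))"
  by (rule rwhisker_monoidal[OF nbeta_monoidal]) (rule nerve_face_ssm_shifts(3)[OF assms])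

lemma face_nbeta_monoidal:
  assumes "i \<le> r + 1"
  shows "invertible_monoidal_transformation (N (r + 3)) (N r)
    (nerve_face Q (r + 1) i \<odot> (nerve_face Q (r + 2) (r + 2) \<odot> nerve_face Q (r + 3) (r + 2)))
    (nerve_face Q (r + 1) i \<odot> (nerve_face Q (r + 2) (r + 2) \<odot> nerve_face Q (r + 3) (r + 3)))
    (lwhisker (nerve_face Q (r + 1) i) (nbeta (r + 1)))"
proof (rule lwhisker_monoidal[where D = "N (r + 1)"])
  show "invertible_monoidal_transformation (N (r + 3)) (N (r + 1))
      (nerve_face Q (r + 2) (r + 2) \<odot> nerve_face Q (r + 3) (r + 2))
      (nerve_face Q (r + 2) (r + 2) \<odot> nerve_face Q (r + 3) (r + 3)) (nbeta (r + 1))"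
    using nbeta_monoidal[of "r + 1"] by (simp add: numeral_3_eq_3)
  show "ssm_functor (N (r + 1)) (N r) (nerve_face Q (r + 1) i)"
    by (rule nerve_face_ssm_shifts(1)[OF assms])
  have "ssm_functor (N (r + 3)) (N (r + 1)) (nerve_face Q (r + 2) (r + 2) \<odot> nerve_face Q (r + 3) j)"
    if "j \<le> r + 3" for j
    using that by (intro ssm_functor_fcomp[OF nerve_face_ssm_shifts(3) nerve_face_ssm_shifts(2)]) simp_all
  then show "cat_functor (N (r + 3)) (N (r + 1)) (nerve_face Q (r + 2) (r + 2) \<odot> nerve_face Q (r + 3) (r + 2))"
    "cat_functor (N (r + 3)) (N (r + 1)) (nerve_face Q (r + 2) (r + 2) \<odot> nerve_face Q (r + 3) (r + 3))"
    by (simp_all add: ssm_functorD)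
qed (rule FreeSM_category FreeSM_ssm_groupoid)+

lemma nerve_face_face_upper:
  assumes "i < j" "j \<le> r + 3" "\<not> (i = r + 2 \<and> j = r + 3)"
  shows "feq (N (r + 3)) (nerve_face Q (r + 2) i \<odot> nerve_face Q (r + 3) j)
    (nerve_face Q (r + 2) (j - 1) \<odot> nerve_face Q (r + 3) i)"
  using nerve_face_face[of i j "r + 1"] assms by (simp add: numeral_3_eq_3)

text \<open>The entry at \<open>j\<close> of the source of the two-cell is the chain of fibres over \<open>j\<close>, and its top face has
  \<open>|h|\<^sup>-\<^sup>1(j)\<close> entries; hence the block \<open>j\<close> may be replaced by the fibre of \<open>|h|\<close> over \<open>j\<close>.\<close>

lemma face_beta_gen_sperm:
  assumes p: "p = Chain T (f # h # fs)" "is_chain Q T (f # h # fs)"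
  shows "block_perm (face_gen Q (r + 1) (r + 1)) (beta_gen Q (r + 1) p) =
    block_perm (eps_list (FA (crd Q) h))
      (SArr [0..<fsrc (FA (crd Q) f)] (pi_perm (FA (crd Q) f)) (pi_list (FA (crd Q) f)))"
proof -
  let ?E = "fibre_gen Q (Dom Q f) (h # fs)"
  have fh: "f \<in> Ar Q" "h \<in> Ar Q" "Cod Q h = Dom Q f" using p by auto
  have len: "length (face_gen Q (r + 1) (r + 1) (?E j)) = length (eps_list (FA (crd Q) h) j)"
    if "j < fsrc (FA (crd Q) f)" for j
    using that fh crd_arrow(2)[OF fh(1)] crd_fib[OF fh(2), of j]
    by (simp add: face_gen_def fibre_gen_def top_face_eq length_eps_list)
  show ?thesis
    unfolding p(1) beta_gen_Chain[OF p(2)]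
    by (rule block_perm_cong) (use len set_pi_list[OF crd_arrow(1)[OF fh(1)]] in auto)
qed

text \<open>On the chain of fibres over \<open>i\<close> the two-cell is governed by the fibre map of \<open>h\<close>, whose underlying
  map of finite ordinals is the fibre map of \<open>|h|\<close>.\<close>

lemma beta_gen_top_face_sperm:
  assumes p: "p = Chain T (f # h # fs)" "is_chain Q T (f # h # fs)"
  shows "sperm (nbeta r (top_face Q p)) =
    sperm (ext_transformation (FreeSM (UNIV :: nat set))
      (\<lambda>i. SArr (eps_list (Cmp Fin (FA (crd Q) f) (FA (crd Q) h)) i)
        (pi_perm (fin_fibre_map (FA (crd Q) h) (FA (crd Q) f) i))
        (concat (map (eps_list (FA (crd Q) h)) (eps_list (FA (crd Q) f) i))))
      [0..<ftgt (FA (crd Q) f)])"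
proof (rule ext_transformation_sperm_cong)
  have f: "f \<in> Ar Q" and h: "h \<in> Ar Q" and fh: "Cod Q h = Dom Q f" "Cod Q f = T"
    and fs: "is_chain Q (Dom Q h) fs" using p by auto
  let ?P = "fibre_gen Q T (f # h # fs)"
  have P: "length (sdom (beta_gen Q r (?P i))) =
        length (eps_list (Cmp Fin (FA (crd Q) f) (FA (crd Q) h)) i) \<and>
      sperm (beta_gen Q r (?P i)) = pi_perm (fin_fibre_map (FA (crd Q) h) (FA (crd Q) f) i)"
    if i: "i < crdn T" for i
  proof -
    let ?m = "fibmap Q h f i" and ?fh = "Cmp Q f h"
    have m: "?m \<in> Ar Q" "Dom Q ?m = fib Q ?fh i"
      using fibmap_props[OF h f fh(1)] i fh by simp_all
    have "is_chain Q (fib Q f i) (fibre_arrows Q i f (h # fs))"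
      using f i fh p by (intro is_chain_fibre_arrows) auto
    then have c: "is_chain Q (fib Q f i) (?m # fibre_arrows Q i ?fh fs)" by simp
    have "FA (crd Q) ?m = fin_fibre_map (FA (crd Q) h) (FA (crd Q) f) i"
      using A3_ar[of h "Dom Q h" "Dom Q f" f T i] f h fh i by (simp add: hom_def)
    moreover have "crdn (fib Q ?fh i) = fin_fibre (Cmp Fin (FA (crd Q) f) (FA (crd Q) h)) i"
      using crd_fib[of ?fh i] Cmp_props[OF f h fh(1)] i fh crd_Cmp[OF f h fh(1)] by simp
    ultimately show ?thesis
      using beta_gen_Chain[OF c, of r] m crd_arrow(2)[OF m(1)]
      by (simp add: fibre_gen_def length_eps_list)
  qed
  then show "map (\<lambda>x. (length (sdom (beta_gen Q r x)), sperm (beta_gen Q r x))) (top_face Q p) =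
    map (\<lambda>i. (length (sdom (SArr (eps_list (Cmp Fin (FA (crd Q) f) (FA (crd Q) h)) i)
        (pi_perm (fin_fibre_map (FA (crd Q) h) (FA (crd Q) f) i))
        (concat (map (eps_list (FA (crd Q) h)) (eps_list (FA (crd Q) f) i))))),
      sperm (SArr (eps_list (Cmp Fin (FA (crd Q) f) (FA (crd Q) h)) i)
        (pi_perm (fin_fibre_map (FA (crd Q) h) (FA (crd Q) f) i))
        (concat (map (eps_list (FA (crd Q) h)) (eps_list (FA (crd Q) f) i))))))
      [0..<ftgt (FA (crd Q) f)]"
    unfolding p(1) top_face_eq using crd_arrow(3)[OF f] fh by simp
qed

text \<open>Both sides run from triple faces of a chain \<open>\<dots> \<rightarrow> T\<^sub>3 \<rightarrow> T\<^sub>2 \<rightarrow> T\<^sub>1\<close> with last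
  arrows \<open>h\<close> and \<open>f\<close>; their permutations are those of \<open>pi_cocycle\<close> for \<open>|h|\<close> and \<open>|f|\<close>.\<close>

theorem nbeta_cocycle:
  "teq (N (r + 3))
    (vcomp (N r)
      (lwhisker (nerve_face Q (r + 1) (r + 1)) (nbeta (r + 1)))
      (rwhisker (nbeta r) (nerve_face Q (r + 3) (r + 2))))
    (vcomp (N r)
      (rwhisker (nbeta r) (nerve_face Q (r + 3) (r + 3)))
      (rwhisker (nbeta r) (nerve_face Q (r + 3) (r + 1))))"
proof (rule teq_FreeSM_I)
  let ?A = "nerve_face Q (r + 1) (r + 1)"
  let ?B = "\<lambda>j. nerve_face Q (r + 2) j" and ?C = "\<lambda>k. nerve_face Q (r + 3) k"
  have cf: "cat_functor (N (r + 3)) (N r) (?A \<odot> ?B j \<odot> ?C k)" if "j \<le> r + 2" "k \<le> r + 3" for j k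
    using that
    by (intro ssm_functorD ssm_functor_fcomp[OF nerve_face_ssm_shifts(3)
          ssm_functor_fcomp[OF nerve_face_ssm_shifts(2) nerve_face_ssm_shifts(1)]]) simp_all
  show "invertible_monoidal_transformation (N (r + 3)) (N r)
      (?A \<odot> ?B (r + 1) \<odot> ?C (r + 2)) (?A \<odot> ?B (r + 2) \<odot> ?C (r + 3))
      (vcomp (N r) (lwhisker ?A (nbeta (r + 1))) (rwhisker (nbeta r) (?C (r + 2))))"
    by (rule vcomp_monoidal[OF nbeta_face_monoidal face_nbeta_monoidal[of "r + 1", folded fcomp_assoc]])
      ((rule cf feq_refl FreeSM_category FreeSM_ssm_groupoid | simp)+)
  show "invertible_monoidal_transformation (N (r + 3)) (N r)
      (?A \<odot> ?B (r + 1) \<odot> ?C (r + 1)) (?A \<odot> ?B (r + 2) \<odot> ?C (r + 3))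
      (vcomp (N r) (rwhisker (nbeta r) (?C (r + 3))) (rwhisker (nbeta r) (?C (r + 1))))"
  proof (rule vcomp_monoidal[OF nbeta_face_monoidal nbeta_face_monoidal])
    show "feq (N (r + 3)) (?A \<odot> ?B (r + 2) \<odot> ?C (r + 1)) (?A \<odot> ?B (r + 1) \<odot> ?C (r + 3))"
      using nerve_face_face_upper[of "r + 1" "r + 3" r, THEN feq_sym]
      unfolding fcomp_assoc by - (rule feq_fcomp_left, simp)
  qed ((rule cf FreeSM_category FreeSM_ssm_groupoid | simp)+)
  show "feq (N (r + 3)) (?A \<odot> ?B (r + 1) \<odot> ?C (r + 2)) (?A \<odot> ?B (r + 1) \<odot> ?C (r + 1))"
    using nerve_face_face_upper[of "r + 1" "r + 2" r]
    unfolding fcomp_assoc by - (rule feq_fcomp_left, simp)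
  show "feq (N (r + 3)) (?A \<odot> ?B (r + 2) \<odot> ?C (r + 3)) (?A \<odot> ?B (r + 2) \<odot> ?C (r + 3))"
    by (rule feq_refl)
next
  fix p assume p: "p \<in> nerve_gen Q (r + 3)"
  then have p': "p \<in> nerve_gen Q (Suc (Suc (Suc r)))" by (simp add: numeral_3_eq_3)
  then obtain T f gs where T: "p = Chain T (f # gs)" "is_chain Q T (f # gs)" "length gs = Suc r"
      "f \<in> Ar Q" "Cod Q f = T" "is_chain Q (Dom Q f) gs"
    by (rule gens_Suc_SucE)
  then obtain h fs where gs: "gs = h # fs" "length fs = r" by (cases gs) auto
  have h: "h \<in> Ar Q" "Cod Q h = Dom Q f" using T gs by auto
  let ?f = "FA (crd Q) f" and ?h = "FA (crd Q) h"
  have om1: "omit Q 1 p = Chain (Dom Q f) (h # fs)" using T gs omit_1_Chain by simp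
  have om2: "omit Q 2 p = Chain T (Cmp Q f h # fs)" using T gs omit_Chain[of 0 "f # gs" Q T] by (simp add: numeral_2_eq_2)
  have in2: "omit Q k p \<in> nerve_gen Q (r + 2)" if "1 \<le> k" "k \<le> 2" for k
    using omit_in_gens[OF p' that(1)] that by simp
  have "sperm (rwhisker (nbeta r) (nerve_face Q (r + 3) (r + 2)) [p]) = pi_perm ?h"
    using nbeta_singleton[OF in2[of 1]] om1
    by (simp add: rwhisker_def nerve_face_eq face_gen_def beta_gen_def)
  moreover have "sperm (rwhisker (nbeta r) (nerve_face Q (r + 3) (r + 1)) [p]) =
      pi_perm (Cmp Fin ?f ?h)"
    using nbeta_singleton[OF in2[of 2]] om2 crd_Cmp[OF T(4) h]
    by (simp add: rwhisker_def nerve_face_eq face_gen_def beta_gen_def)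
  moreover have "sperm (lwhisker (nerve_face Q (r + 1) (r + 1)) (nbeta (r + 1)) [p]) =
      block_perm (eps_list ?h) (SArr [0..<fsrc ?f] (pi_perm ?f) (pi_list ?f))"
    using nbeta_singleton[of p "r + 1"] p face_beta_gen_sperm[of p T f h fs r] T gs
    by (simp add: lwhisker_def nerve_face_eq numeral_3_eq_3)
  moreover have "sperm (rwhisker (nbeta r) (nerve_face Q (r + 3) (r + 3)) [p]) =
      sperm (nbeta r (top_face Q p))"
    by (simp add: rwhisker_def nerve_face_eq face_gen_def)
  ultimately show "sperm (vcomp (N r) (lwhisker (nerve_face Q (r + 1) (r + 1)) (nbeta (r + 1)))
      (rwhisker (nbeta r) (nerve_face Q (r + 3) (r + 2))) [p]) =
    sperm (vcomp (N r) (rwhisker (nbeta r) (nerve_face Q (r + 3) (r + 3)))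
      (rwhisker (nbeta r) (nerve_face Q (r + 3) (r + 1))) [p])"
    using beta_gen_top_face_sperm[of p T f h fs r] T gs
      pi_cocycle[OF crd_arrow(1)[OF h(1)] crd_arrow(1)[OF T(4)]] crd_arrow(2)[OF T(4)]
      crd_arrow(3)[OF h(1)] h(2)
    by (simp add: vcomp_def del: Fin_sel top_face.simps)
qed

text \<open>The faces in question omit an object beyond \<open>T\<^sub>2\<close>, so the arrow into \<open>T\<^sub>1\<close>, which determines the
  permutation, is unchanged.\<close>

theorem nbeta_face:
  assumes i: "i \<le> r"
  shows "teq (N (r + 3)) (lwhisker (nerve_face Q (r + 1) i) (nbeta (r + 1)))
    (rwhisker (nbeta r) (nerve_face Q (r + 3) i))"
proof (rule teq_FreeSM_I)
  let ?A = "\<lambda>i. nerve_face Q (r + 1) i"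
  let ?B = "\<lambda>j. nerve_face Q (r + 2) j" and ?C = "\<lambda>k. nerve_face Q (r + 3) k"
  show "invertible_monoidal_transformation (N (r + 3)) (N r)
      (?A i \<odot> (?B (r + 2) \<odot> ?C (r + 2))) (?A i \<odot> (?B (r + 2) \<odot> ?C (r + 3)))
      (lwhisker (?A i) (nbeta (r + 1)))"
    using i by (intro face_nbeta_monoidal) simp
  show "invertible_monoidal_transformation (N (r + 3)) (N r)
      (?A (r + 1) \<odot> ?B (r + 1) \<odot> ?C i) (?A (r + 1) \<odot> ?B (r + 2) \<odot> ?C i)
      (rwhisker (nbeta r) (?C i))"
    using i by (intro nbeta_face_monoidal) simp
  have AB: "feq (N (r + 3)) (?A i \<odot> (?B (r + 2) \<odot> ?C k)) (?A (r + 1) \<odot> (?B i \<odot> ?C k))"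
    if "k \<le> r + 3" for k
    unfolding fcomp_assoc[symmetric]
  proof (rule feq_fcomp_right)
    show "cat_functor (N (r + 3)) (N (r + 2)) (?C k)"
      by (rule ssm_functorD[OF nerve_face_ssm_shifts(3)[OF that]])
    show "feq (N (r + 2)) (?A i \<odot> ?B (r + 2)) (?A (r + 1) \<odot> ?B i)"
      using nerve_face_face[of i "r + 2" r] i by simp
  qed
  show "feq (N (r + 3)) (?A i \<odot> (?B (r + 2) \<odot> ?C (r + 2))) (?A (r + 1) \<odot> ?B (r + 1) \<odot> ?C i)"
    using nerve_face_face_upper[of i "r + 2" r] i unfolding fcomp_assoc
    by (intro feq_trans[OF AB feq_fcomp_left]) simp_all
  show "feq (N (r + 3)) (?A i \<odot> (?B (r + 2) \<odot> ?C (r + 3))) (?A (r + 1) \<odot> ?B (r + 2) \<odot> ?C i)"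
    using nerve_face_face_upper[of i "r + 3" r] i unfolding fcomp_assoc
    by (intro feq_trans[OF AB feq_fcomp_left]) simp_all
next
  fix p assume p: "p \<in> nerve_gen Q (r + 3)"
  then have p': "p \<in> nerve_gen Q (Suc (Suc (Suc r)))" by (simp add: numeral_3_eq_3)
  then obtain T f gs where T: "p = Chain T (f # gs)" "is_chain Q T (f # gs)" "length gs = Suc r"
    by (rule gens_Suc_SucE)
  \<comment> \<open>The index \<open>r + 3 - i\<close> is at least three, so that the omitted object lies beyond \<open>f\<close>.\<close>
  have k: "r + 3 - i = Suc (r - i) + 2" using i by simp
  have om: "omit Q (r + 3 - i) p = Chain T (f # omit_at Q (r - i) gs)"
    unfolding k T(1) using omit_Chain[of "Suc (r - i)" "f # gs" Q T] T(3) by simp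
  have om_in: "omit Q (r + 3 - i) p \<in> nerve_gen Q (r + 2)"
    using omit_in_gens[OF p', of "r + 3 - i"] i by simp
  have b: "nbeta (r + 1) [p] = beta_gen Q (r + 1) p"
    using p by (intro nbeta_singleton) (simp add: numeral_3_eq_3)
  have Ar: "beta_gen Q (r + 1) p \<in> Ar (N (r + 1))"
    using beta_gen_hom[of p "r + 1"] p by (simp add: FreeSM_hom_iff numeral_3_eq_3)
  have beta_perm: "sperm (beta_gen Q (r + 1) p) = pi_perm (FA (crd Q) f)"
    by (simp add: beta_gen_def T(1))
  have "face_gen Q (r + 1) i = (\<lambda>q. [omit Q (r + 1 - i) q])"
    using i by (simp add: face_gen_def[abs_def])
  then have "sperm (lwhisker (nerve_face Q (r + 1) i) (nbeta (r + 1)) [p]) = pi_perm (FA (crd Q) f)"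
    unfolding lwhisker_def b nerve_face_eq
    using ext_functor_singletons[OF Ar, of "omit Q (r + 1 - i)"] beta_perm
    by (simp del: ext_functor_sel(2))
  moreover have "sperm (rwhisker (nbeta r) (nerve_face Q (r + 3) i) [p]) = pi_perm (FA (crd Q) f)"
    using nbeta_singleton[OF om_in] om i
    by (simp add: rwhisker_def nerve_face_eq face_gen_def beta_gen_def)
  ultimately show "sperm (lwhisker (nerve_face Q (r + 1) i) (nbeta (r + 1)) [p]) =
    sperm (rwhisker (nbeta r) (nerve_face Q (r + 3) i) [p])" by simp
qed

text \<open>The last arrow of the degenerate chain is a terminal map, with underlying map into a
  one-element ordinal: there is a single fibre and nothing is regrouped.\<close>

theorem nbeta_degen_top:
  "teq (N (r + 1)) (rwhisker (nbeta r) (nerve_degen Q (r + 1) (r + 1)))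
    (tid (N r) (nerve_face Q (r + 1) (r + 1) \<odot> nerve_face Q (r + 2) (r + 1) \<odot>
      nerve_degen Q (r + 1) (r + 1)))"
proof (rule teq_FreeSM_I)
  let ?A = "nerve_face Q (r + 1) (r + 1)" and ?B = "\<lambda>j. nerve_face Q (r + 2) j"
  let ?S = "nerve_degen Q (r + 1) (r + 1)"
  have S: "ssm_functor (N (r + 1)) (N (r + 2)) ?S" using nerve_degen_ssm[of "r + 1" "r + 1"] by simp
  show "invertible_monoidal_transformation (N (r + 1)) (N r)
      (?A \<odot> ?B (r + 1) \<odot> ?S) (?A \<odot> ?B (r + 2) \<odot> ?S) (rwhisker (nbeta r) ?S)"
    by (rule rwhisker_monoidal[OF nbeta_monoidal S])
  have "ssm_functor (N (r + 1)) (N r) (?A \<odot> ?B (r + 1) \<odot> ?S)"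
    by (intro ssm_functor_fcomp[OF S] ssm_functor_fcomp[OF nerve_face_ssm_shifts(2)
          nerve_face_ssm_shifts(1)]) simp_all
  then show "invertible_monoidal_transformation (N (r + 1)) (N r)
      (?A \<odot> ?B (r + 1) \<odot> ?S) (?A \<odot> ?B (r + 1) \<odot> ?S) (tid (N r) (?A \<odot> ?B (r + 1) \<odot> ?S))"
    by (rule tid_monoidal[OF _ FreeSM_category FreeSM_ssm_groupoid])
  show "feq (N (r + 1)) (?A \<odot> ?B (r + 1) \<odot> ?S) (?A \<odot> ?B (r + 1) \<odot> ?S)"
    by (rule feq_refl)
  have "feq (N (r + 1)) (?B (r + 2) \<odot> ?S) idf" "feq (N (r + 1)) (?B (r + 1) \<odot> ?S) idf"
    using nerve_face_degen_id[of "r + 1" "r + 1"] by simp_all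
  then show "feq (N (r + 1)) (?A \<odot> ?B (r + 2) \<odot> ?S) (?A \<odot> ?B (r + 1) \<odot> ?S)"
    unfolding fcomp_assoc using feq_trans[OF _ feq_sym] by (intro feq_fcomp_left) blast
next
  fix p assume p: "p \<in> nerve_gen Q (r + 1)"
  then have p': "p \<in> nerve_gen Q (Suc r)" by simp
  then obtain T fs where T: "p = Chain T fs" "is_chain Q T fs" "length fs = r"
    by (rule gens_SucE)
  have TO: "T \<in> Ob Q" by (rule is_chain_Ob[OF T(2)])
  have "degen_gen Q (r + 1) (r + 1) p \<in> nerve_gen Q (r + 2)"
    using degen_gen_in_gens[OF p', of "Suc r"] by simp
  moreover have "pi_perm (FA (crd Q) (tau Q T)) = id"
    using tau_props[OF TO] crd_arrow[of "tau Q T"] crd_lterm[OF TO] by (intro pi_perm_singleton) simp_all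
  ultimately show "sperm (rwhisker (nbeta r) (nerve_degen Q (r + 1) (r + 1)) [p]) =
    sperm (tid (N r) (nerve_face Q (r + 1) (r + 1) \<odot> nerve_face Q (r + 2) (r + 1) \<odot>
      nerve_degen Q (r + 1) (r + 1)) [p])"
    using nbeta_singleton[of "degen_gen Q (r + 1) (r + 1) p" r] degen_gen_top[of Q "Suc r" T fs] T(1)
    by (simp add: rwhisker_def tid_def nerve_degen_def beta_gen_def)
qed

text \<open>The identity is inserted beyond the arrow into \<open>T\<^sub>1\<close>, which determines the permutation.\<close>

theorem nbeta_degen:
  assumes i: "i \<le> r"
  shows "teq (N (r + 2)) (rwhisker (nbeta (r + 1)) (nerve_degen Q (r + 2) i))
    (lwhisker (nerve_degen Q r i) (nbeta r))"
proof (rule teq_FreeSM_I)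
  let ?A = "nerve_face Q (r + 1) (r + 1)" and ?B = "\<lambda>j. nerve_face Q (r + 2) j"
  let ?C = "\<lambda>k. nerve_face Q (r + 3) k"
  have S2: "ssm_functor (N (r + 2)) (N (r + 3)) (nerve_degen Q (r + 2) i)"
    using nerve_degen_ssm[of i "r + 2"] i by (simp add: numeral_3_eq_3)
  show "invertible_monoidal_transformation (N (r + 2)) (N (r + 1))
      (?B (r + 2) \<odot> ?C (r + 2) \<odot> nerve_degen Q (r + 2) i)
      (?B (r + 2) \<odot> ?C (r + 3) \<odot> nerve_degen Q (r + 2) i)
      (rwhisker (nbeta (r + 1)) (nerve_degen Q (r + 2) i))"
    using rwhisker_monoidal[OF nbeta_monoidal[of "r + 1"], of "N (r + 2)"] S2 by (simp add: numeral_3_eq_3)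
  have cf: "cat_functor (N (r + 2)) (N r) (?A \<odot> ?B j)" if "j \<le> r + 2" for j
    using that
    by (intro ssm_functorD ssm_functor_fcomp[OF nerve_face_ssm_shifts(2) nerve_face_ssm_shifts(1)])
      simp_all
  show "invertible_monoidal_transformation (N (r + 2)) (N (r + 1))
      (nerve_degen Q r i \<odot> (?A \<odot> ?B (r + 1))) (nerve_degen Q r i \<odot> (?A \<odot> ?B (r + 2)))
      (lwhisker (nerve_degen Q r i) (nbeta r))"
    by (rule lwhisker_monoidal[OF nbeta_monoidal])
      (use nerve_degen_ssm[OF i] cf in \<open>simp_all add: FreeSM_category FreeSM_ssm_groupoid\<close>)
  have "feq (N (r + 2)) (?B (r + 2) \<odot> ?C (Suc j) \<odot> nerve_degen Q (r + 2) i)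
      (nerve_degen Q r i \<odot> (?A \<odot> ?B j))" if j: "r < j" "j \<le> r + 2" for j
  proof (rule feq_trans)
    show "feq (N (r + 2)) (?B (r + 2) \<odot> ?C (Suc j) \<odot> nerve_degen Q (r + 2) i)
        (?B (r + 2) \<odot> (nerve_degen Q (r + 1) i \<odot> ?B j))"
      using nerve_face_degen_greater[of i "Suc j" "r + 2"] i j unfolding fcomp_assoc
      by (intro feq_fcomp_left) (simp add: numeral_3_eq_3)
    show "feq (N (r + 2)) (?B (r + 2) \<odot> (nerve_degen Q (r + 1) i \<odot> ?B j))
        (nerve_degen Q r i \<odot> (?A \<odot> ?B j))"
      unfolding fcomp_assoc[symmetric]
    proof (rule feq_fcomp_right)
      show "cat_functor (N (r + 2)) (N (r + 1)) (?B j)"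
        by (rule ssm_functorD[OF nerve_face_ssm_shifts(2)[OF j(2)]])
      show "feq (N (r + 1)) (?B (r + 2) \<odot> nerve_degen Q (r + 1) i) (nerve_degen Q r i \<odot> ?A)"
        using nerve_face_degen_greater[of i "r + 2" "r + 1"] i by simp
    qed
  qed
  from this[of "r + 1"] this[of "r + 2"]
  show "feq (N (r + 2)) (?B (r + 2) \<odot> ?C (r + 2) \<odot> nerve_degen Q (r + 2) i)
      (nerve_degen Q r i \<odot> (?A \<odot> ?B (r + 1)))"
    "feq (N (r + 2)) (?B (r + 2) \<odot> ?C (r + 3) \<odot> nerve_degen Q (r + 2) i)
      (nerve_degen Q r i \<odot> (?A \<odot> ?B (r + 2)))" by (simp_all add: numeral_3_eq_3)
next
  fix p assume p: "p \<in> nerve_gen Q (r + 2)"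
  then have p': "p \<in> nerve_gen Q (Suc (Suc r))" by simp
  then obtain T f fs where T: "p = Chain T (f # fs)" "is_chain Q T (f # fs)" "length fs = r"
    by (rule gens_Suc_SucE)
  have "degen_gen Q (r + 2) i p = Chain T (insert_idn Q T (Suc (r - i)) (f # fs))"
    using T degen_gen_Chain[of i "r + 2" "f # fs" Q T] i by (simp add: Suc_diff_le)
  then have deg: "degen_gen Q (r + 2) i p = Chain T (f # insert_idn Q (Dom Q f) (r - i) fs)" by simp
  have deg_in: "degen_gen Q (r + 2) i p \<in> nerve_gen Q (r + 1 + 2)"
    using degen_gen_in_gens[OF p', of i] i by simp
  have Ar: "beta_gen Q r p \<in> Ar (N r)"
    using beta_gen_hom[OF p] by (simp only: FreeSM_hom_iff)
  have beta_perm: "sperm (beta_gen Q r p) = pi_perm (FA (crd Q) f)"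
    by (simp add: beta_gen_def T(1))
  have "sperm (rwhisker (nbeta (r + 1)) (nerve_degen Q (r + 2) i) [p]) = pi_perm (FA (crd Q) f)"
    using nbeta_singleton[OF deg_in] deg by (simp add: rwhisker_def nerve_degen_def beta_gen_def)
  moreover have "sperm (lwhisker (nerve_degen Q r i) (nbeta r) [p]) = pi_perm (FA (crd Q) f)"
    using ext_functor_singletons[OF Ar, of "degen_gen Q r i"] beta_perm
    by (simp add: lwhisker_def nerve_degen_def nbeta_singleton[OF p]
      del: ext_functor_sel(2) ext_transformation_simps)
  ultimately show "sperm (rwhisker (nbeta (r + 1)) (nerve_degen Q (r + 2) i) [p]) =
    sperm (lwhisker (nerve_degen Q r i) (nbeta r) [p])" by simp
qed

lemma operadic_nerve_sel:
  "deg (operadic_nerve Q) r = N r" "face (operadic_nerve Q) = nerve_face Q"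
  "degen (operadic_nerve Q) = nerve_degen Q" "beta (operadic_nerve Q) r = nbeta r"
  by (simp_all add: operadic_nerve_def)

end

theorem theorem5p4:
  fixes Q :: "('o, 'a) opcat"
  assumes "operadic_category Q"
  shows "coherent_pseudosimplicial_ssm_groupoid (operadic_nerve Q)"
proof -
  interpret operadic_category Q by fact
  show ?thesis
    by (intro coherent_pseudosimplicial_ssm_groupoid.intro presimplicial_ssm_groupoid.intro
        coherent_pseudosimplicial_ssm_groupoid_axioms.intro; unfold operadic_nerve_sel)
      ((rule FreeSM_ssm_groupoid nerve_face_ssm nerve_degen_ssm nbeta_monoidal nerve_face_face
        nerve_degen_degen nerve_face_degen_less nerve_face_degen_id nerve_face_degen_greater
        nbeta_cocycle nbeta_face nbeta_degen_top nbeta_degen; assumption)+)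
qed

end
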